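(* Let $\theta \in H^2(\mathbb{D}^2)$ be an inner function, and let $n \ge 0$ be an integer. Then the commutator $[S_{z_1}^*, S_{z_1}] = S_{z_1}^*S_{z_1} - S_{z_1}S_{z_1}^*$ on $\mathcal{K}_\theta$ has rank $n$ if and only if $\theta$ is a rational inner function of degree $(1,n)$ or $(0,n)$.
   Context: $H^2(\mathbb{D}^2)$ is the Hardy space on the bidisk, with variables $z=(z_1,z_2)$. An inner function $\theta$ on $\mathbb{D}^2$ is a bounded holomorphic function on $\mathbb{D}^2$ whose radial boundary values satisfy $|\theta|=1$ almost everywhere on $\mathbb{T}^2$ (unimodular constants are included). For $\theta$ inner, $\mathcal{K}_\theta = H^2(\mathbb{D}^2)\ominus \theta H^2(\mathbb{D}^2)$, $P_\theta$ is the orthogonal projection of $H^2(\mathbb{D}^2)$ onto $\mathcal{K}_\theta$, $T_{z_1}$ is multiplication by $z_1$ on $H^2(\mathbb{D}^2)$, and the compressed shift is $S_{z_1} = P_\theta T_{z_1}|_{\mathcal{K}_\theta}$. A rational inner function $\theta$ has degree $(m_1,m_2)$ if $\theta = p/q$ with $p,q$ polynomials in $z_1,z_2$ sharing no common factor, where, for $j=1,2$, $m_j$ is the maximum of the degrees of $p$ and $q$ in $z_j$. *)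

theory Defs
  imports
    "HOL-Analysis.Analysis"
    "HOL-Computational_Algebra.Polynomial"
    "HOL-Library.Function_Algebras"
begin

definition bidisk :: "(complex \<times> complex) set" where
  "bidisk = ball 0 1 \<times> ball 0 1"

subsection \<open>The Hardy space of the bidisk\<close>

definition has_power_series ::
  "(complex \<times> complex \<Rightarrow> complex) \<Rightarrow> (nat \<times> nat \<Rightarrow> complex) \<Rightarrow> bool" where
  "has_power_series f a \<longleftrightarrow>
     (\<forall>(z1, z2) \<in> bidisk. ((\<lambda>(j, k). a (j, k) * z1 ^ j * z2 ^ k) has_sum f (z1, z2)) UNIV)"

text \<open>
  Functions on the bidisk are represented by total functions vanishing off the bidisk, so that
  equality in the Hardy space is equality of HOL functions.
\<close>

definition hardy :: "(complex \<times> complex \<Rightarrow> complex) set" where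
  "hardy = {f. (\<forall>z. z \<notin> bidisk \<longrightarrow> f z = 0) \<and>
               (\<exists>a. has_power_series f a \<and> (\<lambda>i. (cmod (a i))\<^sup>2) summable_on UNIV)}"

definition taylor_coeff ::
  "(complex \<times> complex \<Rightarrow> complex) \<Rightarrow> nat \<times> nat \<Rightarrow> complex" where
  "taylor_coeff f = (THE a. has_power_series f a)"

definition hardy_inner ::
  "(complex \<times> complex \<Rightarrow> complex) \<Rightarrow> (complex \<times> complex \<Rightarrow> complex) \<Rightarrow> complex" where
  "hardy_inner f g = (\<Sum>\<^sub>\<infinity>i\<in>UNIV. taylor_coeff f i * cnj (taylor_coeff g i))"

subsection \<open>Inner functions and rational inner functions\<close>

definition holomorphic2_on ::
  "(complex \<times> complex \<Rightarrow> complex) \<Rightarrow> (complex \<times> complex) set \<Rightarrow> bool" where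
  "holomorphic2_on f S \<longleftrightarrow>
     (\<forall>z\<in>S. \<exists>a b. (f has_derivative (\<lambda>(v, w). a * v + b * w)) (at z within S))"

text \<open>
  Null sets of the torus are those of Lebesgue measure on \<open>[0, 2 \<pi>] \<times> [0, 2 \<pi>]\<close> under the
  parametrisation \<open>(s, t) \<mapsto> (e\<^sup>i\<^sup>s, e\<^sup>i\<^sup>t)\<close>.
\<close>

definition inner_function :: "(complex \<times> complex \<Rightarrow> complex) \<Rightarrow> bool" where
  "inner_function \<theta> \<longleftrightarrow>
     holomorphic2_on \<theta> bidisk \<and> bounded (\<theta> ` bidisk) \<and>
     (AE (s, t) in lebesgue_on ({0..2 * pi} \<times> {0..2 * pi}).
        \<exists>l. ((\<lambda>r. \<theta> (of_real r * cis s, of_real r * cis t)) \<longlongrightarrow> l) (at_left 1) \<and> cmod l = 1)"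

text \<open>
  A bivariate polynomial is an element of \<open>\<complex>[z\<^sub>1][z\<^sub>2]\<close>: the outer variable is \<open>z\<^sub>2\<close>, the inner
  one \<open>z\<^sub>1\<close>. The units of this ring are the nonzero constants, so \<^const>\<open>coprime\<close> means having no
  common factor in the usual sense.
\<close>

definition poly2 :: "complex poly poly \<Rightarrow> complex \<times> complex \<Rightarrow> complex" where
  "poly2 p = (\<lambda>(z1, z2). poly (poly p [:z2:]) z1)"

definition degree_z1 :: "complex poly poly \<Rightarrow> nat" where
  "degree_z1 p = Max ((\<lambda>i. degree (coeff p i)) ` {..degree p})"

definition degree_z2 :: "complex poly poly \<Rightarrow> nat" where
  "degree_z2 p = degree p"

definition rational_inner_of_degree ::
  "(complex \<times> complex \<Rightarrow> complex) \<Rightarrow> nat \<times> nat \<Rightarrow> bool" where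
  "rational_inner_of_degree \<theta> m \<longleftrightarrow> inner_function \<theta> \<and>
     (\<exists>p q. coprime p q \<and>
        (\<forall>z\<in>bidisk. poly2 q z \<noteq> 0 \<and> \<theta> z = poly2 p z / poly2 q z) \<and>
        m = (max (degree_z1 p) (degree_z1 q), max (degree_z2 p) (degree_z2 q)))"

subsection \<open>The compressed shift\<close>

definition model_space ::
  "(complex \<times> complex \<Rightarrow> complex) \<Rightarrow> (complex \<times> complex \<Rightarrow> complex) set" where
  "model_space \<theta> = {f \<in> hardy. \<forall>g\<in>hardy. hardy_inner f (\<lambda>z. \<theta> z * g z) = 0}"

definition hardy_proj ::
  "(complex \<times> complex \<Rightarrow> complex) set \<Rightarrow> (complex \<times> complex \<Rightarrow> complex) \<Rightarrow>
     complex \<times> complex \<Rightarrow> complex" where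
  "hardy_proj K f = (THE h. h \<in> K \<and> (\<forall>g\<in>K. hardy_inner (f - h) g = 0))"

definition shift_z1 ::
  "(complex \<times> complex \<Rightarrow> complex) \<Rightarrow> complex \<times> complex \<Rightarrow> complex" where
  "shift_z1 f = (\<lambda>z. fst z * f z)"

definition compressed_shift_z1 ::
  "(complex \<times> complex \<Rightarrow> complex) \<Rightarrow> (complex \<times> complex \<Rightarrow> complex) \<Rightarrow>
     complex \<times> complex \<Rightarrow> complex" where
  "compressed_shift_z1 \<theta> f = hardy_proj (model_space \<theta>) (shift_z1 f)"

definition hardy_adjoint ::
  "(complex \<times> complex \<Rightarrow> complex) set \<Rightarrow>
     ((complex \<times> complex \<Rightarrow> complex) \<Rightarrow> complex \<times> complex \<Rightarrow> complex) \<Rightarrow>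
     (complex \<times> complex \<Rightarrow> complex) \<Rightarrow> complex \<times> complex \<Rightarrow> complex" where
  "hardy_adjoint K A g = (THE h. h \<in> K \<and> (\<forall>f\<in>K. hardy_inner (A f) g = hardy_inner f h))"

definition commutator :: "(('a \<Rightarrow> complex) \<Rightarrow> 'a \<Rightarrow> complex) \<Rightarrow> (('a \<Rightarrow> complex) \<Rightarrow> 'a \<Rightarrow> complex) \<Rightarrow>
    ('a \<Rightarrow> complex) \<Rightarrow> 'a \<Rightarrow> complex" where
  "commutator A B f = A (B f) - B (A f)"

subsection \<open>Rank\<close>

interpretation cfun: vector_space "\<lambda>(c::complex) (f::'a \<Rightarrow> complex) x. c * f x"
  by unfold_locales (auto simp: fun_eq_iff algebra_simps)

text \<open>
  An explicit finite basis is required because \<^const>\<open>vector_space.dim\<close> is \<open>0\<close> on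
  infinite-dimensional spaces.
\<close>

definition has_rank_on ::
  "(('a \<Rightarrow> complex) \<Rightarrow> 'a \<Rightarrow> complex) \<Rightarrow> ('a \<Rightarrow> complex) set \<Rightarrow> nat \<Rightarrow> bool" where
  "has_rank_on A K n \<longleftrightarrow>
     (\<exists>B. finite B \<and> card B = n \<and> cfun.independent B \<and> cfun.span B = A ` K)"

end

(* Write theta = phi + z1 * psi with phi a function of z2, and let A h = psi * h and B h = P_theta h
   for functions h of z2. The commutator is C = B B* - A A*, and z1 * C f is a difference
   (phi w + z1 x) - theta (w + z1 y) with w = A* f, x = B* f and y = T_phi* x. Every element of the
   kernel of C therefore exhibits theta as a Moebius transformation in z1 over functions of z2.

   If C has finite rank, a limit of such elements has a polynomial x, and theta being inner makes
   the other coefficients rational. Conversely, let theta = (v + z1 x) / (w + z1 y) be in lowest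
   terms, of degree m in z2. Unless theta depends on z2 alone, unique factorization applied to the
   reflection of this fraction on the torus shows that x is a multiple of z2^m * conj(w(1/conj z2)).
   Then w * C f is determined by a polynomial of degree less than m, so the rank is at most m. It is
   at least m, because x, whose m zeros lie in the disk, divides the polynomial of degree at most
   rank C that occurs in the limiting argument. If theta depends on z2 alone, C is essentially the
   projection onto the m-dimensional one-variable model space. *)

theory Submission
  imports
    Defs
    "HOL-Computational_Algebra.Computational_Algebra"
    "HOL-Computational_Algebra.Field_as_Ring"
begin

section \<open>Square-summable families\<close>

text \<open>Until the section on Fourier series a function is its power series, and of |theta| = 1
  on the torus only the identity \<open>ip (\<theta> * f) (\<theta> * g) = ip f g\<close> is kept.
  Equations that hold on the torus, such as conj(theta) (v + z1 x) = w + z1 y, are used in weak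
  form, as equations between inner products. Boundary values enter once, to prove that identity.

  The obstacle is that an element f of the kernel of C only gives square-summable w and x, from
  which no rationality follows. A rank of at most k yields a polynomial x because, up to closure,
  the functions f(0, .) with f in the kernel have codimension at most k among the functions of z2,
  whereas 1, z2, ..., z2^k are k + 1 functions. The price of the closure is that w has to be
  followed to the limit; this works because C = B B* - A A* vanishes on f, so that B* f and A* f
  have equal norms.\<close>

definition l2 :: "('i \<Rightarrow> complex) \<Rightarrow> bool" where
  "l2 a \<longleftrightarrow> (\<lambda>i. (cmod (a i))\<^sup>2) summable_on UNIV"

definition lip :: "('i \<Rightarrow> complex) \<Rightarrow> ('i \<Rightarrow> complex) \<Rightarrow> complex" where
  "lip a b = (\<Sum>\<^sub>\<infinity>i\<in>UNIV. a i * cnj (b i))"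

definition lsq :: "('i \<Rightarrow> complex) \<Rightarrow> real" where
  "lsq a = (\<Sum>\<^sub>\<infinity>i\<in>UNIV. (cmod (a i))\<^sup>2)"

lemma l2_prod_abs_summable:
  assumes "l2 a" "l2 b"
  shows "(\<lambda>i. norm (a i * cnj (b i))) summable_on UNIV"
proof (rule summable_on_comparison_test)
  show "(\<lambda>i. (cmod (a i))\<^sup>2 + (cmod (b i))\<^sup>2) summable_on UNIV"
    using assms unfolding l2_def by (rule summable_on_add)
  fix i
  have "2 * (cmod (a i) * cmod (b i)) \<le> (cmod (a i))\<^sup>2 + (cmod (b i))\<^sup>2"
    using sum_squares_bound[of "cmod (a i)" "cmod (b i)"] by simp
  moreover have "0 \<le> cmod (a i) * cmod (b i)" by simp
  ultimately have "cmod (a i) * cmod (b i) \<le> (cmod (a i))\<^sup>2 + (cmod (b i))\<^sup>2"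
    by linarith
  thus "norm (a i * cnj (b i)) \<le> (cmod (a i))\<^sup>2 + (cmod (b i))\<^sup>2"
    by (simp add: norm_mult)
qed auto

lemma l2_prod_summable:
  assumes "l2 a" "l2 b"
  shows "(\<lambda>i. a i * cnj (b i)) summable_on UNIV"
  using l2_prod_abs_summable[OF assms] by (rule abs_summable_summable)

lemma l2_scale: "l2 a \<Longrightarrow> l2 (\<lambda>i. c * a i)"
  unfolding l2_def norm_mult power_mult_distrib by (rule summable_on_cmult_right)

lemma l2_add:
  assumes "l2 a" "l2 b"
  shows "l2 (\<lambda>i. a i + b i)"
  unfolding l2_def
proof (rule summable_on_comparison_test)
  show "(\<lambda>i. 2 * (cmod (a i))\<^sup>2 + 2 * (cmod (b i))\<^sup>2) summable_on UNIV"
    using assms unfolding l2_def by (intro summable_on_add summable_on_cmult_right)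
  fix i
  have "(cmod (a i + b i))\<^sup>2 \<le> (cmod (a i) + cmod (b i))\<^sup>2"
    by (intro power_mono norm_triangle_ineq) auto
  also have "\<dots> \<le> 2 * (cmod (a i))\<^sup>2 + 2 * (cmod (b i))\<^sup>2"
    using sum_squares_bound[of "cmod (a i)" "cmod (b i)"] by (simp add: power2_sum)
  finally show "(cmod (a i + b i))\<^sup>2 \<le> 2 * (cmod (a i))\<^sup>2 + 2 * (cmod (b i))\<^sup>2" .
qed auto

lemma l2_diff:
  assumes "l2 a" "l2 b"
  shows "l2 (\<lambda>i. a i - b i)"
  using l2_add[OF assms(1) l2_scale[OF assms(2), of "-1"]] by simp

lemma l2_zero: "l2 (\<lambda>i. 0)"
  by (simp add: l2_def)

lemma lip_add_left:
  assumes "l2 a" "l2 b" "l2 c"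
  shows "lip (\<lambda>i. a i + b i) c = lip a c + lip b c"
  unfolding lip_def distrib_right
  by (intro infsum_add l2_prod_summable assms)

lemma lip_scale_left: "lip (\<lambda>i. c * a i) b = c * lip a b"
  unfolding lip_def mult.assoc by (rule infsum_cmult_right')

lemma lip_cnj: "cnj (lip a b) = lip b a"
  unfolding lip_def infsum_cnj[symmetric] by (simp add: mult.commute)

lemma lip_self: "lip a a = complex_of_real (lsq a)"
proof -
  have "(\<Sum>\<^sub>\<infinity>i\<in>UNIV. complex_of_real ((cmod (a i))\<^sup>2)) = complex_of_real (lsq a)"
    unfolding lsq_def
    by (rule infsum_bounded_linear_strong)
      (rule summable_on_bounded_linear_iff[OF bounded_linear_of_real bounded_linear_Re Re_complex_of_real],
       rule bounded_linear_of_real)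
  thus ?thesis unfolding lip_def complex_norm_square by simp
qed

lemma lsq_ge0: "0 \<le> lsq a"
  unfolding lsq_def by (intro infsum_nonneg) auto

lemma finite_le_lsq: "l2 a \<Longrightarrow> finite F \<Longrightarrow> (\<Sum>i\<in>F. (cmod (a i))\<^sup>2) \<le> lsq a"
  unfolding l2_def lsq_def by (rule finite_sum_le_infsum) auto

lemma coord_le_lsq: "l2 a \<Longrightarrow> (cmod (a i))\<^sup>2 \<le> lsq a"
  using finite_le_lsq[of a "{i}"] by simp

lemma lsq_eq0D: "l2 a \<Longrightarrow> lsq a = 0 \<Longrightarrow> a i = 0"
  using coord_le_lsq[of a i] by simp

lemma l2_boundedI:
  assumes "\<And>F. finite F \<Longrightarrow> (\<Sum>i\<in>F. (cmod (a i))\<^sup>2) \<le> B"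
  shows "l2 a" "lsq a \<le> B"
proof -
  show *: "l2 a" unfolding l2_def
    by (rule nonneg_bdd_above_summable_on) (auto intro!: bdd_aboveI[of _ B] assms)
  thus "lsq a \<le> B" unfolding lsq_def l2_def
    by (rule infsum_le_finite_sums) (use assms in auto)
qed

text \<open>Finite partial sums converge along with the coordinates. The bound is required only from
  some index on, the form in which the Cauchy condition of \<open>l2_complete\<close> supplies
  it.\<close>

lemma l2_Fatou:
  fixes u :: "nat \<Rightarrow> 'i \<Rightarrow> complex"
  assumes l2: "\<And>n. l2 (u n)" and le: "\<And>n. n \<ge> N \<Longrightarrow> lsq (u n) \<le> B"
    and lim: "\<And>i. (\<lambda>n. u n i) \<longlonglongrightarrow> a i"
  shows "l2 a" "lsq a \<le> B"
proof -
  have "(\<Sum>i\<in>F. (cmod (a i))\<^sup>2) \<le> B" if F: "finite F" for F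
  proof (rule LIMSEQ_le_const2)
    show "(\<lambda>n. \<Sum>i\<in>F. (cmod (u n i))\<^sup>2) \<longlonglongrightarrow> (\<Sum>i\<in>F. (cmod (a i))\<^sup>2)"
      by (intro tendsto_intros lim)
    show "\<exists>N. \<forall>n\<ge>N. (\<Sum>i\<in>F. (cmod (u n i))\<^sup>2) \<le> B"
      using finite_le_lsq[OF l2 F] le by (meson order_trans)
  qed
  from l2_boundedI[OF this] show "l2 a" "lsq a \<le> B" by auto
qed

lemma lsq_scale: "lsq (\<lambda>i. c * a i) = (cmod c)\<^sup>2 * lsq a"
  unfolding lsq_def norm_mult power_mult_distrib by (rule infsum_cmult_right')

lemma lsq_add:
  assumes "l2 a" "l2 b"
  shows "lsq (\<lambda>i. a i + b i) = lsq a + lsq b + 2 * Re (lip a b)"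
proof -
  have ab: "l2 (\<lambda>i. a i + b i)" by (rule l2_add[OF assms])
  have "lip (\<lambda>i. a i + b i) (\<lambda>i. a i + b i) = lip a (\<lambda>i. a i + b i) + lip b (\<lambda>i. a i + b i)"
    by (rule lip_add_left[OF assms ab])
  also have "lip a (\<lambda>i. a i + b i) = cnj (lip a a + lip b a)"
    unfolding lip_cnj[symmetric, of _ "\<lambda>i. a i + b i"] by (subst lip_add_left[OF assms assms(1)]) simp
  also have "lip b (\<lambda>i. a i + b i) = cnj (lip a b + lip b b)"
    unfolding lip_cnj[symmetric, of _ "\<lambda>i. a i + b i"] by (subst lip_add_left[OF assms assms(2)]) simp
  finally have "Re (lip (\<lambda>i. a i + b i) (\<lambda>i. a i + b i)) = Re (cnj (lip a a + lip b a) + cnj (lip a b + lip b b))"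
    by simp
  moreover have "Re (lip b a) = Re (lip a b)" using lip_cnj[of a b] by (metis complex_cnj(1) cnj.simps(1))
  ultimately show ?thesis by (simp add: lip_self)
qed

lemma lip_CS:
  assumes "l2 a" "l2 b"
  shows "(cmod (lip a b))\<^sup>2 \<le> lsq a * lsq b"
proof -
  let ?t = "lip a b"
  \<comment> \<open>The right-hand side is the squared norm of a - s <a, b> b. If
    \<open>lsq b\<close> is positive, the best s is \<open>1 / lsq b\<close>; if it is 0, the
    expression is affine in s, which forces <a, b> = 0.\<close>
  have key: "0 \<le> lsq a + (cmod (of_real s * ?t))\<^sup>2 * lsq b - 2 * s * (cmod ?t)\<^sup>2" for s :: real
  proof -
    let ?c = "- of_real s * ?t"
    have "0 \<le> lsq (\<lambda>i. a i + ?c * b i)" by (rule lsq_ge0)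
    also have "\<dots> = lsq a + lsq (\<lambda>i. ?c * b i) + 2 * Re (lip a (\<lambda>i. ?c * b i))"
      by (rule lsq_add[OF assms(1) l2_scale[OF assms(2)]])
    also have "lip a (\<lambda>i. ?c * b i) = cnj (lip (\<lambda>i. ?c * b i) a)" by (simp only: lip_cnj)
    also have "\<dots> = cnj ?c * ?t" unfolding lip_scale_left by (simp add: lip_cnj)
    also have "\<dots> = - of_real (s * (cmod ?t)\<^sup>2)"
      by (simp add: complex_norm_square mult_ac del: of_real_power)
    finally show ?thesis unfolding lsq_scale by (simp add: norm_mult)
  qed
  show ?thesis
  proof (cases "lsq b = 0")
    case True
    have "0 \<le> lsq a - 2 * s * (cmod ?t)\<^sup>2" for s using key[of s] True by simp
    hence *: "2 * s * (cmod ?t)\<^sup>2 \<le> lsq a" for s by simp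
    have "cmod ?t = 0"
    proof (rule ccontr)
      assume "cmod ?t \<noteq> 0"
      thus False using *[of "(lsq a + 1) / (2 * (cmod ?t)\<^sup>2)"] by simp
    qed
    thus ?thesis using True by simp
  next
    case False
    hence pos: "lsq b > 0" using lsq_ge0[of b] by simp
    have "0 \<le> lsq a + (cmod (of_real (1 / lsq b) * ?t))\<^sup>2 * lsq b - 2 * (1 / lsq b) * (cmod ?t)\<^sup>2"
      by (rule key)
    also have "(cmod (of_real (1 / lsq b) * ?t))\<^sup>2 * lsq b = (cmod ?t)\<^sup>2 / lsq b"
      using pos by (simp add: norm_mult norm_divide power_mult_distrib power2_eq_square)
    finally have "(cmod ?t)\<^sup>2 / lsq b \<le> lsq a" by simp
    thus ?thesis using pos by (simp add: field_simps)
  qed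
qed

lemma lsq_triangle:
  assumes "l2 a" "l2 b"
  shows "lsq (\<lambda>i. a i + b i) \<le> 2 * lsq a + 2 * lsq b"
proof -
  have "lsq (\<lambda>i. a i + b i) + lsq (\<lambda>i. a i + (-1) * b i) = 2 * lsq a + 2 * lsq b"
  proof -
    have "lip a (\<lambda>i. (-1) * b i) = cnj (lip (\<lambda>i. (-1) * b i) a)" by (simp only: lip_cnj)
    also have "\<dots> = - lip a b" unfolding lip_scale_left by (simp add: lip_cnj)
    finally show ?thesis
      using lsq_add[OF assms] lsq_add[OF assms(1) l2_scale[OF assms(2), of "-1"]] lsq_scale[of "-1" b]
      by simp
  qed
  thus ?thesis using lsq_ge0[of "\<lambda>i. a i + (-1) * b i"] by linarith
qed

lemma l2_complete:
  fixes u :: "nat \<Rightarrow> 'i \<Rightarrow> complex"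
  assumes l2: "\<And>n. l2 (u n)"
    and C: "\<And>e. e > 0 \<Longrightarrow> \<exists>N. \<forall>m\<ge>N. \<forall>n\<ge>N. lsq (\<lambda>i. u m i - u n i) \<le> e"
  obtains a where "l2 a" "(\<lambda>n. lsq (\<lambda>i. u n i - a i)) \<longlonglongrightarrow> 0" "\<And>i. (\<lambda>n. u n i) \<longlonglongrightarrow> a i"
proof -
  have "Cauchy (\<lambda>n. u n i)" for i
  proof (rule CauchyI)
    fix e :: real assume e: "e > 0"
    then obtain N where N: "\<And>m n. m \<ge> N \<Longrightarrow> n \<ge> N \<Longrightarrow> lsq (\<lambda>i. u m i - u n i) \<le> (e/2)\<^sup>2"
      using C[of "(e/2)\<^sup>2"] by auto
    show "\<exists>N. \<forall>m\<ge>N. \<forall>n\<ge>N. norm (u m i - u n i) < e"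
    proof (intro exI allI impI)
      fix m n assume mn: "N \<le> m" "N \<le> n"
      have "(cmod (u m i - u n i))\<^sup>2 \<le> (e/2)\<^sup>2"
        using coord_le_lsq[OF l2_diff[OF l2[of m] l2[of n]], of i] N[OF mn] by linarith
      hence "cmod (u m i - u n i) \<le> e / 2" using e by (simp add: power2_le_iff_abs_le)
      thus "norm (u m i - u n i) < e" using e by simp
    qed
  qed
  then obtain a where a: "\<And>i. (\<lambda>n. u n i) \<longlonglongrightarrow> a i"
    unfolding Cauchy_convergent_iff convergent_def by metis
  \<comment> \<open>Fatou in m with n fixed turns the Cauchy bound into a bound for the distance to
    the limit.\<close>
  have *: "l2 (\<lambda>i. u n i - a i)" "lsq (\<lambda>i. u n i - a i) \<le> e"
    if "\<And>m. m \<ge> N \<Longrightarrow> lsq (\<lambda>i. u n i - u m i) \<le> e" for n N e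
  proof -
    have 1: "l2 (\<lambda>i. u n i - u m i)" for m by (rule l2_diff[OF l2 l2])
    have 2: "(\<lambda>m. u n i - u m i) \<longlonglongrightarrow> u n i - a i" for i by (intro tendsto_intros a)
    show "l2 (\<lambda>i. u n i - a i)" 
      by (rule l2_Fatou(1)[where u="\<lambda>m i. u n i - u m i" and N=N and B=e]) (rule 1, erule that, rule 2)
    show "lsq (\<lambda>i. u n i - a i) \<le> e" 
      by (rule l2_Fatou(2)[where u="\<lambda>m i. u n i - u m i" and N=N and B=e]) (rule 1, erule that, rule 2)
  qed
  have lim: "(\<lambda>n. lsq (\<lambda>i. u n i - a i)) \<longlonglongrightarrow> 0"
  proof (rule LIMSEQ_I)
    fix r :: real assume r: "r > 0"
    then obtain N where N: "\<And>m n. m \<ge> N \<Longrightarrow> n \<ge> N \<Longrightarrow> lsq (\<lambda>i. u m i - u n i) \<le> r/2"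
      using C[of "r/2"] by auto
    have "norm (lsq (\<lambda>i. u n i - a i) - 0) < r" if n: "n \<ge> N" for n
    proof -
      have "lsq (\<lambda>i. u n i - a i) \<le> r/2" by (rule *(2)[where N=N]) (rule N[OF n])
      moreover have "0 \<le> lsq (\<lambda>i. u n i - a i)" by (rule lsq_ge0)
      ultimately show ?thesis using r by simp
    qed
    thus "\<exists>N. \<forall>n\<ge>N. norm (lsq (\<lambda>i. u n i - a i) - 0) < r" by blast
  qed
  obtain N where N: "\<And>m n. m \<ge> N \<Longrightarrow> n \<ge> N \<Longrightarrow> lsq (\<lambda>i. u m i - u n i) \<le> 1"
    using C[of 1] by auto
  have "l2 (\<lambda>i. u N i - (u N i - a i))"
    by (intro l2_diff l2 *(1)[where N=N and e=1]) (use N in auto)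
  hence "l2 a" by simp
  thus ?thesis using lim a by (intro that)
qed

section \<open>Finite truncations\<close>

definition trunc :: "'i set \<Rightarrow> ('i \<Rightarrow> complex) \<Rightarrow> 'i \<Rightarrow> complex" where
  "trunc F a = (\<lambda>i. if i \<in> F then a i else 0)"

lemma l2_finite_support: "finite {i. a i \<noteq> 0} \<Longrightarrow> l2 a"
  unfolding l2_def
  by (rule finite_nonzero_values_imp_summable_on) auto

lemma l2_trunc: "finite F \<Longrightarrow> l2 (trunc F a)"
  by (rule l2_finite_support) (auto simp: trunc_def elim: finite_subset[rotated])

lemma lip_trunc: "finite F \<Longrightarrow> lip a (trunc F b) = (\<Sum>i\<in>F. a i * cnj (b i))"
  unfolding lip_def trunc_def
  by (rule infsumI, rule has_sum_finite_neutralI[of F]) auto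

lemma lsq_trunc: "finite F \<Longrightarrow> lsq (trunc F a) = (\<Sum>i\<in>F. (cmod (a i))\<^sup>2)"
  unfolding lsq_def trunc_def
  by (rule infsumI, rule has_sum_finite_neutralI[of F]) auto

lemma trunc_approx:
  assumes "l2 a" "e > 0"
  obtains F where "finite F" "lsq (\<lambda>i. a i - trunc F a i) \<le> e"
proof -
  obtain F where F: "finite F" "\<bar>(\<Sum>i\<in>F. (cmod (a i))\<^sup>2) - lsq a\<bar> \<le> e"
    using infsum_finite_approximation[of "\<lambda>i. (cmod (a i))\<^sup>2" UNIV e] assms
    unfolding l2_def lsq_def dist_real_def by auto
  have "lsq (\<lambda>i. trunc F a i + (a i - trunc F a i)) =
      lsq (trunc F a) + lsq (\<lambda>i. a i - trunc F a i) + 2 * Re (lip (trunc F a) (\<lambda>i. a i - trunc F a i))"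
    by (intro lsq_add l2_trunc l2_diff assms F)
  moreover have "lip (trunc F a) (\<lambda>i. a i - trunc F a i) = 0"
    unfolding lip_def trunc_def by (rule infsum_0) auto
  ultimately have "lsq a = (\<Sum>i\<in>F. (cmod (a i))\<^sup>2) + lsq (\<lambda>i. a i - trunc F a i)"
    using lsq_trunc[OF F(1), of a] by simp
  with F show ?thesis by (intro that) auto
qed

section \<open>The Hardy space as a space of power series in two variables\<close>

lemma l2_reindex:
  assumes "inj \<sigma>" "l2 b"
  shows "l2 (b \<circ> \<sigma>)" "lsq (b \<circ> \<sigma>) \<le> lsq b"
proof -
  have "(\<Sum>i\<in>F. (cmod ((b \<circ> \<sigma>) i))\<^sup>2) \<le> lsq b" if "finite F" for F
  proof -
    have "(\<Sum>i\<in>F. (cmod ((b \<circ> \<sigma>) i))\<^sup>2) = (\<Sum>i\<in>\<sigma> ` F. (cmod (b i))\<^sup>2)"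
      by (subst sum.reindex) (auto intro: inj_on_subset[OF assms(1)])
    also have "\<dots> \<le> lsq b" by (rule finite_le_lsq) (use that assms in auto)
    finally show ?thesis .
  qed
  from l2_boundedI[OF this] show "l2 (b \<circ> \<sigma>)" "lsq (b \<circ> \<sigma>) \<le> lsq b" by blast+
qed

text \<open>With \<open>\<sigma>\<close> raising one exponent, \<open>a'\<close> is the family of z1
  f or z2 f. The sums run over the range of \<open>\<sigma>\<close> only, so composition with
  \<open>\<sigma>\<close>, the backward shift, is the adjoint.\<close>

lemma l2_push:
  assumes "inj \<sigma>" "\<And>i. a' (\<sigma> i) = a i" "\<And>i. i \<notin> range \<sigma> \<Longrightarrow> a' i = 0"
  shows "l2 a' \<longleftrightarrow> l2 a" "lip a' b = lip a (b \<circ> \<sigma>)"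
proof -
  have "l2 a' \<longleftrightarrow> (\<lambda>i. (cmod (a' i))\<^sup>2) summable_on range \<sigma>"
    unfolding l2_def by (rule summable_on_cong_neutral) (use assms in auto)
  also have "\<dots> \<longleftrightarrow> l2 a"
    unfolding l2_def by (subst summable_on_reindex[OF assms(1)]) (simp add: o_def assms)
  finally show "l2 a' \<longleftrightarrow> l2 a" .
  have "lip a' b = infsum (\<lambda>i. a' i * cnj (b i)) (range \<sigma>)"
    unfolding lip_def by (rule infsum_cong_neutral) (use assms in auto)
  also have "\<dots> = lip a (b \<circ> \<sigma>)"
    unfolding lip_def by (subst infsum_reindex[OF assms(1)]) (simp add: o_def assms)
  finally show "lip a' b = lip a (b \<circ> \<sigma>)" .
qed

unbundle no vec_syntax
unbundle fps_syntax

text \<open>The outer variable of \<open>fps2\<close> is \<open>z\<^sub>1\<close> and the inner one \<open>z\<^sub>2\<close>, so that \<open>fps_const\<close> embeds the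
  functions of \<open>z\<^sub>2\<close> alone. Bivariate polynomials have the opposite order.\<close>

type_synonym fps2 = "complex fps fps"

definition cf :: "fps2 \<Rightarrow> nat \<times> nat \<Rightarrow> complex" where
  "cf f = (\<lambda>(j, k). f $ j $ k)"

definition mk :: "(nat \<times> nat \<Rightarrow> complex) \<Rightarrow> fps2" where
  "mk a = Abs_fps (\<lambda>j. Abs_fps (\<lambda>k. a (j, k)))"

lemma cf_mk [simp]: "cf (mk a) = a"
  by (auto simp: cf_def mk_def)

lemma cf_eqI: "cf f = cf g \<Longrightarrow> f = g"
  by (auto simp: cf_def fps_eq_iff fun_eq_iff)

definition H2 :: "fps2 set" where "H2 = {f. l2 (cf f)}"
definition ip :: "fps2 \<Rightarrow> fps2 \<Rightarrow> complex" where "ip f g = lip (cf f) (cf g)"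
definition nsq :: "fps2 \<Rightarrow> real" where "nsq f = lsq (cf f)"

abbreviation iota :: "complex fps \<Rightarrow> fps2" where "iota \<equiv> fps_const"
abbreviation sc :: "complex \<Rightarrow> fps2 \<Rightarrow> fps2" where "sc c f \<equiv> fps_const (fps_const c) * f"

lemma cf_simps:
  "cf (f + g) = (\<lambda>i. cf f i + cf g i)" "cf (f - g) = (\<lambda>i. cf f i - cf g i)"
  "cf (sc c f) = (\<lambda>i. c * cf f i)" "cf 0 = (\<lambda>i. 0)"
  by (auto simp: cf_def)

lemma sc_minus1: "sc (-1) f = - f"
  by (rule cf_eqI) (auto simp: cf_def)

lemma H2_add: "f \<in> H2 \<Longrightarrow> g \<in> H2 \<Longrightarrow> f + g \<in> H2"
  by (simp add: H2_def cf_simps l2_add)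
lemma H2_diff: "f \<in> H2 \<Longrightarrow> g \<in> H2 \<Longrightarrow> f - g \<in> H2"
  by (simp add: H2_def cf_simps l2_diff)
lemma H2_sc: "f \<in> H2 \<Longrightarrow> sc c f \<in> H2"
  unfolding H2_def mem_Collect_eq cf_simps by (rule l2_scale)
lemma H2_zero: "0 \<in> H2"
  by (simp add: H2_def cf_simps l2_zero)
lemma H2_sum: "(\<And>i. i \<in> F \<Longrightarrow> f i \<in> H2) \<Longrightarrow> sum f F \<in> H2"
  by (induction F rule: infinite_finite_induct) (auto intro: H2_zero H2_add)

lemma ip_cnj: "cnj (ip f g) = ip g f"
  by (simp add: ip_def lip_cnj)
lemma ip_add_left: "f \<in> H2 \<Longrightarrow> g \<in> H2 \<Longrightarrow> h \<in> H2 \<Longrightarrow> ip (f + g) h = ip f h + ip g h"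
  by (simp add: ip_def H2_def cf_simps lip_add_left)
lemma ip_sc_left: "ip (sc c f) h = c * ip f h"
  unfolding ip_def cf_simps by (rule lip_scale_left)
lemma ip_zero_left: "ip 0 h = 0"
  by (simp add: ip_def lip_def cf_simps)
lemma ip_diff_left: "f \<in> H2 \<Longrightarrow> g \<in> H2 \<Longrightarrow> h \<in> H2 \<Longrightarrow> ip (f - g) h = ip f h - ip g h"
  using ip_add_left[of "f - g" g h] by (simp add: H2_diff)
lemma ip_add_right: "f \<in> H2 \<Longrightarrow> g \<in> H2 \<Longrightarrow> h \<in> H2 \<Longrightarrow> ip h (f + g) = ip h f + ip h g"
  using arg_cong[OF ip_add_left[of f g h], of cnj] by (simp add: ip_cnj)
lemma ip_diff_right: "f \<in> H2 \<Longrightarrow> g \<in> H2 \<Longrightarrow> h \<in> H2 \<Longrightarrow> ip h (f - g) = ip h f - ip h g"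
  using arg_cong[OF ip_diff_left[of f g h], of cnj] by (simp add: ip_cnj)
lemma ip_sc_right: "ip h (sc c f) = cnj c * ip h f"
  using arg_cong[OF ip_sc_left[of c f h], of cnj] by (simp add: ip_cnj)
lemma ip_zero_right: "ip h 0 = 0"
  using arg_cong[OF ip_zero_left[of h], of cnj] by (simp add: ip_cnj)
lemma ip_sum_left:
  assumes "\<And>i. i \<in> F \<Longrightarrow> f i \<in> H2" "h \<in> H2"
  shows "ip (sum f F) h = (\<Sum>i\<in>F. ip (f i) h)"
  using assms(1)
proof (induction F rule: infinite_finite_induct)
  case (insert x F)
  thus ?case by (simp add: ip_add_left[OF _ H2_sum assms(2)])
qed (auto simp: ip_zero_left)
lemma ip_sum_right:
  assumes "\<And>i. i \<in> F \<Longrightarrow> f i \<in> H2" "h \<in> H2"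
  shows "ip h (sum f F) = (\<Sum>i\<in>F. ip h (f i))"
proof -
  have "cnj (ip (sum f F) h) = (\<Sum>i\<in>F. cnj (ip (f i) h))"
    by (simp add: ip_sum_left[OF assms])
  thus ?thesis by (simp only: ip_cnj)
qed
lemma ip_self: "ip f f = complex_of_real (nsq f)"
  by (simp add: ip_def nsq_def lip_self)
lemma nsq_ge0: "0 \<le> nsq f" by (simp add: nsq_def lsq_ge0)
lemma nsq_eq0D: "f \<in> H2 \<Longrightarrow> nsq f = 0 \<Longrightarrow> f = 0"
  by (rule cf_eqI) (auto simp: H2_def nsq_def cf_simps fun_eq_iff dest: lsq_eq0D)
lemma ip_self_eq0D: "f \<in> H2 \<Longrightarrow> ip f f = 0 \<Longrightarrow> f = 0"
  by (simp add: ip_self nsq_eq0D)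
lemma nsq_sc: "nsq (sc c f) = (cmod c)\<^sup>2 * nsq f"
  unfolding nsq_def cf_simps by (rule lsq_scale)
lemma nsq_add: "f \<in> H2 \<Longrightarrow> g \<in> H2 \<Longrightarrow> nsq (f + g) = nsq f + nsq g + 2 * Re (ip f g)"
  unfolding nsq_def ip_def cf_simps H2_def by (rule lsq_add) auto
lemma nsq_diff: "f \<in> H2 \<Longrightarrow> g \<in> H2 \<Longrightarrow> nsq (f - g) = nsq f + nsq g - 2 * Re (ip f g)"
  using nsq_add[of f "sc (-1) g"] H2_sc[of g "-1"] ip_sc_right[of f "-1" g] nsq_sc[of "-1" g]
  unfolding sc_minus1 by simp
lemma nsq_commute: "nsq (f - g) = nsq (g - f)"
  using nsq_sc[of "-1" "f - g"] unfolding sc_minus1 by simp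
lemma CS: "f \<in> H2 \<Longrightarrow> g \<in> H2 \<Longrightarrow> (cmod (ip f g))\<^sup>2 \<le> nsq f * nsq g"
  unfolding nsq_def ip_def H2_def by (rule lip_CS) auto
lemma nsq_triangle: "f \<in> H2 \<Longrightarrow> g \<in> H2 \<Longrightarrow> nsq (f + g) \<le> 2 * nsq f + 2 * nsq g"
  unfolding nsq_def cf_simps H2_def by (rule lsq_triangle) auto
lemma nsq_triangle_diff: "f \<in> H2 \<Longrightarrow> g \<in> H2 \<Longrightarrow> h \<in> H2 \<Longrightarrow> nsq (f - h) \<le> 2 * nsq (f - g) + 2 * nsq (g - h)"
  using nsq_triangle[of "f - g" "g - h"] by (simp add: H2_diff)

section \<open>Monomials, polynomial approximation and completeness\<close>

definition zpow :: "nat \<Rightarrow> nat \<Rightarrow> fps2" where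
  "zpow j k = fps_X ^ j * iota (fps_X ^ k)"

lemma cf_zpow: "cf (zpow j k) = (\<lambda>i. if i = (j, k) then 1 else 0)"
  by (auto simp: cf_def zpow_def fun_eq_iff fps_X_power_mult_nth fps_X_power_iff)

lemma H2_zpow: "zpow j k \<in> H2"
  unfolding H2_def mem_Collect_eq cf_zpow by (rule l2_finite_support) auto

lemma ip_zpow: "ip f (zpow j k) = f $ j $ k"
proof -
  have "ip f (zpow j k) = lip (cf f) (trunc {(j, k)} (\<lambda>i. 1))"
    by (simp add: ip_def cf_zpow trunc_def)
  also have "\<dots> = f $ j $ k" by (subst lip_trunc) (auto simp: cf_def)
  finally show ?thesis .
qed

lemma H2_coeff_eqI: "(\<And>j k. ip f (zpow j k) = ip g (zpow j k)) \<Longrightarrow> f = g"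
  by (simp add: ip_zpow fps_eq_iff)

definition part :: "(nat \<times> nat) set \<Rightarrow> fps2 \<Rightarrow> fps2" where
  "part F f = (\<Sum>p\<in>F. sc (f $ fst p $ snd p) (zpow (fst p) (snd p)))"

lemma cf_part: "finite F \<Longrightarrow> cf (part F f) = trunc F (cf f)"
proof (induction F rule: finite_induct)
  case (insert p F)
  have "part (insert p F) f = sc (f $ fst p $ snd p) (zpow (fst p) (snd p)) + part F f"
    unfolding part_def using insert.hyps by simp
  thus ?case
    using insert by (simp add: cf_simps cf_zpow) (auto simp: trunc_def fun_eq_iff cf_def)
qed (simp add: part_def cf_simps trunc_def)

lemma part_H2: "part F f \<in> H2"
  unfolding part_def by (intro H2_sum H2_sc H2_zpow)

lemma nsq_part: "finite F \<Longrightarrow> nsq (part F f) = (\<Sum>(j, k)\<in>F. (cmod (f $ j $ k))\<^sup>2)"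
  by (simp add: nsq_def cf_part lsq_trunc) (simp add: cf_def case_prod_beta)

lemma H2_approx:
  assumes f: "f \<in> H2"
  obtains F where "\<And>n::nat. finite (F n)" "(\<lambda>n. nsq (part (F n) f - f)) \<longlonglongrightarrow> 0"
proof -
  have "\<exists>F. finite F \<and> nsq (part F f - f) \<le> inverse (real (Suc n))" for n
  proof -
    have "inverse (real (Suc n)) > 0" by simp
    from trunc_approx[OF _ this, of "cf f"] obtain F where F: "finite F"
      "lsq (\<lambda>i. cf f i - trunc F (cf f) i) \<le> inverse (real (Suc n))"
      using f unfolding H2_def by blast
    thus ?thesis unfolding nsq_commute[of _ f] by (auto simp: nsq_def cf_simps cf_part)
  qed
  hence "\<forall>n. \<exists>F. finite F \<and> nsq (part F f - f) \<le> inverse (real (Suc n))" by blast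
  from choice[OF this] obtain F where F: "\<And>n. finite (F n)"
    "\<And>n. nsq (part (F n) f - f) \<le> inverse (real (Suc n))" by blast
  have "(\<lambda>n. nsq (part (F n) f - f)) \<longlonglongrightarrow> 0"
    by (rule tendsto_sandwich[OF _ _ tendsto_const LIMSEQ_inverse_real_of_nat])
      (auto intro!: always_eventually nsq_ge0 F(2) simp del: of_nat_Suc)
  with F(1) show ?thesis by (rule that)
qed

lemma ip_tendsto:
  assumes u: "\<And>n. u n \<in> H2" and a: "a \<in> H2" "g \<in> H2" and lim: "(\<lambda>n. nsq (u n - a)) \<longlonglongrightarrow> 0"
  shows "(\<lambda>n. ip (u n) g) \<longlonglongrightarrow> ip a g"
proof -
  have "(\<lambda>n. nsq (u n - a) * nsq g) \<longlonglongrightarrow> 0 * nsq g" by (intro tendsto_intros lim)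
  hence 1: "(\<lambda>n. nsq (u n - a) * nsq g) \<longlonglongrightarrow> 0" by simp
  have "(\<lambda>n. (cmod (ip (u n) g - ip a g))\<^sup>2) \<longlonglongrightarrow> 0"
  proof (rule tendsto_sandwich[OF _ _ tendsto_const 1])
    show "\<forall>\<^sub>F n in sequentially. (cmod (ip (u n) g - ip a g))\<^sup>2 \<le> nsq (u n - a) * nsq g"
      using CS[OF H2_diff[OF u a(1)] a(2)] by (simp add: ip_diff_left u a)
  qed auto
  hence "(\<lambda>n. cmod (ip (u n) g - ip a g)) \<longlonglongrightarrow> 0"
    using tendsto_real_sqrt by fastforce
  hence "(\<lambda>n. ip (u n) g - ip a g) \<longlonglongrightarrow> 0" by (rule tendsto_norm_zero_cancel)
  thus ?thesis by (rule LIM_zero_cancel)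
qed

lemma nsq_tendsto_unique:
  assumes "\<And>n. u n \<in> H2" "a \<in> H2" "b \<in> H2"
    "(\<lambda>n. nsq (u n - a)) \<longlonglongrightarrow> 0" "(\<lambda>n. nsq (u n - b)) \<longlonglongrightarrow> 0"
  shows "a = b"
proof (rule H2_coeff_eqI)
  fix j k
  show "ip a (zpow j k) = ip b (zpow j k)"
    by (rule LIMSEQ_unique[OF ip_tendsto[OF assms(1,2) H2_zpow assms(4)] ip_tendsto[OF assms(1,3) H2_zpow assms(5)]])
qed

lemma H2_complete:
  assumes u: "\<And>n::nat. u n \<in> H2"
    and C: "\<And>e. e > 0 \<Longrightarrow> \<exists>N. \<forall>m\<ge>N. \<forall>n\<ge>N. nsq (u m - u n) \<le> e"
  obtains a where "a \<in> H2" "(\<lambda>n. nsq (u n - a)) \<longlonglongrightarrow> 0"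
proof -
  have 1: "l2 (cf (u n))" for n using u[of n] by (simp add: H2_def)
  have 2: "\<exists>N. \<forall>m\<ge>N. \<forall>n\<ge>N. lsq (\<lambda>i. cf (u m) i - cf (u n) i) \<le> e" if "e > 0" for e
    using C[OF that] unfolding nsq_def cf_simps .
  obtain a where a: "l2 a" "(\<lambda>n. lsq (\<lambda>i. cf (u n) i - a i)) \<longlonglongrightarrow> 0"
    using l2_complete[of "\<lambda>n. cf (u n)", OF 1 2] by blast
  show ?thesis
  proof (rule that)
    show "mk a \<in> H2" using a(1) by (simp add: H2_def)
    show "(\<lambda>n. nsq (u n - mk a)) \<longlonglongrightarrow> 0" using a(2) unfolding nsq_def cf_simps cf_mk .
  qed
qed

lemma H2_boundedI:
  assumes "\<And>F. finite F \<Longrightarrow> (\<Sum>(j, k)\<in>F. (cmod (f $ j $ k))\<^sup>2) \<le> B"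
  shows "f \<in> H2" "nsq f \<le> B"
proof -
  have *: "(\<Sum>i\<in>F. (cmod (cf f i))\<^sup>2) \<le> B" if "finite F" for F
    using assms[OF that] by (simp add: cf_def case_prod_beta)
  show "f \<in> H2" "nsq f \<le> B" 
    using l2_boundedI[of "cf f" B, OF *] by (simp_all add: H2_def nsq_def)
qed

lemma H2_Fatou:
  assumes "\<And>n. u n \<in> H2" "\<And>n::nat. nsq (u n) \<le> B" "\<And>j k. (\<lambda>n. u n $ j $ k) \<longlonglongrightarrow> a $ j $ k"
  shows "a \<in> H2" "nsq a \<le> B"
proof -
  have 1: "l2 (cf (u n))" for n using assms(1) by (simp add: H2_def)
  have 2: "lsq (cf (u n)) \<le> B" for n using assms(2) by (simp add: nsq_def)
  have 3: "(\<lambda>n. cf (u n) i) \<longlonglongrightarrow> cf a i" for i using assms(3) by (simp add: cf_def case_prod_beta)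
  show "a \<in> H2" "nsq a \<le> B"
    using l2_Fatou[of "\<lambda>n. cf (u n)" 0 B "cf a", OF 1 2 3] by (simp_all add: H2_def nsq_def)
qed

text \<open>\<open>Y\<close> may fail to be closed, so a minimising sequence converges to a point of
  its closure. The sequence belongs to the conclusion because the elements of \<open>Y\<close> will
  carry further data that must be followed to the limit.\<close>

lemma projection:
  assumes Y: "Y \<subseteq> H2" "0 \<in> Y" "\<And>f g. f \<in> Y \<Longrightarrow> g \<in> Y \<Longrightarrow> f + g \<in> Y" "\<And>c f. f \<in> Y \<Longrightarrow> sc c f \<in> Y"
    and h: "h \<in> H2"
  obtains a u where "\<And>n::nat. u n \<in> Y" "a \<in> H2" "(\<lambda>n. nsq (u n - a)) \<longlonglongrightarrow> 0"
    "\<And>y. y \<in> Y \<Longrightarrow> ip (h - a) y = 0"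
proof -
  define d where "d = (INF y\<in>Y. nsq (h - y))"
  have bdd: "bdd_below ((\<lambda>y. nsq (h - y)) ` Y)" by (rule bdd_belowI[of _ 0]) (auto simp: nsq_ge0)
  have d: "d \<le> nsq (h - y)" if "y \<in> Y" for y
    unfolding d_def by (rule cINF_lower[OF bdd that])
  have "\<exists>y\<in>Y. nsq (h - y) < d + inverse (real (Suc n))" for n
  proof -
    have "d < d + inverse (real (Suc n))" by simp
    thus ?thesis unfolding d_def by (subst (asm) cINF_less_iff) (use Y(2) bdd in auto)
  qed
  then obtain u where u: "\<And>n. u n \<in> Y" "\<And>n. nsq (h - u n) < d + inverse (real (Suc n))" by metis
  have uH: "u n \<in> H2" for n using u Y by auto
  have Cau: "nsq (u m - u n) \<le> 2 * inverse (real (Suc m)) + 2 * inverse (real (Suc n))" for m n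
  proof -
    \<comment> \<open>Parallelogram law: the midpoint of \<open>u m\<close> and \<open>u n\<close>
      lies in \<open>Y\<close>, so its squared distance to \<open>h\<close> is at least
      \<open>d\<close>, which leaves little room for the difference.\<close>
    let ?s = "(h - u m) + (h - u n)"
    have *: "?s = sc 2 (h - sc (1/2) (u m + u n))"
      by (rule cf_eqI, unfold cf_simps) (auto simp: field_simps)
    have "4 * d \<le> nsq ?s"
      unfolding * nsq_sc using d[of "sc (1/2) (u m + u n)"] Y u by simp
    moreover have "nsq ?s + nsq ((h - u m) - (h - u n)) = 2 * nsq (h - u m) + 2 * nsq (h - u n)"
      using nsq_add[of "h - u m" "h - u n"] nsq_diff[of "h - u m" "h - u n"] H2_diff h uH by simp
    moreover have "nsq ((h - u m) - (h - u n)) = nsq (u n - u m)" by simp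
    ultimately show ?thesis using u(2)[of m] u(2)[of n] nsq_commute[of "u n" "u m"] by linarith
  qed
  have "\<exists>N. \<forall>m\<ge>N. \<forall>n\<ge>N. nsq (u m - u n) \<le> e" if "e > 0" for e
  proof -
    have "e / 4 > 0" using that by simp
    from reals_Archimedean[OF this] obtain N where N: "inverse (real (Suc N)) < e / 4" by blast
    have "inverse (real (Suc m)) < e / 4" if "m \<ge> N" for m
    proof -
      have "inverse (real (Suc m)) \<le> inverse (real (Suc N))" using that by (simp add: field_simps)
      thus ?thesis using N by linarith
    qed
    note small = this
    have "nsq (u m - u n) \<le> e" if "m \<ge> N" "n \<ge> N" for m n
      using Cau[of m n] small[OF that(1)] small[OF that(2)] by linarith
    thus ?thesis by blast
  qed
  from H2_complete[OF uH this] obtain a where a: "a \<in> H2" "(\<lambda>n. nsq (u n - a)) \<longlonglongrightarrow> 0" by auto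
  have "ip (h - a) y = 0" if y: "y \<in> Y" for y
  proof (cases "nsq y = 0")
    case True
    hence "y = 0" using nsq_eq0D y Y by blast
    thus ?thesis by (simp add: ip_zero_right)
  next
    case False
    hence pos: "nsq y > 0" using nsq_ge0[of y] by linarith
    have yH: "y \<in> H2" using y Y by auto
    have le: "(cmod (ip (h - u n) y))\<^sup>2 \<le> inverse (real (Suc n)) * nsq y" for n
    proof -
      \<comment> \<open>Subtracting the component along \<open>y\<close> lowers the squared distance
        by |\<open>?i\<close>|^2 / |y|^2, which cannot exceed the excess of
        \<open>nsq (h - u n)\<close> over \<open>d\<close>.\<close>
      let ?i = "ip (h - u n) y" let ?t = "?i / of_real (nsq y)"
      have "d \<le> nsq (h - (u n + sc ?t y))" by (rule d) (use Y u y in auto)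
      also have "h - (u n + sc ?t y) = (h - u n) - sc ?t y" by simp
      also have "nsq \<dots> = nsq (h - u n) + nsq (sc ?t y) - 2 * Re (ip (h - u n) (sc ?t y))"
        by (rule nsq_diff) (use h uH yH in \<open>auto intro: H2_diff H2_sc\<close>)
      also have "ip (h - u n) (sc ?t y) = of_real ((cmod ?i)\<^sup>2 / nsq y)"
        unfolding ip_sc_right by (simp add: complex_norm_square mult.commute del: of_real_power)
      also have "nsq (sc ?t y) = (cmod ?i)\<^sup>2 / nsq y"
        unfolding nsq_sc using pos by (simp add: norm_divide power_divide power2_eq_square)
      finally have "(cmod ?i)\<^sup>2 / nsq y \<le> nsq (h - u n) - d" by simp
      also have "\<dots> \<le> inverse (real (Suc n))" using u(2)[of n] by simp
      finally show ?thesis using pos by (simp add: pos_divide_le_eq)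
    qed
    have "(\<lambda>n. inverse (real (Suc n)) * nsq y) \<longlonglongrightarrow> 0 * nsq y"
      by (intro tendsto_intros LIMSEQ_inverse_real_of_nat)
    hence "(\<lambda>n. inverse (real (Suc n)) * nsq y) \<longlonglongrightarrow> 0" by simp
    from tendsto_sandwich[OF _ _ tendsto_const this, of "\<lambda>n. (cmod (ip (h - u n) y))\<^sup>2"] le
    have "(\<lambda>n. (cmod (ip (h - u n) y))\<^sup>2) \<longlonglongrightarrow> 0" by simp
    hence "(\<lambda>n. cmod (ip (h - u n) y)) \<longlonglongrightarrow> 0" using tendsto_real_sqrt by fastforce
    hence 1: "(\<lambda>n. ip (h - u n) y) \<longlonglongrightarrow> 0" by (rule tendsto_norm_zero_cancel)
    have "(\<lambda>n. ip (h - u n) y) \<longlonglongrightarrow> ip (h - a) y"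
      by (rule ip_tendsto) (use a(2) in \<open>auto intro: H2_diff h uH a yH simp: nsq_commute\<close>)
    with 1 show ?thesis by (rule LIMSEQ_unique[symmetric])
  qed
  with u a show ?thesis by (intro that)
qed

section \<open>Isometric multipliers and the commutator\<close>

text \<open>Keeps the backward shift in the form \<open>fps_shift 1\<close>, in which the rules
  about it are stated.\<close>

declare One_nat_def [simp del]

section \<open>Multiplication by z1 and z2, and the backward shift\<close>

lemma H2_cong_push:
  assumes "inj \<sigma>" "\<And>i. cf f' (\<sigma> i) = cf f i" "\<And>i. i \<notin> range \<sigma> \<Longrightarrow> cf f' i = 0"
  shows "f' \<in> H2 \<longleftrightarrow> f \<in> H2" "ip f' g = ip f (mk (cf g \<circ> \<sigma>))"
  using l2_push[of \<sigma> "cf f'" "cf f", OF assms] by (simp_all add: H2_def ip_def)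

lemma inj_Suc_fst: "inj (\<lambda>(j, k). (Suc j, k))" and inj_Suc_snd: "inj (\<lambda>(j, k). (j, Suc k))"
  by (auto simp: inj_on_def)

lemma cf_X:
  "cf (fps_X * f) ((\<lambda>(j, k). (Suc j, k)) i) = cf f i"
  "i \<notin> range (\<lambda>(j, k). (Suc j, k)) \<Longrightarrow> cf (fps_X * f) i = 0"
proof -
  show "cf (fps_X * f) ((\<lambda>(j, k). (Suc j, k)) i) = cf f i"
    by (auto simp: cf_def case_prod_beta)
  assume *: "i \<notin> range (\<lambda>(j, k). (Suc j, k))"
  obtain j k where i: "i = (j, k)" by (cases i)
  have "j = 0"
  proof (cases j)
    case (Suc j')
    hence "i = (\<lambda>(j, k). (Suc j, k)) (j', k)" by (simp add: i)
    thus ?thesis using * by blast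
  qed
  thus "cf (fps_X * f) i = 0" by (simp add: i cf_def)
qed

lemma cf_Y:
  "cf (iota fps_X * f) ((\<lambda>(j, k). (j, Suc k)) i) = cf f i"
  "i \<notin> range (\<lambda>(j, k). (j, Suc k)) \<Longrightarrow> cf (iota fps_X * f) i = 0"
proof -
  show "cf (iota fps_X * f) ((\<lambda>(j, k). (j, Suc k)) i) = cf f i"
    by (auto simp: cf_def case_prod_beta)
  assume *: "i \<notin> range (\<lambda>(j, k). (j, Suc k))"
  obtain j k where i: "i = (j, k)" by (cases i)
  have "k = 0"
  proof (cases k)
    case (Suc k')
    hence "i = (\<lambda>(j, k). (j, Suc k)) (j, k')" by (simp add: i)
    thus ?thesis using * by blast
  qed
  thus "cf (iota fps_X * f) i = 0" by (simp add: i cf_def)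
qed

lemma H2_X: "fps_X * f \<in> H2 \<longleftrightarrow> f \<in> H2"
  by (rule H2_cong_push(1)[OF inj_Suc_fst cf_X])

lemma ip_X_left: "ip (fps_X * f) g = ip f (fps_shift 1 g)"
proof -
  have "mk (cf g \<circ> (\<lambda>(j, k). (Suc j, k))) = fps_shift 1 g"
    by (auto simp: mk_def cf_def fps_eq_iff One_nat_def)
  thus ?thesis using H2_cong_push(2)[OF inj_Suc_fst cf_X, where g = g] by simp
qed

lemma ip_X_right: "ip g (fps_X * f) = ip (fps_shift 1 g) f"
  using arg_cong[OF ip_X_left[of f g], of cnj] by (simp add: ip_cnj)

lemma shift_X: "fps_shift 1 (fps_X * f) = (f :: 'a :: comm_ring_1 fps)"
  by (simp add: fps_eq_iff)

lemma ip_XX: "ip (fps_X * f) (fps_X * g) = ip f g"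
  by (simp only: ip_X_left shift_X)

lemma nsq_X: "nsq (fps_X * f) = nsq f"
  using ip_XX[of f f] by (simp add: ip_self)

lemma H2_Y: "iota fps_X * f \<in> H2 \<longleftrightarrow> f \<in> H2"
  by (rule H2_cong_push(1)[OF inj_Suc_snd cf_Y])

lemma ip_YY: "ip (iota fps_X * f) (iota fps_X * g) = ip f g"
proof -
  have "mk (cf (iota fps_X * g) \<circ> (\<lambda>(j, k). (j, Suc k))) = g"
    by (auto simp: mk_def cf_def fps_eq_iff)
  thus ?thesis using H2_cong_push(2)[OF inj_Suc_snd cf_Y, where g = "iota fps_X * g"] by simp
qed

lemma iota_X_Suc: "iota (fps_X ^ Suc n) * f = iota fps_X * (iota (fps_X ^ n) * f)"
  by (simp add: mult.assoc[symmetric])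

lemma H2_Ypow: "iota (fps_X ^ n) * f \<in> H2 \<longleftrightarrow> f \<in> H2"
proof (induction n)
  case (Suc n)
  thus ?case unfolding iota_X_Suc H2_Y .
qed simp

lemma ip_YYpow: "ip (iota (fps_X ^ n) * f) (iota (fps_X ^ n) * g) = ip f g"
proof (induction n)
  case (Suc n)
  thus ?case unfolding iota_X_Suc ip_YY .
qed simp

lemma H2_shift: "f \<in> H2 \<Longrightarrow> fps_shift 1 f \<in> H2"
proof -
  assume f: "f \<in> H2"
  have "cf f \<circ> (\<lambda>(j, k). (Suc j, k)) = cf (fps_shift 1 f)"
    by (auto simp: cf_def fun_eq_iff One_nat_def)
  thus ?thesis using l2_reindex(1)[OF inj_Suc_fst, of "cf f"] f by (simp add: H2_def)
qed

lemma fps_split: "f = iota (f $ 0) + fps_X * fps_shift 1 (f :: fps2)"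
  by (rule fps_ext) (auto simp: fps_X_mult_nth)

lemma fps2_split_eq_iff:
  "iota a + fps_X * f = iota b + fps_X * g \<longleftrightarrow> a = b \<and> f = (g :: fps2)"
proof
  assume *: "iota a + fps_X * f = iota b + fps_X * g"
  from arg_cong[OF *, of "\<lambda>h. h $ 0"] have "a = b" by simp
  with * show "a = b \<and> f = g" by (simp add: fps_X_neq_zero)
qed simp

lemma X_shift: "fps_X * fps_shift 1 f = f - iota (f $ 0)" for f :: fps2
  by (rule fps_ext) (auto simp: fps_X_mult_nth)

lemma iota_of_shift: "fps_shift 1 f = 0 \<Longrightarrow> f = iota (f $ 0)" for f :: fps2
  using X_shift[of f] by simp

lemma H2_iota_nth: "f \<in> H2 \<Longrightarrow> iota (f $ 0) \<in> H2"
proof -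
  assume f: "f \<in> H2"
  have "iota (f $ 0) = f - fps_X * fps_shift 1 f" unfolding X_shift by simp
  also have "\<dots> \<in> H2" by (intro H2_diff f H2_X[THEN iffD2] H2_shift)
  finally show ?thesis .
qed

lemma shift_iota: "fps_shift 1 (iota u) = 0"
  by (simp add: fps_eq_iff)

lemma ip_iota_X: "ip (iota u) (fps_X * f) = 0"
  by (simp only: ip_X_right shift_iota ip_zero_left)

lemma ip_X_iota: "ip (fps_X * f) (iota u) = 0"
  by (simp only: ip_X_left shift_iota ip_zero_right)

section \<open>Square-summable functions of z2 alone\<close>

definition H1 :: "complex fps set" where "H1 = {u. iota u \<in> H2}"
definition ip1 :: "complex fps \<Rightarrow> complex fps \<Rightarrow> complex" where "ip1 u v = ip (iota u) (iota v)"

lemma ip_iota_left: "iota u \<in> H2 \<Longrightarrow> f \<in> H2 \<Longrightarrow> ip (iota u) f = ip1 u (f $ 0)"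
proof -
  assume u: "iota u \<in> H2" and f: "f \<in> H2"
  have "ip (iota u) (f - iota (f $ 0)) = 0" unfolding X_shift[symmetric] by (rule ip_iota_X)
  thus ?thesis by (simp add: ip_diff_right u f H2_iota_nth ip1_def)
qed

lemma ip_iota_right: "iota u \<in> H2 \<Longrightarrow> f \<in> H2 \<Longrightarrow> ip f (iota u) = ip1 (f $ 0) u"
  using arg_cong[OF ip_iota_left[of u f], of cnj] by (simp add: ip1_def ip_cnj)

lemma iota_add: "iota (u + v) = iota u + iota v" and iota_diff: "iota (u - v) = iota u - iota v"
  and iota_mult: "iota (u * v) = iota u * iota v" and iota_sc: "iota (fps_const c * u) = sc c (iota u)"
  by simp_all

lemma iota_sum: "iota (sum f F) = (\<Sum>i\<in>F. iota (f i))"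
proof (induction F rule: infinite_finite_induct)
  case (insert x F)
  thus ?case by (simp only: sum.insert[OF insert.hyps] iota_add)
qed simp_all

lemma H1_iota: "u \<in> H1 \<longleftrightarrow> iota u \<in> H2" by (simp add: H1_def)
lemma H1_add: "u \<in> H1 \<Longrightarrow> v \<in> H1 \<Longrightarrow> u + v \<in> H1"
  unfolding H1_def mem_Collect_eq iota_add by (rule H2_add)
lemma H1_diff: "u \<in> H1 \<Longrightarrow> v \<in> H1 \<Longrightarrow> u - v \<in> H1"
  unfolding H1_def mem_Collect_eq iota_diff by (rule H2_diff)
lemma H1_sc: "u \<in> H1 \<Longrightarrow> fps_const c * u \<in> H1"
  unfolding H1_def mem_Collect_eq iota_sc by (rule H2_sc)
lemma H1_Xpow: "fps_X ^ n * u \<in> H1 \<longleftrightarrow> u \<in> H1"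
  unfolding H1_def mem_Collect_eq iota_mult by (rule H2_Ypow)
lemma H1_one: "1 \<in> H1"
  using H2_zpow[of 0 0] by (simp add: H1_def zpow_def)
lemma H1_Xpow1: "fps_X ^ n \<in> H1"
  using H1_Xpow[of n 1] H1_one by simp
lemma H1_zero: "0 \<in> H1" by (simp add: H1_def H2_zero)
lemma H1_sum: "(\<And>i. i \<in> F \<Longrightarrow> f i \<in> H1) \<Longrightarrow> sum f F \<in> H1"
  by (induction F rule: infinite_finite_induct) (auto intro: H1_zero H1_add)
lemma H1_nth: "f \<in> H2 \<Longrightarrow> f $ 0 \<in> H1" by (simp add: H1_def H2_iota_nth)

lemma iota_zpow: "iota (fps_X ^ k) = zpow 0 k" by (simp add: zpow_def)

lemma ip1_Xpow: "ip1 u (fps_X ^ k) = u $ k"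
  unfolding ip1_def iota_zpow ip_zpow by simp

lemma nsq_tendsto_add:
  assumes "\<And>n. u n \<in> H2" "\<And>n. v n \<in> H2" "a \<in> H2" "b \<in> H2"
    "(\<lambda>n. nsq (u n - a)) \<longlonglongrightarrow> 0" "(\<lambda>n. nsq (v n - b)) \<longlonglongrightarrow> 0"
  shows "(\<lambda>n::nat. nsq ((u n + v n) - (a + b))) \<longlonglongrightarrow> 0"
proof (rule tendsto_sandwich[OF _ _ tendsto_const])
  have "(\<lambda>n. 2 * nsq (u n - a) + 2 * nsq (v n - b)) \<longlonglongrightarrow> 2 * 0 + 2 * 0"
    by (intro tendsto_intros assms)
  thus "(\<lambda>n. 2 * nsq (u n - a) + 2 * nsq (v n - b)) \<longlonglongrightarrow> 0" by simp
  have "nsq ((u n + v n) - (a + b)) \<le> 2 * nsq (u n - a) + 2 * nsq (v n - b)" for n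
    using nsq_triangle[of "u n - a" "v n - b"] assms(1-4) by (simp add: H2_diff add_diff_add)
  thus "\<forall>\<^sub>F n in sequentially. nsq ((u n + v n) - (a + b)) \<le> 2 * nsq (u n - a) + 2 * nsq (v n - b)"
    by simp
qed (simp add: nsq_ge0)

lemma nsq_tendsto_sc:
  assumes "(\<lambda>n::nat. nsq (u n - a)) \<longlonglongrightarrow> 0"
  shows "(\<lambda>n. nsq (sc c (u n) - sc c a)) \<longlonglongrightarrow> 0"
proof -
  have "(\<lambda>n. (cmod c)\<^sup>2 * nsq (u n - a)) \<longlonglongrightarrow> (cmod c)\<^sup>2 * 0" by (intro tendsto_intros assms)
  thus ?thesis by (simp flip: right_diff_distrib add: nsq_sc)
qed

lemma nsq_tendsto_sum:
  assumes "finite F" "\<And>i n. i \<in> F \<Longrightarrow> u i n \<in> H2" "\<And>i. i \<in> F \<Longrightarrow> a i \<in> H2"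
    "\<And>i. i \<in> F \<Longrightarrow> (\<lambda>n. nsq (u i n - a i)) \<longlonglongrightarrow> 0"
  shows "(\<lambda>n::nat. nsq ((\<Sum>i\<in>F. u i n) - (\<Sum>i\<in>F. a i))) \<longlonglongrightarrow> 0"
  using assms
proof (induction F)
  case empty
  show ?case by (simp add: nsq_def lsq_def cf_simps)
next
  case (insert x F)
  have "(\<lambda>n. nsq ((u x n + (\<Sum>i\<in>F. u i n)) - (a x + (\<Sum>i\<in>F. a i)))) \<longlonglongrightarrow> 0"
    by (rule nsq_tendsto_add) (use insert in \<open>auto intro: H2_sum\<close>)
  thus ?case using insert.hyps by simp
qed

text \<open>The trace that an inner function leaves on power series: |theta| = 1 on the torus has
  become isometry. \<open>inner_isometric\<close> provides the instance.\<close>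

locale isometric_multiplier =
  fixes \<theta> :: fps2
  assumes mult_H2: "f \<in> H2 \<Longrightarrow> \<theta> * f \<in> H2"
    and mult_ip: "f \<in> H2 \<Longrightarrow> g \<in> H2 \<Longrightarrow> ip (\<theta> * f) (\<theta> * g) = ip f g"
begin

lemma mult_nsq: "f \<in> H2 \<Longrightarrow> nsq (\<theta> * f) = nsq f"
  using mult_ip[of f f] by (simp add: ip_self)

text \<open>The adjoint of multiplication by theta, given by the coefficients that adjointness
  forces on it; that they are square summable is \<open>Madj_H2\<close>.\<close>

definition Madj :: "fps2 \<Rightarrow> fps2" where
  "Madj f = mk (\<lambda>(j, k). ip f (\<theta> * zpow j k))"

lemma Madj_nth: "Madj f $ j $ k = ip f (\<theta> * zpow j k)"
  by (simp add: Madj_def mk_def)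

lemma ip_part_right:
  assumes "finite F"
  shows "ip f (part F g) = (\<Sum>p\<in>F. cnj (g $ fst p $ snd p) * f $ fst p $ snd p)"
  unfolding ip_def cf_part[OF assms] lip_trunc[OF assms] by (simp add: cf_def case_prod_beta mult.commute)

lemma Madj_part:
  assumes f: "f \<in> H2" and F: "finite F"
  shows "ip f (\<theta> * part F g) = ip (Madj f) (part F g)"
proof -
  have "\<theta> * part F g = (\<Sum>p\<in>F. sc (g $ fst p $ snd p) (\<theta> * zpow (fst p) (snd p)))"
    by (simp add: part_def sum_distrib_left mult_ac)
  also have "ip f \<dots> = (\<Sum>p\<in>F. cnj (g $ fst p $ snd p) * ip f (\<theta> * zpow (fst p) (snd p)))"
    by (subst ip_sum_right) (auto intro!: H2_sc mult_H2 H2_zpow f simp: ip_sc_right)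
  finally show ?thesis by (simp add: ip_part_right[OF F] Madj_nth)
qed

lemma Madj_H2:
  assumes f: "f \<in> H2"
  shows "Madj f \<in> H2"
proof (rule H2_boundedI(1))
  fix F :: "(nat \<times> nat) set" assume F: "finite F"
  \<comment> \<open>Duality: for this test function <f, theta g> equals |g|^2, while Cauchy-Schwarz
    and isometry bound it by |f| |g|.\<close>
  let ?g = "part F (Madj f)"
  have gH: "?g \<in> H2" by (rule part_H2)
  have "ip f (\<theta> * ?g) = (\<Sum>p\<in>F. complex_of_real ((cmod (Madj f $ fst p $ snd p))\<^sup>2))"
    unfolding Madj_part[OF f F] ip_part_right[OF F] complex_norm_square by (simp only: mult.commute)
  also have "\<dots> = complex_of_real (nsq ?g)" by (simp add: nsq_part[OF F] case_prod_beta)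
  finally have "(nsq ?g)\<^sup>2 \<le> nsq f * nsq ?g"
    using CS[OF f mult_H2[OF gH]] mult_nsq[OF gH] nsq_ge0[of ?g] by simp
  hence "nsq ?g \<le> nsq f"
    using nsq_ge0[of ?g] nsq_ge0[of f] by (cases "nsq ?g = 0") (auto simp: power2_eq_square)
  thus "(\<Sum>(j, k)\<in>F. (cmod (Madj f $ j $ k))\<^sup>2) \<le> nsq f" using nsq_part[OF F] by simp
qed

lemma ip_tendsto_right:
  assumes "\<And>n. u n \<in> H2" "a \<in> H2" "g \<in> H2" "(\<lambda>n. nsq (u n - a)) \<longlonglongrightarrow> 0"
  shows "(\<lambda>n. ip g (u n)) \<longlonglongrightarrow> ip g a"
  using tendsto_cnj[OF ip_tendsto[OF assms]] by (simp add: ip_cnj)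

lemma ip_Madj:
  assumes f: "f \<in> H2" and g: "g \<in> H2"
  shows "ip (Madj f) g = ip f (\<theta> * g)"
proof -
  obtain F where F: "\<And>n. finite (F n)" and lim: "(\<lambda>n. nsq (part (F n) g - g)) \<longlonglongrightarrow> 0"
    using H2_approx[OF g] by blast
  have lim2: "(\<lambda>n. nsq (\<theta> * part (F n) g - \<theta> * g)) \<longlonglongrightarrow> 0"
    using lim by (simp add: mult_nsq H2_diff part_H2 g flip: right_diff_distrib)
  have "(\<lambda>n. ip (Madj f) (part (F n) g)) \<longlonglongrightarrow> ip (Madj f) g"
    by (rule ip_tendsto_right[OF part_H2 g Madj_H2[OF f] lim])
  moreover have "(\<lambda>n. ip f (\<theta> * part (F n) g)) \<longlonglongrightarrow> ip f (\<theta> * g)"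
    by (rule ip_tendsto_right[OF mult_H2[OF part_H2] mult_H2[OF g] f lim2])
  ultimately show ?thesis using LIMSEQ_unique unfolding Madj_part[OF f F] by auto
qed

lemma ip_Madj': "f \<in> H2 \<Longrightarrow> g \<in> H2 \<Longrightarrow> ip g (Madj f) = ip (\<theta> * g) f"
  using arg_cong[OF ip_Madj[of f g], of cnj] by (simp add: ip_cnj)

lemma Madj_eqI:
  assumes "\<And>g. g \<in> H2 \<Longrightarrow> ip h g = ip f (\<theta> * g)" "f \<in> H2"
  shows "Madj f = h"
  by (rule H2_coeff_eqI) (simp add: ip_Madj assms H2_zpow)

lemma Madj_mult: "f \<in> H2 \<Longrightarrow> Madj (\<theta> * f) = f"
  by (rule Madj_eqI) (simp_all add: mult_ip mult_H2)

lemma Madj_add: "f \<in> H2 \<Longrightarrow> g \<in> H2 \<Longrightarrow> Madj (f + g) = Madj f + Madj g"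
  by (rule Madj_eqI) (simp_all add: ip_add_left ip_Madj Madj_H2 mult_H2 H2_add)

lemma Madj_diff: "f \<in> H2 \<Longrightarrow> g \<in> H2 \<Longrightarrow> Madj (f - g) = Madj f - Madj g"
  by (rule Madj_eqI) (simp_all add: ip_diff_left ip_Madj Madj_H2 mult_H2 H2_diff)

lemma Madj_sc: "f \<in> H2 \<Longrightarrow> Madj (sc c f) = sc c (Madj f)"
  by (rule Madj_eqI) (simp_all add: ip_sc_left ip_Madj H2_sc)

lemma Madj_shift: "f \<in> H2 \<Longrightarrow> Madj (fps_shift 1 f) = fps_shift 1 (Madj f)"
proof (rule Madj_eqI)
  fix g :: fps2 assume f: "f \<in> H2" and g: "g \<in> H2"
  have "ip (fps_shift 1 (Madj f)) g = ip (Madj f) (fps_X * g)" by (simp only: ip_X_right)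
  also have "\<dots> = ip f (\<theta> * (fps_X * g))" by (rule ip_Madj) (use f g H2_X in auto)
  also have "\<dots> = ip f (fps_X * (\<theta> * g))" by (simp add: mult_ac)
  finally show "ip (fps_shift 1 (Madj f)) g = ip (fps_shift 1 f) (\<theta> * g)" by (simp only: ip_X_right)
qed (rule H2_shift)

definition K :: "fps2 set" where "K = {f \<in> H2. \<forall>g\<in>H2. ip f (\<theta> * g) = 0}"

lemma K_iff: "f \<in> K \<longleftrightarrow> f \<in> H2 \<and> Madj f = 0"
proof (cases "f \<in> H2")
  case f: True
  show ?thesis
  proof
    assume "f \<in> K"
    thus "f \<in> H2 \<and> Madj f = 0"
      by (auto intro!: Madj_eqI simp: K_def ip_zero_left)
  next
    assume "f \<in> H2 \<and> Madj f = 0"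
    thus "f \<in> K" by (auto simp: K_def ip_Madj[symmetric] ip_zero_left)
  qed
qed (simp add: K_def)

lemma K_H2: "f \<in> K \<Longrightarrow> f \<in> H2" by (simp add: K_def)
lemma K_perp: "f \<in> K \<Longrightarrow> g \<in> H2 \<Longrightarrow> ip f (\<theta> * g) = 0" by (simp add: K_def)
lemma K_perp': "f \<in> K \<Longrightarrow> g \<in> H2 \<Longrightarrow> ip (\<theta> * g) f = 0"
  using arg_cong[OF K_perp[of f g], of cnj] by (simp add: ip_cnj)
lemma K_add: "f \<in> K \<Longrightarrow> g \<in> K \<Longrightarrow> f + g \<in> K" by (simp add: K_iff H2_add Madj_add)
lemma K_diff: "f \<in> K \<Longrightarrow> g \<in> K \<Longrightarrow> f - g \<in> K" by (simp add: K_iff H2_diff Madj_diff)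
lemma K_sc: "f \<in> K \<Longrightarrow> sc c f \<in> K" by (simp add: K_iff H2_sc Madj_sc)
lemma K_zero: "0 \<in> K" by (simp add: K_def H2_zero ip_zero_left)
lemma K_sum: "(\<And>i. i \<in> F \<Longrightarrow> f i \<in> K) \<Longrightarrow> sum f F \<in> K"
  by (induction F rule: infinite_finite_induct) (auto intro: K_zero K_add)
lemma K_shift: "f \<in> K \<Longrightarrow> fps_shift 1 f \<in> K"
  by (simp add: K_iff H2_shift Madj_shift)

text \<open>Since \<open>Madj\<close> is a left inverse of multiplication by theta,
  \<open>\<theta> * Madj f\<close> is the component of \<open>f\<close> in theta H^2.\<close>

definition proj :: "fps2 \<Rightarrow> fps2" where "proj f = f - \<theta> * Madj f"

lemma proj_K: "f \<in> H2 \<Longrightarrow> proj f \<in> K"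
  by (simp add: proj_def K_iff H2_diff Madj_H2 mult_H2 Madj_diff Madj_mult)

lemma proj_perp: "f \<in> H2 \<Longrightarrow> g \<in> K \<Longrightarrow> ip (f - proj f) g = 0"
  by (simp add: proj_def K_perp' Madj_H2)

section \<open>The splitting theta = phi + z1 psi and the commutator\<close>

definition \<phi> :: "complex fps" where "\<phi> = \<theta> $ 0"
definition \<psi> :: fps2 where "\<psi> = fps_shift 1 \<theta>"

lemma theta_split: "\<theta> = iota \<phi> + fps_X * \<psi>"
  unfolding \<phi>_def \<psi>_def by (rule fps_split)

lemma theta_nth_0: "(\<theta> * iota u) $ 0 = \<phi> * u" by (simp add: \<phi>_def)
lemma shift_theta: "fps_shift 1 (\<theta> * iota u) = \<psi> * iota u"
  by (simp add: fps_eq_iff \<psi>_def)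

definition tadj :: "complex fps \<Rightarrow> complex fps" where "tadj u = Madj (iota u) $ 0"
definition ws :: "fps2 \<Rightarrow> complex fps" where "ws f = Madj (fps_X * f) $ 0"

text \<open>\<open>Madj\<close> commutes with the backward shift in z1, whose kernel consists of the
  functions of z2.\<close>

lemma Madj_iota: "u \<in> H1 \<Longrightarrow> Madj (iota u) = iota (tadj u)"
  unfolding tadj_def
proof (rule iota_of_shift)
  assume "u \<in> H1"
  hence "fps_shift 1 (Madj (iota u)) = Madj (fps_shift 1 (iota u))" by (simp only: Madj_shift H1_iota)
  also have "\<dots> = 0" unfolding shift_iota using K_zero by (simp add: K_iff)
  finally show "fps_shift 1 (Madj (iota u)) = 0" .
qed

text \<open>The backward shift of \<open>Madj (fps_X * f)\<close> is \<open>Madj f\<close>, which is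
  0 on the model space.\<close>

lemma Madj_X_K: "f \<in> K \<Longrightarrow> Madj (fps_X * f) = iota (ws f)"
  unfolding ws_def
proof (rule iota_of_shift)
  assume f: "f \<in> K"
  hence "fps_X * f \<in> H2" by (simp add: H2_X K_H2)
  from Madj_shift[OF this] have "fps_shift 1 (Madj (fps_X * f)) = Madj f" by (simp only: shift_X)
  also have "\<dots> = 0" using f by (simp add: K_iff)
  finally show "fps_shift 1 (Madj (fps_X * f)) = 0" .
qed

lemma tadj_H1: "u \<in> H1 \<Longrightarrow> tadj u \<in> H1"
  unfolding tadj_def by (intro H1_nth Madj_H2) (simp add: H1_iota)
lemma ws_H1: "f \<in> K \<Longrightarrow> ws f \<in> H1"
  unfolding ws_def by (intro H1_nth Madj_H2) (simp add: H2_X K_H2)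

lemma phi_H1: "u \<in> H1 \<Longrightarrow> \<phi> * u \<in> H1"
  using H1_nth[OF mult_H2[of "iota u"]] unfolding theta_nth_0 H1_iota .

lemma psi_H2: "u \<in> H1 \<Longrightarrow> \<psi> * iota u \<in> H2"
  unfolding shift_theta[symmetric] by (intro H2_shift mult_H2) (simp add: H1_iota)

text \<open>On functions of \<open>z\<^sub>2\<close>, \<open>Bop\<close> is the projection onto the model space and \<open>Aop\<close> the multiplication
  by the backward shift of \<open>\<theta>\<close>. The adjoints are \<open>f \<mapsto> f $ 0\<close> and \<open>ws\<close>, hence the commutator is
  \<open>B B\<^sup>* - A A\<^sup>*\<close>. The function \<open>tadj\<close> is the adjoint of multiplication by \<open>\<phi> = \<theta>(0, \<cdot>)\<close>.\<close>

definition Bop :: "complex fps \<Rightarrow> fps2" where "Bop u = iota u - \<theta> * iota (tadj u)"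
definition Aop :: "complex fps \<Rightarrow> fps2" where "Aop u = \<psi> * iota u"
definition Cop :: "fps2 \<Rightarrow> fps2" where "Cop f = Bop (f $ 0) - Aop (ws f)"

lemma Bop_proj: "u \<in> H1 \<Longrightarrow> Bop u = proj (iota u)"
  by (simp add: Bop_def proj_def Madj_iota)

lemma Bop_K: "u \<in> H1 \<Longrightarrow> Bop u \<in> K"
  by (simp add: Bop_proj proj_K H1_iota)

lemma tadj_add: "u \<in> H1 \<Longrightarrow> v \<in> H1 \<Longrightarrow> tadj (u + v) = tadj u + tadj v"
  unfolding tadj_def iota_add by (subst Madj_add) (simp_all add: H1_iota)
lemma tadj_diff: "u \<in> H1 \<Longrightarrow> v \<in> H1 \<Longrightarrow> tadj (u - v) = tadj u - tadj v"
  unfolding tadj_def iota_diff by (subst Madj_diff) (simp_all add: H1_iota)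
lemma tadj_sc: "u \<in> H1 \<Longrightarrow> tadj (fps_const c * u) = fps_const c * tadj u"
  unfolding tadj_def iota_sc by (subst Madj_sc) (simp_all add: H1_iota)
lemma Bop_add: "u \<in> H1 \<Longrightarrow> v \<in> H1 \<Longrightarrow> Bop (u + v) = Bop u + Bop v"
  unfolding Bop_def by (simp add: tadj_add algebra_simps flip: fps_const_add)
lemma Bop_diff: "u \<in> H1 \<Longrightarrow> v \<in> H1 \<Longrightarrow> Bop (u - v) = Bop u - Bop v"
  unfolding Bop_def by (simp add: tadj_diff algebra_simps flip: fps_const_sub)
lemma Bop_sc: "u \<in> H1 \<Longrightarrow> Bop (fps_const c * u) = sc c (Bop u)"
  unfolding Bop_def by (simp only: tadj_sc iota_sc right_diff_distrib mult.left_commute)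
lemma tadj_zero: "tadj 0 = 0"
  using tadj_sc[of 0 0] by (simp add: H1_zero)
lemma Bop_zero: "Bop 0 = 0" by (simp add: Bop_def tadj_zero)
lemma Bop_sum: "(\<And>i. i \<in> F \<Longrightarrow> u i \<in> H1) \<Longrightarrow> Bop (\<Sum>i\<in>F. fps_const (c i) * u i) = (\<Sum>i\<in>F. sc (c i) (Bop (u i)))"
proof (induction F rule: infinite_finite_induct)
  case (insert x F)
  thus ?case by (simp add: Bop_add Bop_sc H1_sum H1_sc)
qed (simp_all add: Bop_zero)
lemma Aop_diff: "Aop (u - v) = Aop u - Aop v"
  unfolding Aop_def by (simp add: algebra_simps flip: fps_const_sub)
lemma Aop_add: "Aop (u + v) = Aop u + Aop v"
  unfolding Aop_def by (simp add: algebra_simps flip: fps_const_add)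
lemma Aop_sc: "Aop (fps_const c * u) = sc c (Aop u)"
  unfolding Aop_def by (simp only: iota_sc mult.left_commute)
lemma ws_add: "f \<in> K \<Longrightarrow> g \<in> K \<Longrightarrow> ws (f + g) = ws f + ws g"
  unfolding ws_def distrib_left by (subst Madj_add) (simp_all add: H2_X K_H2)
lemma ws_diff: "f \<in> K \<Longrightarrow> g \<in> K \<Longrightarrow> ws (f - g) = ws f - ws g"
  unfolding ws_def right_diff_distrib by (subst Madj_diff) (simp_all add: H2_X K_H2)
lemma ws_sc: "f \<in> K \<Longrightarrow> ws (sc c f) = fps_const c * ws f"
  using Madj_sc[of "fps_X * f" c] unfolding ws_def by (simp add: H2_X K_H2 mult_ac)
lemma Cop_add: "f \<in> K \<Longrightarrow> g \<in> K \<Longrightarrow> Cop (f + g) = Cop f + Cop g"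
  unfolding Cop_def by (simp add: ws_add Bop_add Aop_add H1_nth K_H2)
lemma Cop_diff: "f \<in> K \<Longrightarrow> g \<in> K \<Longrightarrow> Cop (f - g) = Cop f - Cop g"
  unfolding Cop_def by (simp add: ws_diff Bop_diff Aop_diff H1_nth K_H2)
lemma Cop_sc: "f \<in> K \<Longrightarrow> Cop (sc c f) = sc c (Cop f)"
  unfolding Cop_def by (simp add: ws_sc Bop_sc Aop_sc H1_nth K_H2 right_diff_distrib)
lemma ws_zero: "ws 0 = 0"
  using ws_sc[OF K_zero, of 0] by simp
lemma Cop_zero: "Cop 0 = 0"
  by (simp add: Cop_def Bop_zero ws_zero Aop_def)
lemma Cop_sum: "(\<And>i. i \<in> F \<Longrightarrow> f i \<in> K) \<Longrightarrow> Cop (\<Sum>i\<in>F. sc (c i) (f i)) = (\<Sum>i\<in>F. sc (c i) (Cop (f i)))"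
proof (induction F rule: infinite_finite_induct)
  case (insert x F)
  thus ?case by (simp add: Cop_add Cop_sc K_sum K_sc)
qed (simp_all add: Cop_zero)

text \<open>On the model space the adjoint S* of the compressed shift S is the backward shift. As S
  f = z1 f - theta \<open>ws f\<close>, shifting back gives S* S f = f - A A* f. In the other order
  z1 times the backward shift of f is f - f(0, .), whose projection is f - B B* f.\<close>

lemma commutator_formula:
  assumes f: "f \<in> K"
  shows "fps_shift 1 (proj (fps_X * f)) - proj (fps_X * fps_shift 1 f) = Cop f"
proof -
  have "fps_shift 1 (proj (fps_X * f)) = f - Aop (ws f)"
    unfolding proj_def Madj_X_K[OF f] fps_shift_diff shift_theta shift_X Aop_def ..
  moreover have "proj (fps_X * fps_shift 1 f) = f - Bop (f $ 0)"
  proof -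
    have "Madj (f - iota (f $ 0)) = - iota (tadj (f $ 0))"
      using f by (simp add: Madj_diff K_iff H2_iota_nth Madj_iota H1_nth)
    moreover have "a - b - - c = a - (b - c)" for a b c :: fps2 by simp
    ultimately show ?thesis unfolding X_shift proj_def Bop_def by (simp only: mult_minus_right)
  qed
  ultimately show ?thesis by (simp add: Cop_def)
qed

lemma ip_Bop: "u \<in> H1 \<Longrightarrow> f \<in> K \<Longrightarrow> ip (Bop u) f = ip1 u (f $ 0)"
  unfolding Bop_def
  by (subst ip_diff_left) (auto simp: K_H2 mult_H2 tadj_H1 K_perp' ip_iota_left simp flip: H1_iota)

lemma X_Aop: "fps_X * Aop u = \<theta> * iota u - iota (\<phi> * u)"
  unfolding Aop_def by (subst theta_split) (simp add: algebra_simps)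

text \<open>z1 A u = theta u - phi u, and phi u is orthogonal to z1 f.\<close>

lemma ip_Aop: "u \<in> H1 \<Longrightarrow> f \<in> K \<Longrightarrow> ip (Aop u) f = ip1 u (ws f)"
proof -
  assume u: "u \<in> H1" and f: "f \<in> K"
  have "ip (Aop u) f = ip (fps_X * Aop u) (fps_X * f)" by (simp only: ip_XX)
  also have "\<dots> = ip (\<theta> * iota u) (fps_X * f) - ip (iota (\<phi> * u)) (fps_X * f)"
    unfolding X_Aop
    by (rule ip_diff_left) (use u f in \<open>auto simp: mult_H2 H2_X K_H2 phi_H1 simp flip: H1_iota iota_mult\<close>)
  also have "\<dots> = ip (iota u) (Madj (fps_X * f))"
    using u f by (simp add: ip_iota_X ip_Madj' H2_X K_H2 H1_iota)
  finally show ?thesis by (simp add: Madj_X_K[OF f] ip1_def)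
qed

text \<open>Pythagoras: theta \<open>tadj u\<close> is the component of u in theta H^2.\<close>

lemma nsq_Bop: "u \<in> H1 \<Longrightarrow> nsq (Bop u) \<le> nsq (iota u)"
proof -
  assume u: "u \<in> H1"
  have "nsq (Bop u) = nsq (iota u) + nsq (\<theta> * iota (tadj u)) - 2 * Re (ip (iota u) (\<theta> * iota (tadj u)))"
    unfolding Bop_def by (rule nsq_diff) (use u in \<open>auto simp: mult_H2 tadj_H1 simp flip: H1_iota\<close>)
  also have "ip (iota u) (\<theta> * iota (tadj u)) = of_real (nsq (iota (tadj u)))"
    using u tadj_H1[OF u] by (simp add: H1_iota Madj_iota ip_self flip: ip_Madj)
  finally show ?thesis
    using tadj_H1[OF u] nsq_ge0[of "iota (tadj u)"] by (simp add: mult_nsq H1_iota)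
qed

text \<open>Pythagoras for theta u = phi u + z1 A u, where the left side has the norm of u.\<close>

lemma nsq_Aop: "u \<in> H1 \<Longrightarrow> nsq (Aop u) \<le> nsq (iota u)"
proof -
  assume u: "u \<in> H1"
  have "nsq (iota u) = nsq (\<theta> * iota u)" using u by (simp add: mult_nsq H1_iota)
  also have "\<theta> * iota u = iota (\<phi> * u) + fps_X * Aop u" unfolding X_Aop by simp
  also have "nsq \<dots> = nsq (iota (\<phi> * u)) + nsq (Aop u)"
    using nsq_add[of "iota (\<phi> * u)" "fps_X * Aop u"] u phi_H1[OF u] psi_H2[OF u]
    by (simp add: H1_iota ip_iota_X nsq_X H2_X Aop_def del: fps_const_mult)
  finally show ?thesis using nsq_ge0[of "iota (\<phi> * u)"] by linarith
qed

text \<open>Pair C f = 0 with f: B B* contributes |f(0, .)|^2 and A A* contributes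
  |\<open>ws f\<close>|^2.\<close>

lemma kerC_nsq:
  assumes "f \<in> K" "Cop f = 0"
  shows "nsq (iota (f $ 0)) = nsq (iota (ws f))"
proof -
  have "0 = ip (Cop f) f" by (simp add: assms ip_zero_left)
  also have "\<dots> = ip (Bop (f $ 0)) f - ip (Aop (ws f)) f"
    unfolding Cop_def
    by (rule ip_diff_left) (use assms in \<open>auto intro!: K_H2 Bop_K H1_nth psi_H2 ws_H1 simp: Aop_def\<close>)
  also have "\<dots> = ip1 (f $ 0) (f $ 0) - ip1 (ws f) (ws f)"
    using assms by (simp add: ip_Bop ip_Aop H1_nth ws_H1 K_H2)
  finally show ?thesis by (simp add: ip1_def ip_self)
qed

text \<open>If u = theta \<open>tadj u\<close>, then the part of the right side divisible by z1
  vanishes, that is psi \<open>tadj u\<close> = 0.\<close>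

lemma Bop_inj:
  assumes "\<psi> \<noteq> 0" "Bop u = 0"
  shows "u = 0"
proof -
  have *: "iota u = \<theta> * iota (tadj u)" using assms by (simp add: Bop_def)
  have "\<psi> * iota (tadj u) = 0" using arg_cong[OF *, of "fps_shift 1"] by (simp only: shift_theta shift_iota)
  hence "tadj u = 0" using assms by simp
  thus ?thesis using * by simp
qed

end

section \<open>Limits of elements of the kernel\<close>

lemma iota_limit:
  assumes u: "\<And>n. u n \<in> H2" and a: "a \<in> H2" and lim: "(\<lambda>n. nsq (u n - a)) \<longlonglongrightarrow> 0"
    and shift: "\<And>n. fps_shift 1 (u n) = 0"
  shows "a = iota (a $ 0)"
proof (rule iota_of_shift, rule H2_coeff_eqI)
  fix j l
  have "(\<lambda>n. ip (u n) (fps_X * zpow j l)) \<longlonglongrightarrow> ip a (fps_X * zpow j l)"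
    by (rule ip_tendsto[OF u a _ lim]) (simp add: H2_X H2_zpow)
  moreover have "ip (u n) (fps_X * zpow j l) = 0" for n
    unfolding ip_X_right shift by (rule ip_zero_left)
  ultimately have "ip a (fps_X * zpow j l) = 0" by (simp add: LIMSEQ_const_iff)
  thus "ip (fps_shift 1 a) (zpow j l) = ip 0 (zpow j l)"
    by (simp only: ip_X_right ip_zero_left)
qed

context isometric_multiplier
begin

text \<open>Rank of C at most k; the index runs over k + 1 vectors. This form directly hands out the
  kernel elements that the proofs need, and it allows repeated vectors.\<close>

definition rank_le :: "nat \<Rightarrow> bool" where
  "rank_le k \<longleftrightarrow> (\<forall>g. (\<forall>i\<le>k. g i \<in> K) \<longrightarrow>
     (\<exists>c. (\<exists>i\<le>k. c i \<noteq> 0) \<and> Cop (\<Sum>i\<le>k. sc (c i) (g i)) = 0))"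

text \<open>As \<open>Bop\<close> is injective, the \<open>h\<close> with \<open>Bop h\<close> orthogonal to the kernel \<open>N\<close> of the commutator form a
  space of dimension at most \<open>k\<close>. So some polynomial \<open>\<beta>\<close> of degree at most \<open>k\<close> is a limit of \<open>f $ 0\<close> with
  \<open>f \<in> N\<close>, and \<open>ws f\<close> converges along with \<open>f $ 0\<close> because both have the same norm on \<open>N\<close>.\<close>

lemma exists_Bop_eq_Aop:
  assumes rank_le: "rank_le k" and psi: "\<psi> \<noteq> 0"
  obtains \<beta> w where "\<beta> \<noteq> 0" "\<And>i. i > k \<Longrightarrow> \<beta> $ i = 0" "w \<in> H1" "Bop \<beta> = Aop w"
proof -
  define N where "N = {f \<in> K. Cop f = 0}"
  define Y where "Y = (\<lambda>f. iota (f $ 0)) ` N"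
  have N_add: "f + g \<in> N" if "f \<in> N" "g \<in> N" for f g
    using that by (simp add: N_def K_add Cop_add)
  have N_sc: "sc c f \<in> N" if "f \<in> N" for f c
    using that by (simp add: N_def K_sc Cop_sc)
  have N_zero: "0 \<in> N" by (simp add: N_def K_zero Cop_zero)
  have Y1: "Y \<subseteq> H2" by (auto simp: Y_def N_def H2_iota_nth K_H2)
  have Y2: "0 \<in> Y" unfolding Y_def by (rule image_eqI[OF _ N_zero]) simp
  have Y3: "f + g \<in> Y" if fg: "f \<in> Y" "g \<in> Y" for f g
  proof -
    obtain a b where ab: "a \<in> N" "b \<in> N" "f = iota (a $ 0)" "g = iota (b $ 0)"
      using fg by (auto simp: Y_def)
    show ?thesis unfolding Y_def
      by (rule image_eqI[OF _ N_add[OF ab(1,2)]]) (simp add: ab)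
  qed
  have Y4: "sc c f \<in> Y" if f: "f \<in> Y" for c f
  proof -
    obtain a where a: "a \<in> N" "f = iota (a $ 0)" using f by (auto simp: Y_def)
    show ?thesis unfolding Y_def
      by (rule image_eqI[OF _ N_sc[OF a(1), of c]]) (simp add: a)
  qed
  have "\<exists>a u. (\<forall>n. u n \<in> Y) \<and> a \<in> H2 \<and> (\<lambda>n::nat. nsq (u n - a)) \<longlonglongrightarrow> 0 \<and>
      (\<forall>y\<in>Y. ip (iota (fps_X ^ i) - a) y = 0)" for i
  proof -
    have "iota (fps_X ^ i) \<in> H2" using H1_Xpow1[of i] by (simp only: H1_iota)
    thus ?thesis
      by (rule projection[of Y "iota (fps_X ^ i)", OF Y1 Y2, rotated 2]) (blast, erule (1) Y3, erule Y4)
  qed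
  from choice[OF allI[OF this]] obtain a where
    "\<forall>i. \<exists>u. (\<forall>n. u n \<in> Y) \<and> a i \<in> H2 \<and> (\<lambda>n::nat. nsq (u n - a i)) \<longlonglongrightarrow> 0 \<and>
      (\<forall>y\<in>Y. ip (iota (fps_X ^ i) - a i) y = 0)" ..
  from choice[OF this] obtain u where *:
    "\<forall>i. (\<forall>n. u i n \<in> Y) \<and> a i \<in> H2 \<and> (\<lambda>n::nat. nsq (u i n - a i)) \<longlonglongrightarrow> 0 \<and>
      (\<forall>y\<in>Y. ip (iota (fps_X ^ i) - a i) y = 0)" ..
  have u: "\<And>i n. u i n \<in> Y" and a: "\<And>i. a i \<in> H2"
    and lim: "\<And>i. (\<lambda>n::nat. nsq (u i n - a i)) \<longlonglongrightarrow> 0"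
    and perp: "\<And>i y. y \<in> Y \<Longrightarrow> ip (iota (fps_X ^ i) - a i) y = 0"
    using * by blast+
  have uH: "u i n \<in> H2" for i n using u Y1 by auto
  have a_iota: "a i = iota (a i $ 0)" for i
  proof (rule iota_limit[OF uH a lim])
    fix n
    obtain f where "u i n = iota (f $ 0)" using u[of i n] unfolding Y_def by blast
    thus "fps_shift 1 (u i n) = 0" by (simp only: shift_iota)
  qed
  \<comment> \<open>The component of z2^i orthogonal to \<open>Y\<close>.\<close>
  define h where "h i = fps_X ^ i - a i $ 0" for i
  have hH: "h i \<in> H1" for i unfolding h_def by (intro H1_diff H1_Xpow1 H1_nth a)
  have iota_h: "iota (h i) = iota (fps_X ^ i) - a i" for i
    unfolding h_def iota_diff using a_iota[of i] by simp
  obtain c where c: "\<exists>i\<le>k. c i \<noteq> 0" "Cop (\<Sum>i\<le>k. sc (c i) (Bop (h i))) = 0"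
    using rank_le[unfolded rank_le_def, rule_format, of "\<lambda>i. Bop (h i)"] Bop_K[OF hH] by blast
  define \<eta> where "\<eta> = (\<Sum>i\<le>k. fps_const (c i) * h i)"
  have \<eta>H: "\<eta> \<in> H1" unfolding \<eta>_def by (intro H1_sum H1_sc hH)
  have "Bop \<eta> = (\<Sum>i\<le>k. sc (c i) (Bop (h i)))" unfolding \<eta>_def by (rule Bop_sum) (rule hH)
  hence BN: "Bop \<eta> \<in> N" using c(2) Bop_K[OF \<eta>H] by (simp add: N_def)
  have "ip (iota \<eta>) y = 0" if y: "y \<in> Y" for y
  proof -
    have "iota \<eta> = (\<Sum>i\<le>k. sc (c i) (iota (fps_X ^ i) - a i))"
      unfolding \<eta>_def iota_sum iota_sc iota_h ..
    also have "ip \<dots> y = (\<Sum>i\<le>k. ip (sc (c i) (iota (fps_X ^ i) - a i)) y)"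
      by (rule ip_sum_left) (use y Y1 H1_Xpow1 in \<open>auto intro!: H2_sc H2_diff a simp flip: H1_iota\<close>)
    also have "\<dots> = 0" by (simp add: ip_sc_left perp y)
    finally show ?thesis .
  qed
  \<comment> \<open>\<open>Bop \<eta>\<close> lies in \<open>N\<close>, so its value at z1 = 0 lies
    in \<open>Y\<close>, to which eta is orthogonal. By \<open>ip_Bop\<close> this inner product is
    the squared norm of \<open>Bop \<eta>\<close>.\<close>
  hence "ip (iota \<eta>) (iota (Bop \<eta> $ 0)) = 0" using BN by (auto simp: Y_def)
  hence "ip (Bop \<eta>) (Bop \<eta>) = 0" by (simp add: ip_Bop \<eta>H Bop_K ip1_def)
  hence "Bop \<eta> = 0" using Bop_K[OF \<eta>H] by (intro ip_self_eq0D) (auto simp: K_H2)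
  hence "\<eta> = 0" by (rule Bop_inj[OF psi])
  \<comment> \<open>As eta = 0, this combination of the z2^i equals the same combination of their
    projections \<open>a i\<close>, so it lies in the closure of \<open>Y\<close>.\<close>
  define \<beta> where "\<beta> = (\<Sum>i\<le>k. fps_const (c i) * fps_X ^ i)"
  have \<beta>_nth: "\<beta> $ i = (if i \<le> k then c i else 0)" for i
    unfolding \<beta>_def by (simp add: fps_sum_nth fps_X_power_iff if_distrib cong: if_cong)
  have \<beta>H: "\<beta> \<in> H1" unfolding \<beta>_def by (intro H1_sum H1_sc H1_Xpow1)
  have iota_\<beta>: "iota \<beta> = (\<Sum>i\<le>k. sc (c i) (a i))"
  proof -
    have "iota \<beta> - (\<Sum>i\<le>k. sc (c i) (a i)) = iota \<eta>"
      unfolding \<beta>_def \<eta>_def iota_sum iota_sc iota_h right_diff_distrib sum_subtractf ..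
    thus ?thesis using \<open>\<eta> = 0\<close> by simp
  qed
  define U where "U n = (\<Sum>i\<le>k. sc (c i) (u i n))" for n
  have U_lim: "(\<lambda>n. nsq (U n - iota \<beta>)) \<longlonglongrightarrow> 0"
    unfolding U_def iota_\<beta> by (rule nsq_tendsto_sum) (auto intro!: H2_sc uH a nsq_tendsto_sc lim)
  have sumY: "sum f F \<in> Y" if "\<And>i. i \<in> F \<Longrightarrow> f i \<in> Y" for f :: "nat \<Rightarrow> fps2" and F
    using that by (induction F rule: infinite_finite_induct) (auto intro: Y2 Y3)
  have "U n \<in> Y" for n unfolding U_def by (rule sumY, rule Y4, rule u)
  hence "\<forall>n. \<exists>f. f \<in> N \<and> U n = iota (f $ 0)" unfolding Y_def by blast
  from choice[OF this] obtain F where F: "\<And>n. F n \<in> N" "\<And>n. U n = iota (F n $ 0)" by blast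
  have FK: "F n \<in> K" for n using F by (simp add: N_def)
  have UH: "U n \<in> H2" for n unfolding F(2) by (intro H2_iota_nth K_H2 FK)
  have wsH: "iota (ws (F n)) \<in> H2" for n using ws_H1[OF FK] by (simp add: H1_iota)
  have iso: "nsq (iota (ws (F m)) - iota (ws (F n))) = nsq (U m - U n)" for m n
  proof -
    have "nsq (iota ((F m - F n) $ 0)) = nsq (iota (ws (F m - F n)))"
      by (rule kerC_nsq) (use F(1) in \<open>auto simp: N_def K_diff Cop_diff\<close>)
    thus ?thesis unfolding F(2) by (simp add: ws_diff FK)
  qed
  have "\<exists>N. \<forall>m\<ge>N. \<forall>n\<ge>N. nsq (U m - U n) \<le> e" if "e > 0" for e
  proof -
    have e4: "e / 4 > 0" using that by simp
    obtain N where "\<forall>n\<ge>N. norm (nsq (U n - iota \<beta>) - 0) < e / 4"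
      using LIMSEQ_D[OF U_lim e4] by blast
    hence N: "nsq (U n - iota \<beta>) < e / 4" if "n \<ge> N" for n
      using that nsq_ge0[of "U n - iota \<beta>"] by auto
    have "nsq (U m - U n) \<le> e" if "m \<ge> N" "n \<ge> N" for m n
      using nsq_triangle_diff[OF UH _ UH, of "iota \<beta>" m n] N[OF that(1)] N[OF that(2)]
        \<beta>H nsq_commute[of "iota \<beta>" "U n"] by (simp add: H1_iota)
    thus ?thesis by blast
  qed
  then obtain W where W: "W \<in> H2" "(\<lambda>n. nsq (iota (ws (F n)) - W)) \<longlonglongrightarrow> 0"
    using H2_complete[of "\<lambda>n. iota (ws (F n))"] wsH unfolding iso by blast
  have W_iota: "W = iota (W $ 0)"
    by (rule iota_limit[OF wsH W shift_iota])
  define w where "w = W $ 0"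
  have wH: "w \<in> H1" unfolding w_def by (rule H1_nth[OF W(1)])
  have w_lim: "(\<lambda>n. nsq (iota (ws (F n) - w))) \<longlonglongrightarrow> 0"
    using W(2) unfolding iota_diff w_def W_iota[symmetric] .
  have BA: "Bop (F n $ 0) = Aop (ws (F n))" for n
    using F(1)[of n] by (simp add: N_def Cop_def)
  have lim1: "(\<lambda>n. nsq (Bop (F n $ 0) - Bop \<beta>)) \<longlonglongrightarrow> 0"
  proof (rule tendsto_sandwich[OF _ _ tendsto_const U_lim])
    have "nsq (Bop (F n $ 0) - Bop \<beta>) \<le> nsq (U n - iota \<beta>)" for n
      using nsq_Bop[of "F n $ 0 - \<beta>"] by (simp add: F(2) Bop_diff H1_diff H1_nth K_H2 FK \<beta>H)
    thus "\<forall>\<^sub>F n in sequentially. nsq (Bop (F n $ 0) - Bop \<beta>) \<le> nsq (U n - iota \<beta>)" by simp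
  qed (simp add: nsq_ge0)
  have lim2: "(\<lambda>n. nsq (Bop (F n $ 0) - Aop w)) \<longlonglongrightarrow> 0"
  proof (rule tendsto_sandwich[OF _ _ tendsto_const w_lim])
    have "nsq (Bop (F n $ 0) - Aop w) \<le> nsq (iota (ws (F n) - w))" for n
      unfolding BA Aop_diff[symmetric] by (intro nsq_Aop H1_diff ws_H1 FK wH)
    thus "\<forall>\<^sub>F n in sequentially. nsq (Bop (F n $ 0) - Aop w) \<le> nsq (iota (ws (F n) - w))" by simp
  qed (simp add: nsq_ge0)
  have "Bop \<beta> = Aop w"
    by (rule nsq_tendsto_unique[OF _ _ _ lim1 lim2])
      (auto intro!: K_H2 Bop_K H1_nth FK \<beta>H psi_H2 wH simp: Aop_def)
  moreover have "\<beta> \<noteq> 0"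
  proof
    obtain i where i: "i \<le> k" "c i \<noteq> 0" using c(1) by blast
    assume "\<beta> = 0"
    thus False using \<beta>_nth[of i] i by simp
  qed
  ultimately show ?thesis using \<beta>_nth wH by (intro that) auto
qed

end

section \<open>Finite rank forces rationality\<close>

definition degle :: "nat \<Rightarrow> complex fps \<Rightarrow> bool" where
  "degle m x \<longleftrightarrow> (\<forall>i>m. x $ i = 0)"

lemma degleD: "degle m x \<Longrightarrow> i > m \<Longrightarrow> x $ i = 0" by (simp add: degle_def)

lemma degle_expand: "degle m x \<Longrightarrow> x = (\<Sum>i\<le>m. fps_const (x $ i) * fps_X ^ i)"
  by (rule fps_ext) (auto simp: fps_sum_nth fps_X_power_iff degle_def if_distrib cong: if_cong)

lemma degle_H1_mult:
  assumes "degle m x" "u \<in> H1"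
  shows "x * u \<in> H1"
proof -
  have "(\<Sum>i\<le>m. fps_const (x $ i) * fps_X ^ i) * u = (\<Sum>i\<le>m. fps_const (x $ i) * (fps_X ^ i * u))"
    by (simp add: sum_distrib_right mult.assoc)
  also have "\<dots> \<in> H1" by (intro H1_sum H1_sc H1_Xpow[THEN iffD2] assms)
  finally show ?thesis using degle_expand[OF assms(1)] by argo
qed

lemma degle_H1: "degle m x \<Longrightarrow> x \<in> H1"
  using degle_H1_mult[of m x 1] by (simp add: H1_one)

lemma degle_mult:
  assumes "degle m x" "degle n y" shows "degle (m + n) (x * y)"
  unfolding degle_def
proof (intro allI impI)
  fix i assume i: "m + n < i"
  have "x $ j * y $ (i - j) = 0" if "j \<in> {0..i}" for j
    using degleD[OF assms(1), of j] degleD[OF assms(2), of "i - j"] i that by (cases "j > m") auto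
  thus "(x * y) $ i = 0" unfolding fps_mult_nth by (intro sum.neutral ballI)
qed

lemma degle_diff: "degle m x \<Longrightarrow> degle m y \<Longrightarrow> degle m (x - y)" by (simp add: degle_def)
lemma degle_le: "degle m x \<Longrightarrow> m \<le> n \<Longrightarrow> degle n x" by (simp add: degle_def)
lemma degle_X: "degle n (fps_X ^ n)" by (simp add: degle_def fps_X_power_iff)
lemma degle_Xpow_mult: "degle m x \<Longrightarrow> degle (n + m) (fps_X ^ n * x)"
  by (rule degle_mult[OF degle_X])
lemma degle_zero: "degle n 0" by (simp add: degle_def)

lemma ip1_cnj: "cnj (ip1 u v) = ip1 v u" by (simp add: ip1_def ip_cnj)
lemma ip1_diff_left: "u \<in> H1 \<Longrightarrow> v \<in> H1 \<Longrightarrow> w \<in> H1 \<Longrightarrow> ip1 (u - v) w = ip1 u w - ip1 v w"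
  unfolding ip1_def iota_diff H1_iota by (rule ip_diff_left)

lemma ip1_finite:
  assumes "degle m x" "u \<in> H1"
  shows "ip1 u x = (\<Sum>i\<le>m. u $ i * cnj (x $ i))"
proof -
  have 1: "iota x = (\<Sum>i\<le>m. sc (x $ i) (iota (fps_X ^ i)))"
    using arg_cong[OF degle_expand[OF assms(1)], of iota] unfolding iota_sum iota_sc .
  have "ip1 u x = (\<Sum>i\<le>m. ip (iota u) (sc (x $ i) (iota (fps_X ^ i))))"
    unfolding ip1_def 1
    by (rule ip_sum_right) (use assms(2) H1_Xpow1 in \<open>auto intro!: H2_sc simp: H1_iota simp del: fps_const_mult\<close>)
  also have "\<dots> = (\<Sum>i\<le>m. u $ i * cnj (x $ i))"
    unfolding ip_sc_right ip1_def[symmetric] ip1_Xpow by (simp add: mult.commute)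
  finally show ?thesis .
qed

lemma ip1_XX: "ip1 (fps_X ^ n * u) (fps_X ^ n * v) = ip1 u v"
  unfolding ip1_def iota_mult by (rule ip_YYpow)

definition creflect :: "nat \<Rightarrow> complex fps \<Rightarrow> complex fps" where
  "creflect m x = Abs_fps (\<lambda>j. if j \<le> m then cnj (x $ (m - j)) else 0)"

lemma degle_creflect: "degle m (creflect m x)" by (simp add: degle_def creflect_def)

lemma creflect_creflect: "degle m x \<Longrightarrow> creflect m (creflect m x) = x"
  by (rule fps_ext) (auto simp: creflect_def degle_def)

lemma creflect_eq_0_iff: "degle m x \<Longrightarrow> creflect m x = 0 \<longleftrightarrow> x = 0"
proof
  assume x: "degle m x" and "creflect m x = 0"
  hence "creflect m 0 = x" using creflect_creflect[OF x] by simp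
  moreover have "creflect m 0 = 0" by (rule fps_ext) (simp add: creflect_def)
  ultimately show "x = 0" by simp
next
  assume "x = 0"
  thus "creflect m x = 0" by (intro fps_ext) (simp add: creflect_def)
qed

text \<open>On the unit circle, multiplication by \<open>creflect m x\<close> is multiplication by \<open>z\<^sup>m\<close> times the
  conjugate of \<open>x\<close>.\<close>

lemma mult_creflect_nth:
  assumes x: "degle m x" and v: "v \<in> H1"
  shows "(v * creflect m x) $ N = ip1 (fps_X ^ m * v) (fps_X ^ N * x)"
proof -
  have "ip1 (fps_X ^ m * v) (fps_X ^ N * x) =
      (\<Sum>i\<le>N + m. (fps_X ^ m * v) $ i * cnj ((fps_X ^ N * x) $ i))"
    by (rule ip1_finite[OF degle_Xpow_mult[OF x]]) (simp add: H1_Xpow v)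
  also have "\<dots> = (\<Sum>i\<in>{0 + m..N + m}. (fps_X ^ m * v) $ i * cnj ((fps_X ^ N * x) $ i))"
    by (rule sum.mono_neutral_right) (auto simp: fps_X_power_mult_nth)
  also have "\<dots> = (\<Sum>j\<in>{0..N}. (fps_X ^ m * v) $ (j + m) * cnj ((fps_X ^ N * x) $ (j + m)))"
    by (rule sum.shift_bounds_cl_nat_ivl)
  also have "\<dots> = (\<Sum>j\<in>{0..N}. v $ j * creflect m x $ (N - j))"
    by (rule sum.cong) (auto simp: fps_X_power_mult_nth creflect_def add.commute)
  finally show ?thesis by (simp add: fps_mult_nth)
qed

lemma one_mult_creflect_nth: "degle m x \<Longrightarrow> creflect m x $ N = ip1 (fps_X ^ m) (fps_X ^ N * x)"
  using mult_creflect_nth[of m x 1 N] by (simp add: H1_one)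

section \<open>Representations of theta as a fraction of degree one in z1\<close>

context isometric_multiplier
begin

definition \<theta>1 :: "complex fps" where "\<theta>1 = \<psi> $ 0"

lemma theta1_H1: "u \<in> H1 \<Longrightarrow> \<theta>1 * u \<in> H1"
  using H1_nth[OF psi_H2[of u]] by (simp add: \<theta>1_def)

lemma tadj_nth: "u \<in> H1 \<Longrightarrow> tadj u $ k = ip1 u (\<phi> * fps_X ^ k)"
proof -
  assume u: "u \<in> H1"
  have "tadj u $ k = ip (iota u) (\<theta> * iota (fps_X ^ k))"
    using u by (simp add: tadj_def Madj_nth zpow_def H1_iota)
  also have "\<dots> = ip1 u ((\<theta> * iota (fps_X ^ k)) $ 0)"
    by (rule ip_iota_left) (use u H1_Xpow1 in \<open>auto intro!: mult_H2 simp flip: H1_iota\<close>)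
  finally show ?thesis unfolding theta_nth_0 .
qed

lemma ip1_tadj: "u \<in> H1 \<Longrightarrow> v \<in> H1 \<Longrightarrow> ip1 (tadj u) v = ip1 u (\<phi> * v)"
proof -
  assume u: "u \<in> H1" and v: "v \<in> H1"
  have "ip1 (tadj u) v = ip (iota u) (\<theta> * iota v)"
    unfolding ip1_def Madj_iota[OF u, symmetric] by (rule ip_Madj) (use u v in \<open>simp_all add: H1_iota\<close>)
  also have "\<dots> = ip1 u ((\<theta> * iota v) $ 0)"
    by (rule ip_iota_left) (use u v in \<open>auto intro!: mult_H2 simp flip: H1_iota\<close>)
  finally show ?thesis unfolding theta_nth_0 .
qed

text \<open>The k-th coefficient is an inner product with phi z2^k, which has no terms below
  z2^k.\<close>

lemma degle_tadj: "degle n u \<Longrightarrow> degle n (tadj u)"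
proof -
  assume u: "degle n u"
  have "ip1 u (\<phi> * fps_X ^ k) = 0" if "k > n" for k
  proof -
    have "ip1 (\<phi> * fps_X ^ k) u = (\<Sum>i\<le>n. (\<phi> * fps_X ^ k) $ i * cnj (u $ i))"
      by (rule ip1_finite[OF u]) (rule phi_H1[OF H1_Xpow1])
    also have "\<dots> = 0" using that by (intro sum.neutral) (simp add: fps_X_power_mult_right_nth)
    finally show ?thesis by (metis complex_cnj_zero ip1_cnj)
  qed
  thus ?thesis by (simp add: degle_def tadj_nth degle_H1[OF u])
qed

text \<open>theta = (v + z1 x) / (w + z1 y), cleared of its denominator so that it makes sense for
  power series. The trivial denominator is not excluded here.\<close>

definition moebius :: "complex fps \<Rightarrow> complex fps \<Rightarrow> complex fps \<Rightarrow> complex fps \<Rightarrow> bool" where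
  "moebius v x w y \<longleftrightarrow> v \<in> H1 \<and> x \<in> H1 \<and> w \<in> H1 \<and> y \<in> H1 \<and>
     \<theta> * (iota w + fps_X * iota y) = iota v + fps_X * iota x"

lemma moebius_H1: "moebius v x w y \<Longrightarrow> v \<in> H1" "moebius v x w y \<Longrightarrow> x \<in> H1"
  "moebius v x w y \<Longrightarrow> w \<in> H1" "moebius v x w y \<Longrightarrow> y \<in> H1"
  by (simp_all add: moebius_def)

lemma moebius_eq: "moebius v x w y \<Longrightarrow> \<theta> * (iota w + fps_X * iota y) = iota v + fps_X * iota x"
  by (simp add: moebius_def)

lemma moebius_mult:
  assumes "moebius v x w y" "v * u \<in> H1" "x * u \<in> H1" "w * u \<in> H1" "y * u \<in> H1"
  shows "moebius (v * u) (x * u) (w * u) (y * u)"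
proof -
  have "\<theta> * (iota (w * u) + fps_X * iota (y * u)) = \<theta> * (iota w + fps_X * iota y) * iota u"
    unfolding iota_mult by (simp only: algebra_simps)
  also have "\<dots> = iota (v * u) + fps_X * iota (x * u)"
    unfolding moebius_eq[OF assms(1)] iota_mult by (simp only: algebra_simps)
  finally show ?thesis using assms by (simp add: moebius_def)
qed

lemma moebius_degle:
  assumes "moebius v x w y" "degle m u"
  shows "moebius (v * u) (x * u) (w * u) (y * u)"
  by (rule moebius_mult[OF assms(1)])
    (use moebius_H1[OF assms(1)] degle_H1_mult[OF assms(2)] in \<open>simp_all add: mult.commute[of _ u]\<close>)

lemma moebius_phi:
  assumes "moebius v x w y"
  shows "moebius (v * \<phi>) (x * \<phi>) (w * \<phi>) (y * \<phi>)"
  by (rule moebius_mult[OF assms]) (use moebius_H1[OF assms] phi_H1 in \<open>simp_all add: mult.commute\<close>)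

text \<open>Insert theta = phi + z1 psi and compare the terms free of z1 with those divisible by z1.
  With y = \<open>tadj x\<close> the second equation reads \<open>Bop x = Aop w\<close>.\<close>

lemma moebius_shift:
  assumes "moebius v x w y"
  shows "v = \<phi> * w" "\<psi> * iota w + \<theta> * iota y = iota x"
proof -
  have "iota (\<phi> * w) + fps_X * (\<psi> * iota w + \<theta> * iota y) = iota v + fps_X * iota x"
    using moebius_eq[OF assms] unfolding iota_mult
    by (subst (asm) distrib_left) (subst (asm) (1) theta_split, simp only: algebra_simps)
  thus "v = \<phi> * w" "\<psi> * iota w + \<theta> * iota y = iota x" unfolding fps2_split_eq_iff by auto
qed

lemma moebius_theta1: "moebius v x w y \<Longrightarrow> \<theta>1 * w + \<phi> * y = x"
  using arg_cong[OF moebius_shift(2), of v x w y "\<lambda>f. f $ 0"] by (simp add: \<theta>1_def \<phi>_def)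

text \<open>Weak form of conj(phi) x = y, the z1-coefficient of conj(theta) (v + z1 x) = w + z1 y:
  isometry is applied to z1 g and the denominator.\<close>

lemma moebius_phi_ip:
  assumes t: "moebius v x w y" and g: "g \<in> H1"
  shows "ip1 (\<phi> * g) x = ip1 g y"
proof -
  note H = moebius_H1[OF t] g
  note I = H[unfolded H1_iota]
  have "ip (\<theta> * (fps_X * iota g)) (\<theta> * (iota w + fps_X * iota y)) = ip (fps_X * iota g) (iota w + fps_X * iota y)"
    by (rule mult_ip) (use I in \<open>auto intro!: H2_add H2_X[THEN iffD2]\<close>)
  also have "\<dots> = ip1 g y"
    by (subst ip_add_right) (use I in \<open>auto simp: H2_X ip_X_iota ip_XX ip1_def\<close>)
  also have "\<theta> * (fps_X * iota g) = fps_X * (\<theta> * iota g)" by (rule mult.left_commute)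
  also have "\<theta> * (iota w + fps_X * iota y) = iota v + fps_X * iota x" by (rule moebius_eq[OF t])
  also have "ip (fps_X * (\<theta> * iota g)) (iota v + fps_X * iota x) = ip (\<theta> * iota g) (iota x)"
    by (subst ip_add_right) (use I in \<open>auto simp: H2_X ip_X_iota ip_XX ip1_def mult_H2\<close>)
  also have "\<dots> = ip1 ((\<theta> * iota g) $ 0) x"
    by (rule ip_iota_right) (use I in \<open>auto simp: mult_H2\<close>)
  finally show ?thesis unfolding theta_nth_0 .
qed

lemma moebius_tadj: "moebius v x w y \<Longrightarrow> tadj x = y"
proof (rule fps_ext)
  fix k assume t: "moebius v x w y"
  have "cnj (tadj x $ k) = cnj (y $ k)"
    unfolding tadj_nth[OF moebius_H1(2)[OF t]] ip1_cnj moebius_phi_ip[OF t H1_Xpow1]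
    by (metis ip1_Xpow ip1_cnj)
  thus "tadj x $ k = y $ k" by simp
qed

lemma moebius_Bop: "moebius v x w y \<Longrightarrow> Bop x = Aop w"
  using moebius_shift(2)[of v x w y] moebius_tadj[of v x w y] unfolding Bop_def Aop_def
  by (metis add_diff_cancel_right')

text \<open>The equation says psi w + theta y = x with y = \<open>tadj x\<close>; multiplying by z1
  and adding phi w to both sides produces the fraction.\<close>

lemma Bop_moebius:
  assumes "Bop x = Aop w" "x \<in> H1" "w \<in> H1"
  shows "moebius (\<phi> * w) x w (tadj x)"
proof -
  have "\<psi> * iota w + \<theta> * iota (tadj x) = iota x"
    using assms(1) unfolding Bop_def Aop_def by (metis diff_add_cancel)
  have "\<theta> * (iota w + fps_X * iota (tadj x)) = \<theta> * iota w + fps_X * (\<theta> * iota (tadj x))"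
    by (simp only: algebra_simps)
  also have "\<theta> * iota w = iota \<phi> * iota w + fps_X * (\<psi> * iota w)"
    by (subst theta_split) (simp only: algebra_simps)
  also have "iota \<phi> * iota w + fps_X * (\<psi> * iota w) + fps_X * (\<theta> * iota (tadj x)) =
      iota (\<phi> * w) + fps_X * (\<psi> * iota w + \<theta> * iota (tadj x))"
    unfolding iota_mult by (simp only: algebra_simps)
  also have "\<psi> * iota w + \<theta> * iota (tadj x) = iota x" by fact
  finally show ?thesis using assms by (simp add: moebius_def phi_H1 tadj_H1)
qed

text \<open>By adjointness the two sides are <f, B x> and <f, A w>. Applied to powers of z2 times
  the fraction, this controls the high coefficients of \<open>w * f $ 0 - x * ws f\<close>.\<close>

lemma moebius_K:
  assumes "moebius v x w y" "f \<in> K"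
  shows "ip1 (f $ 0) x = ip1 (ws f) w"
proof -
  have "ip1 x (f $ 0) = ip1 w (ws f)"
    using ip_Bop[OF moebius_H1(2)[OF assms(1)] assms(2)] ip_Aop[OF moebius_H1(3)[OF assms(1)] assms(2)]
      moebius_Bop[OF assms(1)] by simp
  thus ?thesis by (metis ip1_cnj)
qed

text \<open>Weak form of w = conj(phi) v + conj(\<open>\<theta>1\<close>) x, the term free of z1 in
  conj(theta) (v + z1 x) = w + z1 y.\<close>

lemma moebius_den_ip:
  assumes t: "moebius v x w y" and p: "p \<in> H1"
  shows "ip1 p w = ip1 (\<phi> * p) v + ip1 (\<theta>1 * p) x"
proof -
  note H = moebius_H1[OF t] p
  note I = H[unfolded H1_iota]
  have "ip (\<theta> * iota p) (\<theta> * (iota w + fps_X * iota y)) = ip (iota p) (iota w + fps_X * iota y)"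
    by (rule mult_ip) (use I in \<open>auto intro!: H2_add H2_X[THEN iffD2]\<close>)
  also have "\<dots> = ip1 p w"
    by (subst ip_add_right) (use I in \<open>auto simp: H2_X ip_iota_X ip1_def\<close>)
  also have "\<theta> * (iota w + fps_X * iota y) = iota v + fps_X * iota x" by (rule moebius_eq[OF t])
  also have "ip (\<theta> * iota p) (iota v + fps_X * iota x) = ip (\<theta> * iota p) (iota v) + ip (\<theta> * iota p) (fps_X * iota x)"
    by (rule ip_add_right) (use I in \<open>auto simp: H2_X mult_H2\<close>)
  also have "ip (\<theta> * iota p) (iota v) = ip1 ((\<theta> * iota p) $ 0) v"
    by (rule ip_iota_right) (use I in \<open>auto simp: mult_H2\<close>)
  also have "ip (\<theta> * iota p) (fps_X * iota x) = ip (\<psi> * iota p) (iota x)"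
    unfolding ip_X_right shift_theta ..
  also have "\<dots> = ip1 ((\<psi> * iota p) $ 0) x"
    by (rule ip_iota_right) (use I psi_H2[OF p] in auto)
  finally show ?thesis unfolding theta_nth_0 by (simp add: \<theta>1_def)
qed

text \<open>The conjugate of conj(phi) x = y times z2^m, read off coefficient by coefficient. This
  is what makes phi rational.\<close>

lemma moebius_creflect_phi:
  assumes t: "moebius v x w y" and "degle m x" "degle m y"
  shows "\<phi> * creflect m x = creflect m y"
proof (rule fps_ext)
  fix N
  have "(\<phi> * creflect m x) $ N = ip1 (\<phi> * fps_X ^ m) (x * fps_X ^ N)"
    using mult_creflect_nth[of m x \<phi> N] assms(2) phi_H1[OF H1_one] by (simp add: mult.commute)
  also have "\<dots> = ip1 (fps_X ^ m) (y * fps_X ^ N)"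
    by (rule moebius_phi_ip[OF moebius_degle[OF t degle_X] H1_Xpow1])
  also have "\<dots> = creflect m y $ N" using one_mult_creflect_nth[OF assms(3)] by (simp add: mult.commute)
  finally show "(\<phi> * creflect m x) $ N = creflect m y $ N" .
qed

lemma ip1_high:
  assumes "degle n x" "n < s" "u \<in> H1"
  shows "ip1 (fps_X ^ s * u) x = 0"
  using assms by (subst ip1_finite[OF assms(1)]) (auto simp: H1_Xpow fps_X_power_mult_nth intro!: sum.neutral)

text \<open>Now A = 0 and B kills phi H^2, so C fixes each B p. A dependence among the C B z2^i with
  i at most n is therefore a polynomial p with B p = 0, that is p = theta \<open>tadj p\<close>, and
  \<open>tadj\<close> does not raise the degree.\<close>

lemma rank_le_psi_zero:
  assumes rank_le: "rank_le n" and psi: "\<psi> = 0"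
  obtains p q where "degle n p" "degle n q" "q \<noteq> 0" "moebius p 0 q 0"
proof -
  have \<theta>: "\<theta> = iota \<phi>" using theta_split psi by simp
  obtain c where c: "\<exists>i\<le>n. c i \<noteq> 0" "Cop (\<Sum>i\<le>n. sc (c i) (Bop (fps_X ^ i))) = 0"
    using rank_le[unfolded rank_le_def, rule_format, of "\<lambda>i. Bop (fps_X ^ i)"] Bop_K[OF H1_Xpow1] by blast
  define p where "p = (\<Sum>i\<le>n. fps_const (c i) * fps_X ^ i)"
  have p_nth: "p $ i = (if i \<le> n then c i else 0)" for i
    unfolding p_def by (simp add: fps_sum_nth fps_X_power_iff if_distrib cong: if_cong)
  have dp: "degle n p" by (simp add: degle_def p_nth)
  have pH: "p \<in> H1" by (rule degle_H1[OF dp])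
  have Bphi: "Bop (\<phi> * u) = 0" if "u \<in> H1" for u
  proof -
    have "tadj (\<phi> * u) = u"
      unfolding tadj_def iota_mult \<theta>[symmetric] using that by (simp add: Madj_mult H1_iota)
    thus ?thesis unfolding Bop_def iota_mult \<theta>[symmetric] by simp
  qed
  have "Bop p = (\<Sum>i\<le>n. sc (c i) (Bop (fps_X ^ i)))" unfolding p_def by (rule Bop_sum) (rule H1_Xpow1)
  hence "0 = Cop (Bop p)" using c(2) by simp
  also have "\<dots> = Bop (Bop p $ 0)" by (simp add: Cop_def Aop_def psi)
  also have "Bop p $ 0 = p - \<phi> * tadj p" by (simp add: Bop_def \<phi>_def)
  also have "Bop \<dots> = Bop p" by (simp add: Bop_diff pH phi_H1 tadj_H1 Bphi)
  finally have "iota p = \<theta> * iota (tadj p)" by (simp add: Bop_def)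
  hence "moebius p 0 (tadj p) 0" by (simp add: moebius_def pH tadj_H1 H1_zero)
  moreover have "tadj p \<noteq> 0"
  proof
    assume "tadj p = 0"
    hence "p = 0" using \<open>iota p = \<theta> * iota (tadj p)\<close> by simp
    moreover obtain i where "i \<le> n" "c i \<noteq> 0" using c(1) by blast
    ultimately show False using p_nth[of i] by simp
  qed
  ultimately show ?thesis using dp degle_tadj[OF dp] by (intro that[of p "tadj p"]) auto
qed

text \<open>On the circle, \<open>\<theta> = (\<phi> w + z\<^sub>1 \<beta>) / (w + z\<^sub>1 y)\<close> being inner forces \<open>y = cnj \<phi> * \<beta>\<close> and
  \<open>\<theta>1 * cnj \<beta> = (1 - \<bar>\<phi>\<bar>\<^sup>2) * cnj w\<close>. The first equation makes \<open>y\<close> a polynomial and \<open>\<phi>\<close> rational; multiplied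
  by the denominators of \<open>1 - \<bar>\<phi>\<bar>\<^sup>2\<close>, the second one then makes \<open>w\<close> rational.\<close>

lemma rank_le_imp_rational:
  assumes rank_le: "rank_le n"
  obtains m v x w y where "degle m v" "degle m x" "degle m w" "degle m y" "w \<noteq> 0 \<or> y \<noteq> 0" "moebius v x w y"
proof (cases "\<psi> = 0")
  case True
  from rank_le_psi_zero[OF rank_le this] obtain p q where "degle n p" "degle n q" "q \<noteq> 0" "moebius p 0 q 0" .
  thus ?thesis using degle_zero by (intro that[of n p 0 q 0]) auto
next
  case psi: False
  obtain \<beta> w where \<beta>: "\<beta> \<noteq> 0" "\<And>i. i > n \<Longrightarrow> \<beta> $ i = 0" and w: "w \<in> H1" and BA: "Bop \<beta> = Aop w"
    using exists_Bop_eq_Aop[OF rank_le psi] by blast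
  have d\<beta>: "degle n \<beta>" using \<beta>(2) by (simp add: degle_def)
  define y where "y = tadj \<beta>"
  have t: "moebius (\<phi> * w) \<beta> w y" unfolding y_def by (rule Bop_moebius[OF BA degle_H1[OF d\<beta>] w])
  have dy: "degle n y" unfolding y_def by (rule degle_tadj[OF d\<beta>])
  define b' where "b' = creflect n \<beta>"
  define y' where "y' = creflect n y"
  have d': "degle n b'" "degle n y'" unfolding b'_def y'_def by (rule degle_creflect)+
  have phi_b': "\<phi> * b' = y'" unfolding b'_def y'_def by (rule moebius_creflect_phi[OF t d\<beta> dy])
  have b'0: "b' \<noteq> 0" using \<beta>(1) creflect_eq_0_iff[OF d\<beta>] by (simp add: b'_def)
  have yw: "y \<noteq> 0 \<or> w \<noteq> 0"
  proof (rule ccontr)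
    assume "\<not> ?thesis"
    hence "y = 0" "w = 0" by auto
    hence "fps_X * iota \<beta> = 0" using moebius_eq[OF t] by simp
    thus False using \<beta>(1) by simp
  qed
  show ?thesis
  proof (cases "w = 0")
    case True
    hence "moebius 0 \<beta> 0 y" using t by simp
    thus ?thesis using True yw d\<beta> dy degle_zero by (intro that[of n 0 \<beta> 0 y]) auto
  next
    case w0: False
    \<comment> \<open>On the circle r = z2^n (|beta|^2 - |y|^2), which is z2^n |beta|^2 (1 -
      |phi|^2).\<close>
    define r where "r = b' * \<beta> - y' * y"
    have dr: "degle (n + n) r" unfolding r_def by (intro degle_diff degle_mult d' d\<beta> dy)
    have br: "b' * \<theta>1 * w = r"
    proof -
      have "b' * (\<theta>1 * w + \<phi> * y) = b' * \<beta>" by (simp add: moebius_theta1[OF t])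
      hence "b' * \<theta>1 * w + (\<phi> * b') * y = b' * \<beta>" by (simp only: algebra_simps)
      thus ?thesis unfolding phi_b' r_def by (simp add: algebra_simps)
    qed
    have r0: "r \<noteq> 0"
    proof
      assume "r = 0"
      hence "\<theta>1 = 0" using br b'0 w0 by simp
      hence 1: "\<phi> * y = \<beta>" using moebius_theta1[OF t] by simp
      have "\<theta> * (iota w + fps_X * iota y) = iota \<phi> * (iota w + fps_X * iota y)"
        unfolding moebius_eq[OF t] 1[symmetric] iota_mult by (simp only: algebra_simps)
      moreover have "iota w + fps_X * iota y \<noteq> 0"
      proof
        assume "iota w + fps_X * iota y = 0"
        hence "(iota w + fps_X * iota y) $ 0 = 0" by simp
        thus False using w0 by simp
      qed
      ultimately have "\<theta> = iota \<phi>" by simp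
      hence "fps_X * \<psi> = 0" using theta_split by simp
      thus False using psi by simp
    qed
    define r' where "r' = creflect (n + n) r"
    have dr': "degle (n + n) r'" unfolding r'_def by (rule degle_creflect)
    have r'0: "r' \<noteq> 0" unfolding r'_def using creflect_eq_0_iff[OF dr] r0 by simp
    have vanish: "(w * r') $ N = 0" if N: "N > n + n + n" for N
    proof -
      define s where "s = N - (n + n)"
      have Ns: "N = (n + n) + s" and s: "s > n" using N by (auto simp: s_def)
      \<comment> \<open>\<open>p\<close> and \<open>u\<close> are chosen so that phi p = beta u and
        p - y u = z2^s r. Since s exceeds the degree of beta, the \<open>\<theta>1\<close> term of
        \<open>moebius_den_ip\<close> drops out.\<close>
      define p where "p = fps_X ^ s * (b' * \<beta>)"
      have dp: "degle (s + (n + n)) p" unfolding p_def by (intro degle_Xpow_mult degle_mult d' d\<beta>)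
      define u where "u = fps_X ^ s * y'"
      have du: "degle (s + n) u" unfolding u_def by (intro degle_Xpow_mult d')
      have pu: "\<phi> * p = \<beta> * u" unfolding p_def u_def phi_b'[symmetric] by (simp only: mult_ac)
      have "ip1 p w = ip1 (\<phi> * p) (\<phi> * w) + ip1 (\<theta>1 * p) \<beta>"
        by (rule moebius_den_ip[OF t degle_H1[OF dp]])
      also have "\<theta>1 * p = fps_X ^ s * (\<theta>1 * (b' * \<beta>))" by (simp add: p_def mult_ac)
      also have "ip1 \<dots> \<beta> = 0"
        by (rule ip1_high[OF d\<beta> s]) (intro theta1_H1 degle_H1[OF degle_mult[OF d'(1) d\<beta>]])
      also have "ip1 (\<phi> * p) (\<phi> * w) = cnj (ip1 (\<phi> * w) (\<beta> * u))" unfolding pu ip1_cnj ..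
      also have "\<dots> = ip1 (y * u) w" unfolding moebius_phi_ip[OF moebius_degle[OF t du] w] ip1_cnj ..
      finally have *: "ip1 p w - ip1 (y * u) w = 0" by simp
      have "fps_X ^ s * r = p - y * u" unfolding r_def p_def u_def by (simp only: algebra_simps)
      hence "ip1 (fps_X ^ s * r) w = 0"
        using * ip1_diff_left[OF degle_H1[OF dp] degle_H1_mult[OF dy degle_H1[OF du]] w] by simp
      hence 0: "ip1 w (fps_X ^ s * r) = 0" by (metis complex_cnj_zero ip1_cnj)
      have "(w * r') $ N = ip1 (fps_X ^ (n + n) * w) (fps_X ^ (n + n) * (fps_X ^ s * r))"
        unfolding r'_def mult_creflect_nth[OF dr w] Ns power_add mult.assoc ..
      also have "\<dots> = 0" unfolding ip1_XX by (rule 0)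
      finally show ?thesis .
    qed
    define q where "q = w * r'"
    have dq: "degle (n + n + n) q" unfolding q_def degle_def using vanish by blast
    \<comment> \<open>All four entries become polynomials: \<open>b'\<close> clears the denominator
      of phi, and \<open>r'\<close> that of w.\<close>
    let ?u = "b' * r'"
    have du: "degle (n + (n + n)) ?u" by (intro degle_mult d' dr')
    have "moebius (\<phi> * w * ?u) (\<beta> * ?u) (w * ?u) (y * ?u)" by (rule moebius_degle[OF t du])
    moreover have "\<phi> * w * ?u = y' * q" unfolding q_def phi_b'[symmetric] by (simp only: mult_ac)
    moreover have "w * ?u = b' * q" unfolding q_def by (simp only: mult_ac)
    ultimately have "moebius (y' * q) (\<beta> * ?u) (b' * q) (y * ?u)" by simp
    moreover have "b' * q \<noteq> 0" using b'0 w0 r'0 by (simp add: q_def)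
    moreover have "degle (n + (n + n + n)) (y' * q)" "degle (n + (n + (n + n))) (\<beta> * ?u)"
      "degle (n + (n + n + n)) (b' * q)" "degle (n + (n + (n + n))) (y * ?u)"
      by (intro degle_mult d' dq d\<beta> dy dr')+
    ultimately show ?thesis
      by (intro that[of "4 * n" "y' * q" "\<beta> * ?u" "b' * q" "y * ?u"]) (auto elim!: degle_le)
  qed
qed

end

section \<open>The rank of a rational multiplier\<close>

text \<open>Dependence of a set does not see repetitions, so a repeated vector is treated apart: its
  two occurrences cancel.\<close>

lemma span_dependent:
  fixes g :: "nat \<Rightarrow> 'a \<Rightarrow> complex"
  assumes T: "finite T" "card T \<le> m" and g: "\<And>i. i \<le> m \<Longrightarrow> g i \<in> cfun.span T"
  obtains c where "\<exists>i\<le>m. c i \<noteq> 0" "\<And>a. (\<Sum>i\<le>m. c i * g i a) = 0"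
proof (cases "inj_on g {..m}")
  case False
  then obtain i j where ij: "i \<le> m" "j \<le> m" "i \<noteq> j" "g i = g j" by (auto simp: inj_on_def)
  define c where "c l = (if l = i then 1 else if l = j then -1 else 0 :: complex)" for l
  have "(\<Sum>l\<le>m. c l * g l a) = (\<Sum>l\<in>{i, j}. c l * g l a)" for a
    by (rule sum.mono_neutral_right) (use ij in \<open>auto simp: c_def\<close>)
  hence "(\<Sum>l\<le>m. c l * g l a) = 0" for a using ij by (simp add: c_def)
  moreover have "\<exists>l\<le>m. c l \<noteq> 0" by (rule exI[of _ i]) (simp add: c_def ij)
  ultimately show ?thesis by (rule that[rotated])
next
  case True
  let ?S = "g ` {..m}"
  have "card ?S = Suc m" using card_image[OF True] by simp
  moreover have "finite ?S \<and> card ?S \<le> card T" if "cfun.independent ?S"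
    by (rule cfun.independent_span_bound[OF T(1) that]) (use g in auto)
  ultimately have "cfun.dependent ?S" using T(2) by linarith
  then obtain u where u: "\<exists>v\<in>?S. u v \<noteq> 0" "(\<Sum>v\<in>?S. (\<lambda>x. u v * v x)) = 0"
    unfolding cfun.dependent_finite[OF finite_imageI[OF finite_atMost]] by blast
  have sum_apply: "(\<Sum>v\<in>S. (\<lambda>x. u v * v x)) a = (\<Sum>v\<in>S. u v * v a)" for S a
    by (induction S rule: infinite_finite_induct) simp_all
  have "(\<Sum>i\<le>m. u (g i) * g i a) = 0" for a
  proof -
    have "(\<Sum>i\<le>m. u (g i) * g i a) = (\<Sum>v\<in>?S. u v * v a)"
      unfolding sum.reindex[OF True] o_def ..
    also have "\<dots> = 0" unfolding sum_apply[symmetric] u(2) by simp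
    finally show ?thesis .
  qed
  thus ?thesis using u(1) by (intro that[of "\<lambda>i. u (g i)"]) auto
qed

text \<open>m linear conditions on m + 1 unknowns; \<open>G\<close> cuts each series down to a
  vector in the span of m unit vectors.\<close>

lemma coeff_dependent:
  fixes g :: "nat \<Rightarrow> complex fps"
  obtains c where "\<exists>i\<le>m. c i \<noteq> 0" "\<And>j. j < m \<Longrightarrow> (\<Sum>i\<le>m. fps_const (c i) * g i) $ j = 0"
proof -
  define T where "T = (\<lambda>j::nat. (\<lambda>l. if l = j then 1 else 0 :: complex)) ` {..<m}"
  define G where "G i l = (if l < m then g i $ l else 0)" for i l
  have GT: "G i \<in> cfun.span T" for i
  proof -
    have "G i = (\<Sum>j<m. (\<lambda>l. g i $ j * (if l = j then 1 else 0)))"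
    proof
      fix l
      have "(\<Sum>j\<in>J. (\<lambda>l. g i $ j * (if l = j then 1 else 0))) l = (\<Sum>j\<in>J. g i $ j * (if l = j then 1 else 0))" for J
        by (induction J rule: infinite_finite_induct) auto
      thus "G i l = (\<Sum>j<m. (\<lambda>l. g i $ j * (if l = j then 1 else 0))) l"
        by (simp add: G_def if_distrib cong: if_cong)
    qed
    also have "\<dots> \<in> cfun.span T"
      by (intro cfun.span_sum cfun.span_scale cfun.span_base) (auto simp: T_def)
    finally show ?thesis .
  qed
  have T: "finite T" "card T \<le> m"
    unfolding T_def using card_image_le[of "{..<m}"] by auto
  obtain c where c: "\<exists>i\<le>m. c i \<noteq> 0" "\<And>a. (\<Sum>i\<le>m. c i * G i a) = 0"
    using span_dependent[of T m G, OF T GT] by blast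
  have "(\<Sum>i\<le>m. fps_const (c i) * g i) $ j = 0" if "j < m" for j
    using c(2)[of j] that by (simp add: fps_sum_nth G_def)
  thus ?thesis using c(1) that by blast
qed

text \<open>From index m on, the factor z2^m cancels in \<open>mult_creflect_nth\<close>.\<close>

lemma creflect_mult_nth_ge:
  assumes "degle m x" "v \<in> H1" "N \<ge> m"
  shows "(v * creflect m x) $ N = ip1 v (x * fps_X ^ (N - m))"
proof -
  have N: "N = m + (N - m)" using assms(3) by simp
  have "fps_X ^ N * x = fps_X ^ m * (x * fps_X ^ (N - m))"
    by (subst N, subst power_add) (simp only: mult_ac)
  hence "(v * creflect m x) $ N = ip1 (fps_X ^ m * v) (fps_X ^ m * (x * fps_X ^ (N - m)))"
    unfolding mult_creflect_nth[OF assms(1,2)] by (simp only:)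
  thus ?thesis unfolding ip1_XX .
qed

context isometric_multiplier
begin

text \<open>Up to a constant, the coefficients of the denominator are reflections of those of the numerator,
  so \<open>w * Cop f\<close> is \<open>e1 - \<theta> * e2\<close> with polynomials \<open>e1\<close>, \<open>e2\<close> of degree less than \<open>m\<close>. Coprimality of
  \<open>x\<close> and \<open>w\<close> makes \<open>e2\<close> vanish together with \<open>e1\<close>, which leaves \<open>m\<close> parameters.\<close>

lemma rank_le_if_moebius:
  assumes t: "moebius v x w y" and deg: "degle m v" "degle m x" "degle m w" "degle m y"
    and c: "c \<noteq> 0" "creflect m x = fps_const c * w" "creflect m w = fps_const c * x"
      "creflect m v = fps_const c * y"
    and w0: "w \<noteq> 0"
    and cop: "\<And>e u. (\<forall>i\<ge>m. e $ i = 0) \<Longrightarrow> (\<forall>i\<ge>m. u $ i = 0) \<Longrightarrow> x * e = w * u \<Longrightarrow> e = 0"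
  shows "rank_le m"
  unfolding rank_le_def
proof (intro allI impI)
  fix g assume "\<forall>i\<le>m. g i \<in> K"
  hence gK: "g i \<in> K" if "i \<le> m" for i using that by blast
  define e1 where "e1 f = w * f $ 0 - x * ws f" for f
  obtain d where d: "\<exists>i\<le>m. d i \<noteq> 0"
    "\<And>j. j < m \<Longrightarrow> (\<Sum>i\<le>m. fps_const (d i) * e1 (g i)) $ j = 0"
    using coeff_dependent[of m "\<lambda>i. e1 (g i)"] by blast
  define f where "f = (\<Sum>i\<le>m. sc (d i) (g i))"
  have fK: "f \<in> K" unfolding f_def by (intro K_sum K_sc gK) simp
  have e1_sum: "e1 (\<Sum>i\<in>I. sc (d i) (g i)) = (\<Sum>i\<in>I. fps_const (d i) * e1 (g i))" if "I \<subseteq> {..m}" for I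
  proof -
    have "finite I" using that finite_subset by blast
    from this that show ?thesis
    proof (induction I rule: finite_induct)
      case (insert i I)
      have "(\<Sum>i\<in>I. sc (d i) (g i)) \<in> K" "sc (d i) (g i) \<in> K"
        using insert.prems by (auto intro!: K_sum K_sc gK)
      moreover have "g i \<in> K" using insert.prems gK by auto
      ultimately have A: "ws (sc (d i) (g i) + (\<Sum>i\<in>I. sc (d i) (g i))) =
          fps_const (d i) * ws (g i) + ws (\<Sum>i\<in>I. sc (d i) (g i))"
        by (simp only: ws_add ws_sc)
      have B: "(sc (d i) (g i) + (\<Sum>i\<in>I. sc (d i) (g i))) $ 0 =
          fps_const (d i) * g i $ 0 + (\<Sum>i\<in>I. sc (d i) (g i)) $ 0"
        by simp
      have "e1 (sc (d i) (g i) + (\<Sum>i\<in>I. sc (d i) (g i))) =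
          fps_const (d i) * e1 (g i) + e1 (\<Sum>i\<in>I. sc (d i) (g i))"
        unfolding e1_def A B by (simp only: algebra_simps)
      thus ?case using insert by simp
    qed (simp add: e1_def ws_zero)
  qed
  have f0H: "f $ 0 \<in> H1" and wH: "ws f \<in> H1" and tH: "tadj (f $ 0) \<in> H1"
    using fK by (simp_all add: H1_nth K_H2 ws_H1 tadj_H1)
  note H = moebius_H1[OF t]
  have tm: "moebius (v * fps_X ^ j) (x * fps_X ^ j) (w * fps_X ^ j) (y * fps_X ^ j)" for j
    by (rule moebius_degle[OF t degle_X])
  have cancel: "a = b" if "fps_const c * a = fps_const c * b" for a b :: "complex fps"
    using that c(1) by simp
  have coeff_w: "(fps_const c * (w * u)) $ N = ip1 u (x * fps_X ^ (N - m))" if "u \<in> H1" "N \<ge> m" for u N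
    using creflect_mult_nth_ge[OF deg(2) that] unfolding c(2) by (simp add: mult_ac)
  have coeff_x: "(fps_const c * (x * u)) $ N = ip1 u (w * fps_X ^ (N - m))" if "u \<in> H1" "N \<ge> m" for u N
    using creflect_mult_nth_ge[OF deg(3) that] unfolding c(3) by (simp add: mult_ac)
  have coeff_y: "(fps_const c * (y * u)) $ N = ip1 u (v * fps_X ^ (N - m))" if "u \<in> H1" "N \<ge> m" for u N
    using creflect_mult_nth_ge[OF deg(1) that] unfolding c(4) by (simp add: mult_ac)
  have tadj_ip: "ip1 (tadj (f $ 0)) u = ip1 (f $ 0) (\<phi> * u)" if "u \<in> H1" for u
    by (rule ip1_tadj[OF f0H that])
  have v: "v = \<phi> * w" by (rule moebius_shift(1)[OF t])
  \<comment> \<open>Coefficients below m vanish by the choice of \<open>d\<close>. From m on they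
    are, up to c, the difference of the two sides of \<open>moebius_K\<close> for z2^(N - m) times
    the fraction, because w and x are reflections of x and w.\<close>
  have e1_0: "e1 f = 0"
  proof (rule fps_ext)
    fix N
    show "e1 f $ N = 0 $ N"
    proof (cases "N < m")
      case True
      thus ?thesis using d(2) unfolding f_def by (simp add: e1_sum)
    next
      case False
      hence N: "N \<ge> m" by simp
      have "(fps_const c * e1 f) $ N = (fps_const c * (w * f $ 0)) $ N - (fps_const c * (x * ws f)) $ N"
        by (simp add: e1_def algebra_simps)
      also have "\<dots> = 0"
        unfolding coeff_w[OF f0H N] coeff_x[OF wH N] using moebius_K[OF tm fK] by simp
      finally show ?thesis using c(1) by simp
    qed
  qed
  define e2 where "e2 = w * tadj (f $ 0) - y * ws f"
  \<comment> \<open>Once e1 vanishes, e2 / w = u / x; both numerators turn out to have degree below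
    m, as \<open>cop\<close> requires.\<close>
  define u where "u = x * tadj (f $ 0) - y * f $ 0"
  have "e2 $ N = 0" if N: "N \<ge> m" for N
  proof -
    have "(fps_const c * e2) $ N = (fps_const c * (w * tadj (f $ 0))) $ N - (fps_const c * (y * ws f)) $ N"
      by (simp add: e2_def algebra_simps)
    also have "\<dots> = ip1 (f $ 0) (\<phi> * (x * fps_X ^ (N - m))) - ip1 (ws f) (v * fps_X ^ (N - m))"
      unfolding coeff_w[OF tH N] coeff_y[OF wH N] using tadj_ip[OF moebius_H1(2)[OF tm]] by simp
    also have "v * fps_X ^ (N - m) = w * fps_X ^ (N - m) * \<phi>" unfolding v by (simp only: mult_ac)
    also have "\<phi> * (x * fps_X ^ (N - m)) = x * fps_X ^ (N - m) * \<phi>" by (simp only: mult_ac)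
    also have "ip1 (f $ 0) \<dots> = ip1 (ws f) (w * fps_X ^ (N - m) * \<phi>)"
      by (rule moebius_K[OF moebius_phi[OF tm] fK])
    finally show ?thesis using c(1) by simp
  qed
  moreover have "u $ N = 0" if N: "N \<ge> m" for N
  proof -
    have "(fps_const c * u) $ N = (fps_const c * (x * tadj (f $ 0))) $ N - (fps_const c * (y * f $ 0)) $ N"
      by (simp add: u_def algebra_simps)
    also have "\<dots> = ip1 (f $ 0) (\<phi> * (w * fps_X ^ (N - m))) - ip1 (f $ 0) (v * fps_X ^ (N - m))"
      unfolding coeff_x[OF tH N] coeff_y[OF f0H N] using tadj_ip[OF moebius_H1(3)[OF tm]] by simp
    also have "\<dots> = 0" unfolding v by (simp add: mult_ac)
    finally show ?thesis using c(1) by simp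
  qed
  moreover have "x * e2 = w * u"
  proof -
    have "x * e2 - w * u = y * e1 f" unfolding e2_def u_def e1_def by (simp only: algebra_simps)
    thus ?thesis using e1_0 by simp
  qed
  ultimately have e2_0: "e2 = 0" using cop by blast
  have "iota w * Cop f = 0"
  proof -
    have psiw: "\<psi> * iota w = iota x - \<theta> * iota y" using moebius_shift(2)[OF t] by (metis add_diff_cancel_right')
    have "iota w * Cop f = iota w * iota (f $ 0) - \<theta> * (iota w * iota (tadj (f $ 0))) - (\<psi> * iota w) * iota (ws f)"
      unfolding Cop_def Bop_def Aop_def by (simp only: algebra_simps)
    also have "\<dots> = iota (e1 f) - \<theta> * iota e2"
      unfolding psiw e1_def e2_def iota_diff iota_mult by (simp only: algebra_simps)
    finally show ?thesis using e1_0 e2_0 by simp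
  qed
  hence "Cop f = 0" using w0 by simp
  thus "\<exists>c. (\<exists>i\<le>m. c i \<noteq> 0) \<and> Cop (\<Sum>i\<le>m. sc (c i) (g i)) = 0" using d(1) unfolding f_def by blast
qed

text \<open>The limiting argument yields a second fraction for the same theta, with a polynomial
  \<open>\<beta>\<close> in place of x. Cross-multiplying the two and comparing powers of z1 shows
  that they are proportional.\<close>

lemma rank_le_moebius_cross:
  assumes t: "moebius v x w y" and rank_le: "rank_le k" and psi: "\<psi> \<noteq> 0" and w0: "w \<noteq> 0"
  obtains \<beta> w' where "\<beta> \<noteq> 0" "degle k \<beta>" "w' \<in> H1" "w * \<beta> = x * w'"
proof -
  obtain \<beta> w' where \<beta>: "\<beta> \<noteq> 0" "\<And>i. i > k \<Longrightarrow> \<beta> $ i = 0" and w': "w' \<in> H1" and BA: "Bop \<beta> = Aop w'"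
    using exists_Bop_eq_Aop[OF rank_le psi] by blast
  have d\<beta>: "degle k \<beta>" using \<beta>(2) by (simp add: degle_def)
  define y' where "y' = tadj \<beta>"
  have t': "moebius (\<phi> * w') \<beta> w' y'" unfolding y'_def by (rule Bop_moebius[OF BA degle_H1[OF d\<beta>] w'])
  have v: "v = \<phi> * w" by (rule moebius_shift(1)[OF t])
  have "(iota v + fps_X * iota x) * (iota w' + fps_X * iota y') =
      (iota w + fps_X * iota y) * (iota (\<phi> * w') + fps_X * iota \<beta>)"
    unfolding moebius_eq[OF t, symmetric] moebius_eq[OF t', symmetric] by (simp only: mult_ac)
  moreover have expand: "(iota a + fps_X * iota b) * (iota a' + fps_X * iota b') =
      iota (a * a') + fps_X * (iota (a * b' + b * a') + fps_X * iota (b * b'))" for a b a' b' :: "complex fps"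
    unfolding iota_mult iota_add by (simp only: algebra_simps)
  ultimately have *: "v * y' + x * w' = w * \<beta> + y * (\<phi> * w')" "x * y' = y * \<beta>"
    unfolding expand fps2_split_eq_iff by auto
  \<comment> \<open>The determinant of the Moebius map in z1; if it vanished, theta would not depend
    on z1.\<close>
  define D where "D = v * y - x * w"
  have D0: "D \<noteq> 0"
  proof
    assume "D = 0"
    hence "w * (\<phi> * y) = w * x" unfolding D_def v by (simp add: algebra_simps)
    hence x: "x = \<phi> * y" using w0 by simp
    have "\<psi> * (iota w + fps_X * iota y) = \<psi> * iota w + \<theta> * iota y - iota \<phi> * iota y"
      by (subst (2) theta_split) (simp only: algebra_simps)
    also have "\<dots> = 0" unfolding moebius_shift(2)[OF t] x iota_mult by simp
    finally have "iota w + fps_X * iota y = 0" using psi by simp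
    hence "(iota w + fps_X * iota y) $ 0 = 0" by simp
    thus False using w0 by simp
  qed
  have "x * (v * y' + x * w') = x * (w * \<beta> + y * (\<phi> * w'))" unfolding *(1) ..
  hence "v * (x * y') + x * x * w' = x * w * \<beta> + x * y * \<phi> * w'" by (simp only: algebra_simps)
  hence 1: "v * (y * \<beta>) + x * x * w' = x * w * \<beta> + x * y * \<phi> * w'" unfolding *(2) .
  have "D * (w * \<beta>) - D * (x * w') =
      w * (v * (y * \<beta>) + x * x * w') - w * (x * w * \<beta> + x * y * \<phi> * w')"
    unfolding D_def v by (simp only: algebra_simps)
  hence "D * (w * \<beta>) = D * (x * w')" unfolding 1 by simp
  hence "w * \<beta> = x * w'" using D0 by simp
  thus ?thesis using \<beta>(1) d\<beta> w' by (intro that)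
qed

text \<open>\<open>e u\<close> is the projection of u onto the one-variable model space of phi,
  hence orthogonal to every v z2^k = phi w z2^k. As v has leading term z2^d, these relations
  determine each coefficient of index at least d from the lower ones, so m coefficients
  suffice.\<close>

lemma rank_le_if_moebius_psi_zero:
  assumes t: "moebius v 0 w 0" and psi: "\<psi> = 0" and v: "degle d v" "v $ d \<noteq> 0" "d \<le> m"
  shows "rank_le m"
  unfolding rank_le_def
proof (intro allI impI)
  have \<theta>: "\<theta> = iota \<phi>" using theta_split psi by simp
  have iso: "ip1 (\<phi> * a) (\<phi> * b) = ip1 a b" if "a \<in> H1" "b \<in> H1" for a b
    using mult_ip[of "iota a" "iota b"] that unfolding ip1_def iota_mult \<theta>[symmetric] H1_iota by blast
  have v': "v = \<phi> * w" by (rule moebius_shift(1)[OF t])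
  fix g assume "\<forall>i\<le>m. g i \<in> K"
  hence gK: "g i \<in> K" if "i \<le> m" for i using that by blast
  define e where "e u = u - \<phi> * tadj u" for u
  obtain c where c: "\<exists>i\<le>m. c i \<noteq> 0"
    "\<And>j. j < m \<Longrightarrow> (\<Sum>i\<le>m. fps_const (c i) * e (g i $ 0)) $ j = 0"
    using coeff_dependent[of m "\<lambda>i. e (g i $ 0)"] by blast
  define f where "f = (\<Sum>i\<le>m. sc (c i) (g i))"
  have fK: "f \<in> K" unfolding f_def by (intro K_sum K_sc gK) simp
  have f0H: "f $ 0 \<in> H1" using fK by (simp add: H1_nth K_H2)
  have Be: "Bop u = iota (e u)" for u unfolding Bop_def e_def iota_diff iota_mult \<theta>[symmetric] ..
  have f0: "f $ 0 = (\<Sum>i\<le>m. fps_const (c i) * g i $ 0)" unfolding f_def by (simp add: fps_sum_nth)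
  have "iota (e (f $ 0)) = (\<Sum>i\<le>m. sc (c i) (iota (e (g i $ 0))))"
    unfolding Be[symmetric] f0 by (rule Bop_sum) (simp add: H1_nth K_H2 gK)
  also have "\<dots> = iota (\<Sum>i\<le>m. fps_const (c i) * e (g i $ 0))" unfolding iota_sum iota_sc ..
  finally have low: "e (f $ 0) $ j = 0" if "j < m" for j using c(2)[OF that] by simp
  have eH: "e (f $ 0) \<in> H1" unfolding e_def by (intro H1_diff f0H phi_H1 tadj_H1)
  have wH: "w * fps_X ^ k \<in> H1" for k
    using moebius_H1(3)[OF t] by (simp add: mult.commute[of w] H1_Xpow)
  have perp: "ip1 (e (f $ 0)) (v * fps_X ^ k) = 0" for k
  proof -
    have "v * fps_X ^ k = \<phi> * (w * fps_X ^ k)" unfolding v' by (simp only: mult_ac)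
    hence "ip1 (e (f $ 0)) (v * fps_X ^ k) = ip1 (f $ 0 - \<phi> * tadj (f $ 0)) (\<phi> * (w * fps_X ^ k))"
      unfolding e_def by (simp only:)
    also have "\<dots> = ip1 (f $ 0) (\<phi> * (w * fps_X ^ k)) - ip1 (\<phi> * tadj (f $ 0)) (\<phi> * (w * fps_X ^ k))"
      by (rule ip1_diff_left) (intro f0H phi_H1 tadj_H1 wH)+
    also have "\<dots> = 0" by (simp add: iso tadj_H1 f0H wH ip1_tadj)
    finally show ?thesis .
  qed
  have "e (f $ 0) $ i = 0" for i
  proof (induction i rule: less_induct)
    case (less i)
    show ?case
    proof (cases "i < m")
      case True thus ?thesis by (rule low)
    next
      case False
      hence i: "i = d + (i - d)" "i \<ge> d" using v(3) by auto
      have dv: "degle i (v * fps_X ^ (i - d))"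
        using degle_mult[OF v(1) degle_X[of "i - d"]] i(1) by simp
      have "0 = (\<Sum>j\<le>i. e (f $ 0) $ j * cnj ((v * fps_X ^ (i - d)) $ j))"
        using ip1_finite[OF dv eH] perp by simp
      also have "\<dots> = (\<Sum>j\<in>{i}. e (f $ 0) $ j * cnj ((v * fps_X ^ (i - d)) $ j))"
        by (rule sum.mono_neutral_right) (use less in auto)
      also have "\<dots> = e (f $ 0) $ i * cnj (v $ d)" using i(2) by (simp add: fps_X_power_mult_right_nth)
      finally show ?thesis using v(2) by simp
    qed
  qed
  hence "e (f $ 0) = 0" by (intro fps_ext) simp
  hence "Cop f = 0" by (simp add: Cop_def Be Aop_def psi)
  thus "\<exists>c. (\<exists>i\<le>m. c i \<noteq> 0) \<and> Cop (\<Sum>i\<le>m. sc (c i) (g i)) = 0" using c(1) unfolding f_def by blast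
qed

end

declare One_nat_def [simp]

section \<open>Bivariate polynomials of degree at most one in z1\<close>

definition lift :: "complex poly \<Rightarrow> complex poly poly" where
  "lift v = map_poly (\<lambda>c. [:c:]) v"

text \<open>v + z1 x: the inner variable of \<open>complex poly poly\<close> is z1, so
  \<open>[:[:0, 1:]:]\<close> is z1, and \<open>lift\<close> embeds the polynomials in z2.\<close>

definition comb :: "complex poly \<Rightarrow> complex poly \<Rightarrow> complex poly poly" where
  "comb v x = lift v + [:[:0, 1:]:] * lift x"

lemma coeff_lift: "coeff (lift v) i = [:coeff v i:]"
  by (simp add: lift_def coeff_map_poly)

lemma lift_add: "lift (v + w) = lift v + lift w"
  by (rule poly_eqI) (simp add: coeff_lift)

lemma lift_mult: "lift (v * w) = lift v * lift w"
  
proof (rule poly_eqI)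
  fix n
  have "[:a:] * [:b:] = [:a * b:]" for a b :: complex by simp
  thus "coeff (lift (v * w)) n = coeff (lift v * lift w) n"
    unfolding coeff_lift coeff_mult sum_to_poly[symmetric] by (simp only:)
qed

lemma coeff_comb: "coeff (comb v x) i = [:coeff v i, coeff x i:]"
  by (simp add: comb_def coeff_lift)

lemma comb_eq_iff: "comb v x = comb w y \<longleftrightarrow> v = w \<and> x = y"
  by (auto simp: poly_eq_iff[of "comb v x"] coeff_comb poly_eq_iff[of v] poly_eq_iff[of x])

lemma comb_zero: "comb 0 0 = 0"
  by (rule poly_eqI) (simp add: coeff_comb)

lemma comb_eq_0_iff: "comb v x = 0 \<longleftrightarrow> v = 0 \<and> x = 0"
  using comb_eq_iff[of v x 0 0] by (simp add: comb_zero)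

lemma lift_mult_comb: "lift h * comb v x = comb (h * v) (h * x)"
  by (simp add: comb_def lift_mult algebra_simps)

lemma comb_mult: "comb a b * comb a' b' =
    lift (a * a') + [:[:0, 1:]:] * lift (a * b' + b * a') + [:[:0, 1:]:] * [:[:0, 1:]:] * lift (b * b')"
  unfolding comb_def lift_mult lift_add by (simp only: algebra_simps)

lemma degree_le_iff: "degree p \<le> m \<longleftrightarrow> (\<forall>i>m. coeff p i = 0)"
  using degree_le coeff_eq_0 by (metis le_less_trans)

lemma degree_comb_le: "degree (comb v x) \<le> m \<longleftrightarrow> degree v \<le> m \<and> degree x \<le> m"
  by (auto simp: degree_le_iff coeff_comb)

lemma degree_z1_le_iff: "degree_z1 p \<le> d \<longleftrightarrow> (\<forall>i. degree (coeff p i) \<le> d)"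
proof -
  have "degree (coeff p i) \<le> d" if "\<forall>i\<le>degree p. degree (coeff p i) \<le> d" for i
    using that by (cases "i \<le> degree p") (auto simp: coeff_eq_0)
  thus ?thesis by (auto simp: degree_z1_def)
qed

lemma degree_coeff_le_z1: "degree (coeff p i) \<le> degree_z1 p"
  using degree_z1_le_iff[of p "degree_z1 p"] by simp

lemma degree_z1_lift: "degree_z1 p = 0 \<longleftrightarrow> (\<exists>h. p = lift h)"
proof
  assume "degree_z1 p = 0"
  hence *: "degree (coeff p i) = 0" for i using degree_z1_le_iff[of p 0] by simp
  have "p = lift (map_poly (\<lambda>c. coeff c 0) p)"
  proof (rule poly_eqI)
    fix i
    obtain a where "coeff p i = [:a:]" using *[of i] by (rule degree_eq_zeroE)
    hence "coeff p i = [:coeff (coeff p i) 0:]" by simp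
    thus "coeff p i = coeff (lift (map_poly (\<lambda>c. coeff c 0) p)) i"
      by (simp add: coeff_lift coeff_map_poly)
  qed
  thus "\<exists>h. p = lift h" ..
next
  assume "\<exists>h. p = lift h"
  thus "degree_z1 p = 0" using degree_z1_le_iff[of p 0] by (auto simp: coeff_lift)
qed

lemma degree_z1_comb: "degree_z1 (comb v x) = (if x = 0 then 0 else 1)"
proof (cases "x = 0")
  case True
  thus ?thesis using degree_z1_le_iff[of "comb v x" 0] by (simp add: coeff_comb)
next
  case False
  hence "coeff x (degree x) \<noteq> 0" by simp
  then obtain i where "coeff x i \<noteq> 0" ..
  hence "degree (coeff (comb v x) i) = 1" by (simp add: coeff_comb)
  moreover have "degree (coeff (comb v x) i) \<le> degree_z1 (comb v x)" by (rule degree_coeff_le_z1)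
  ultimately have "1 \<le> degree_z1 (comb v x)" by simp
  moreover have "degree_z1 (comb v x) \<le> 1"
    unfolding degree_z1_le_iff by (simp add: coeff_comb)
  ultimately show ?thesis using False by simp
qed

lemma comb_exists:
  assumes "degree_z1 p \<le> 1"
  obtains v x where "p = comb v x"
proof
  show "p = comb (map_poly (\<lambda>c. coeff c 0) p) (map_poly (\<lambda>c. coeff c 1) p)"
  proof (rule poly_eqI, rule poly_eqI)
    fix i j
    have "degree (coeff p i) \<le> 1" using assms by (simp add: degree_z1_le_iff)
    hence "coeff (coeff p i) (Suc (Suc l)) = 0" for l by (intro coeff_eq_0) simp
    thus "coeff (coeff p i) j = coeff (coeff (comb (map_poly (\<lambda>c. coeff c 0) p) (map_poly (\<lambda>c. coeff c 1) p)) i) j"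
      by (auto simp: coeff_comb coeff_map_poly coeff_pCons One_nat_def split: nat.split)
  qed
qed

lemma coeff_poly_const: "coeff (poly p [:c:]) d = poly (map_poly (\<lambda>a. coeff a d) p) c" for p :: "complex poly poly"
  by (induction p) (simp_all add: map_poly_pCons)

text \<open>As a polynomial in z1, p has a leading coefficient r(z2); setting z2 = c preserves the
  degree unless c is a zero of r.\<close>

lemma degree_z1_eval:
  assumes "p \<noteq> 0"
  shows "\<exists>r. r \<noteq> 0 \<and> (\<forall>c. poly r c \<noteq> 0 \<longrightarrow> degree (poly p [:c:]) = degree_z1 p \<and> poly p [:c:] \<noteq> 0)"
proof -
  let ?d = "degree_z1 p"
  define r where "r = map_poly (\<lambda>a. coeff a ?d) p"
  have "degree_z1 p \<in> (\<lambda>i. degree (coeff p i)) ` {..degree p}"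
    unfolding degree_z1_def by (rule Max_in) auto
  then obtain i where i: "?d = degree (coeff p i)" by blast
  have "r \<noteq> 0"
  \<comment> \<open>A coefficient of degree 0 may itself be 0, so in this case the leading
    coefficient in z2 serves as witness instead.\<close>
  proof (cases "?d = 0")
    case True
    have "degree (coeff p (degree p)) \<le> ?d" using degree_z1_le_iff[of p ?d] by simp
    hence d0: "degree (lead_coeff p) = 0" using True by simp
    have "coeff (lead_coeff p) (degree (lead_coeff p)) \<noteq> 0" using assms by simp
    hence "coeff (lead_coeff p) 0 \<noteq> 0" unfolding d0 .
    hence "coeff r (degree p) \<noteq> 0" using True by (simp add: r_def coeff_map_poly)
    thus ?thesis by auto
  next
    case False
    hence "coeff p i \<noteq> 0" using i by auto
    hence "coeff r i \<noteq> 0" by (simp add: r_def coeff_map_poly i)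
    thus ?thesis by auto
  qed
  moreover have "degree (poly p [:c:]) = ?d" "poly p [:c:] \<noteq> 0" if "poly r c \<noteq> 0" for c
  proof -
    have ne: "coeff (poly p [:c:]) ?d \<noteq> 0" using that by (simp add: coeff_poly_const r_def)
    thus "poly p [:c:] \<noteq> 0" by auto
    have "map_poly (\<lambda>a. coeff a j) p = 0" if "j > ?d" for j
    proof (rule poly_eqI)
      fix l
      have "degree (coeff p l) \<le> ?d" using degree_z1_le_iff[of p ?d] by simp
      thus "coeff (map_poly (\<lambda>a. coeff a j) p) l = coeff 0 l"
        using that by (simp add: coeff_map_poly coeff_eq_0)
    qed
    hence "degree (poly p [:c:]) \<le> ?d" by (intro degree_le) (simp add: coeff_poly_const)
    moreover have "?d \<le> degree (poly p [:c:])" by (rule le_degree[OF ne])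
    ultimately show "degree (poly p [:c:]) = ?d" by simp
  qed
  ultimately show ?thesis by blast
qed

text \<open>For all but finitely many c, setting z2 = c preserves the z1-degrees of both factors and
  of the product, which leaves a statement in one variable.\<close>

lemma degree_z1_mult:
  assumes "p \<noteq> 0" "q \<noteq> 0"
  shows "degree_z1 (p * q) = degree_z1 p + degree_z1 q"
proof -
  have pq: "p * q \<noteq> 0" using assms by simp
  from degree_z1_eval[OF assms(1)] obtain r1 where r1: "r1 \<noteq> 0"
    "\<forall>c. poly r1 c \<noteq> 0 \<longrightarrow> degree (poly p [:c:]) = degree_z1 p \<and> poly p [:c:] \<noteq> 0" by (elim exE conjE)
  from degree_z1_eval[OF assms(2)] obtain r2 where r2: "r2 \<noteq> 0"
    "\<forall>c. poly r2 c \<noteq> 0 \<longrightarrow> degree (poly q [:c:]) = degree_z1 q \<and> poly q [:c:] \<noteq> 0" by (elim exE conjE)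
  from degree_z1_eval[OF pq] obtain r3 where r3: "r3 \<noteq> 0"
    "\<forall>c. poly r3 c \<noteq> 0 \<longrightarrow> degree (poly (p * q) [:c:]) = degree_z1 (p * q) \<and> poly (p * q) [:c:] \<noteq> 0" by (elim exE conjE)
  have "r1 * r2 * r3 \<noteq> 0" using r1(1) r2(1) r3(1) by (intro no_zero_divisors)
  hence fin: "finite {c. poly (r1 * r2 * r3) c = 0}" by (rule poly_roots_finite)
  have "{c. poly (r1 * r2 * r3) c = 0} \<noteq> UNIV"
  proof
    assume "{c. poly (r1 * r2 * r3) c = 0} = UNIV"
    with fin have "finite (UNIV :: complex set)" by (simp only:)
    thus False using infinite_UNIV_char_0 by blast
  qed
  then obtain c where "poly (r1 * r2 * r3) c \<noteq> 0" by blast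
  hence c: "poly r1 c \<noteq> 0" "poly r2 c \<noteq> 0" "poly r3 c \<noteq> 0" by auto
  note d1 = r1(2)[rule_format, OF c(1)] and d2 = r2(2)[rule_format, OF c(2)] and d3 = r3(2)[rule_format, OF c(3)]
  have "degree_z1 (p * q) = degree (poly p [:c:] * poly q [:c:])" using d3 by simp
  also have "\<dots> = degree (poly p [:c:]) + degree (poly q [:c:])"
    using d1 d2 by (intro degree_mult_eq) auto
  finally show ?thesis using d1 d2 by simp
qed

lemma lift_eq_0_iff: "lift v = 0 \<longleftrightarrow> v = 0"
  using comb_eq_0_iff[of v 0] by (simp add: comb_def lift_def)

text \<open>By \<open>eq\<close> the fraction equals x / y, so by coprimality its denominator
  divides y, which is free of z1. Degrees in z1 add, so a nonzero y could not occur in the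
  denominator.\<close>

lemma coprime_comb_proportional:
  assumes cop: "coprime (comb v x) (comb w y)" and eq: "y * v = x * w"
  shows "y = 0"
proof (rule ccontr)
  assume y: "y \<noteq> 0"
  have "comb v x * lift y = comb w y * lift x"
    unfolding mult.commute[of "comb v x"] mult.commute[of "comb w y"] lift_mult_comb eq
    by (simp only: mult.commute)
  hence "comb w y dvd comb v x * lift y" by (simp only: dvd_triv_left)
  moreover have "coprime (comb w y) (comb v x)" using cop by (simp only: coprime_commute)
  ultimately have "comb w y dvd lift y" by (rule iffD1[OF coprime_dvd_mult_right_iff, rotated])
  then obtain h where h: "lift y = comb w y * h" by (elim dvdE)
  have ly: "lift y \<noteq> 0" using y by (simp add: lift_eq_0_iff)
  hence "h \<noteq> 0" "comb w y \<noteq> 0" using h by auto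
  hence "degree_z1 (lift y) = degree_z1 (comb w y) + degree_z1 h" unfolding h by (intro degree_z1_mult)
  moreover have "degree_z1 (lift y) = 0" using degree_z1_lift by blast
  ultimately show False using y by (simp add: degree_z1_comb)
qed

text \<open>Otherwise z2 - a divides both polynomials.\<close>

lemma coprime_comb_no_common_root:
  assumes cop: "coprime (comb v x) (comb w y)" and "poly v a = 0" "poly x a = 0" "poly w a = 0" "poly y a = 0"
  shows False
proof -
  let ?l = "[:- a, 1:]"
  have dvd: "lift ?l dvd comb p q" if pq: "poly p a = 0" "poly q a = 0" for p q
  proof -
    obtain p' where "p = ?l * p'" using pq(1) unfolding poly_eq_0_iff_dvd by (elim dvdE)
    moreover obtain q' where "q = ?l * q'" using pq(2) unfolding poly_eq_0_iff_dvd by (elim dvdE)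
    ultimately have "comb p q = lift ?l * comb p' q'" by (simp only: lift_mult_comb)
    thus ?thesis by (rule dvdI)
  qed
  have "is_unit (lift ?l)"
    using cop dvd[OF assms(2,3)] dvd[OF assms(4,5)] by (rule coprime_common_divisor)
  hence "degree (lift ?l) = 0" by (auto simp: is_unit_poly_iff)
  hence "coeff (lift ?l) 1 = 0" by (intro coeff_eq_0) simp
  thus False by (simp add: coeff_lift)
qed

section \<open>Reflection of fractions in the torus\<close>

definition preflect :: "nat \<Rightarrow> complex poly \<Rightarrow> complex poly" where
  "preflect m x = (\<Sum>i\<le>m. monom (cnj (coeff x (m - i))) i)"

lemma coeff_preflect: "coeff (preflect m x) i = (if i \<le> m then cnj (coeff x (m - i)) else 0)"
  by (simp add: preflect_def coeff_sum if_distrib cong: if_cong)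

lemma degree_preflect: "degree (preflect m x) \<le> m"
  by (simp add: degree_le_iff coeff_preflect)

lemma preflect_eq_0: "degree x \<le> m \<Longrightarrow> preflect m x = 0 \<Longrightarrow> x = 0"
proof (rule poly_eqI)
  fix i assume *: "degree x \<le> m" "preflect m x = 0"
  show "coeff x i = coeff 0 i"
  proof (cases "i \<le> m")
    case True
    have "coeff (preflect m x) (m - i) = 0" using * by simp
    thus ?thesis using True by (simp add: coeff_preflect)
  next
    case False
    thus ?thesis using * by (simp add: coeff_eq_0)
  qed
qed

lemma poly_preflect:
  assumes "degree x \<le> m" "a \<noteq> 0"
  shows "poly (preflect m x) a = a ^ m * cnj (poly x (1 / cnj a))"
proof -
  have "poly (preflect m x) a = (\<Sum>i\<le>m. cnj (coeff x (m - i)) * a ^ i)"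
    by (simp add: preflect_def poly_sum poly_monom)
  also have "\<dots> = (\<Sum>i\<le>m. cnj (coeff x i) * a ^ (m - i))"
    by (rule sum.reindex_bij_witness[of _ "\<lambda>i. m - i" "\<lambda>i. m - i"]) auto
  also have "\<dots> = (\<Sum>i\<le>m. a ^ m * (cnj (coeff x i) * (1 / a) ^ i))"
  proof (rule sum.cong)
    fix i assume "i \<in> {..m}"
    hence "a ^ (m - i) = a ^ m * (1 / a) ^ i"
      using assms(2) by (simp add: power_diff power_one_over field_simps)
    thus "cnj (coeff x i) * a ^ (m - i) = a ^ m * (cnj (coeff x i) * (1 / a) ^ i)" by simp
  qed simp
  also have "\<dots> = a ^ m * cnj (\<Sum>i\<le>m. coeff x i * (1 / cnj a) ^ i)"
    by (simp add: sum_distrib_left)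
  also have "(\<Sum>i\<le>m. coeff x i * (1 / cnj a) ^ i) = poly x (1 / cnj a)"
    unfolding poly_altdef using assms(1)
    by (intro sum.mono_neutral_right) (auto simp: coeff_eq_0)
  finally show ?thesis .
qed

text \<open>The relations say P P' = Q Q', where P' and Q' are z1 z2^m times the conjugates of P and
  Q on the torus. By coprimality P' = Q h and Q' = P h, and degrees force h to be constant. If x and
  y both vanished, h could be a multiple of z1.\<close>

lemma reflection_unique:
  fixes v x w y :: "complex poly"
  assumes cop: "coprime (comb v x) (comb w y)"
    and deg: "degree v \<le> m" "degree x \<le> m" "degree w \<le> m" "degree y \<le> m"
    and top: "\<not> (m > 0 \<and> degree v < m \<and> degree x < m \<and> degree w < m \<and> degree y < m)"
    and w0: "w \<noteq> 0" and z1: "x \<noteq> 0 \<or> y \<noteq> 0"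
    and rel: "v * preflect m x = w * preflect m y" "x * preflect m v = y * preflect m w"
      "v * preflect m v + x * preflect m x = w * preflect m w + y * preflect m y"
  obtains c where "c \<noteq> 0" "preflect m x = smult c w" "preflect m v = smult c y"
    "preflect m y = smult c v" "preflect m w = smult c x"
proof -
  let ?P = "comb v x" and ?Q = "comb w y"
  let ?P' = "comb (preflect m x) (preflect m v)" and ?Q' = "comb (preflect m y) (preflect m w)"
  have PQ: "?P * ?P' = ?Q * ?Q'"
    unfolding comb_mult rel ..
  have Q0: "?Q \<noteq> 0" and Q'0: "?Q' \<noteq> 0"
    using w0 preflect_eq_0[OF deg(3)] by (auto simp: comb_eq_0_iff)
  have "?Q dvd ?P * ?P'" unfolding PQ by simp
  moreover have "coprime ?Q ?P" using cop by (simp only: coprime_commute)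
  ultimately have "?Q dvd ?P'" by (rule iffD1[OF coprime_dvd_mult_right_iff, rotated])
  then obtain h where h: "?P' = ?Q * h" by (elim dvdE)
  have "?Q * (?P * h) = ?Q * ?Q'" using PQ unfolding h by (simp only: mult_ac)
  hence h': "?Q' = ?P * h" using Q0 by simp
  have h0: "h \<noteq> 0" using h' Q'0 by auto
  have P0: "?P \<noteq> 0" using h' Q'0 by auto
  \<comment> \<open>If y is nonzero, Q already has z1-degree 1, the most that P' can have; if x is
    nonzero, the same holds for P and Q'.\<close>
  have "degree_z1 h = 0"
  proof (cases "y = 0")
    case False
    hence "degree_z1 ?P' = 1 + degree_z1 h" unfolding h degree_z1_mult[OF Q0 h0] by (simp add: degree_z1_comb)
    thus ?thesis by (simp add: degree_z1_comb split: if_splits)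
  next
    case True
    hence "x \<noteq> 0" using z1 by simp
    hence "degree_z1 ?Q' = 1 + degree_z1 h" unfolding h' degree_z1_mult[OF P0 h0] by (simp add: degree_z1_comb)
    thus ?thesis by (simp add: degree_z1_comb split: if_splits)
  qed
  then obtain h1 where h1: "h = lift h1" unfolding degree_z1_lift by (elim exE)
  have h10: "h1 \<noteq> 0" using h0 h1 by (auto simp: lift_def)
  have "comb (preflect m x) (preflect m v) = comb (h1 * w) (h1 * y)"
    using h unfolding h1 lift_mult_comb[symmetric] by (simp only: mult.commute)
  moreover have "comb (preflect m y) (preflect m w) = comb (h1 * v) (h1 * x)"
    using h' unfolding h1 lift_mult_comb[symmetric] by (simp only: mult.commute)
  ultimately have eqs: "preflect m x = h1 * w" "preflect m v = h1 * y" "preflect m y = h1 * v" "preflect m w = h1 * x"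
    by (simp_all add: comb_eq_iff)
  have bound: "degree h1 + degree u \<le> m" if "h1 * u = preflect m u'" "u \<noteq> 0" for u u'
    using degree_mult_eq[OF h10 that(2)] degree_preflect[of m u'] that(1) by simp
  \<comment> \<open>Some entry has degree m already, and its product with h1 is a reflected entry,
    of degree at most m.\<close>
  have "degree h1 = 0"
  proof (cases "m = 0")
    case True
    thus ?thesis using bound[OF eqs(1)[symmetric] w0] by simp
  next
    case False
    then consider "degree v = m" | "degree x = m" | "degree w = m" | "degree y = m"
      using top deg by linarith
    thus ?thesis
    proof cases
      case 1
      hence "v \<noteq> 0" using False by auto
      from bound[OF eqs(3)[symmetric] this] 1 show ?thesis by simp
    next
      case 2
      hence "x \<noteq> 0" using False by auto
      from bound[OF eqs(4)[symmetric] this] 2 show ?thesis by simp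
    next
      case 3
      from bound[OF eqs(1)[symmetric] w0] 3 show ?thesis by simp
    next
      case 4
      hence "y \<noteq> 0" using False by auto
      from bound[OF eqs(2)[symmetric] this] 4 show ?thesis by simp
    qed
  qed
  then obtain c where c: "h1 = [:c:]" by (rule degree_eq_zeroE)
  hence "c \<noteq> 0" using h10 by auto
  thus ?thesis
    by (rule that[of c]) (simp_all add: eqs c)
qed

lemma coprimeI_no_common_root:
  fixes x w :: "complex poly"
  assumes "x \<noteq> 0" "\<And>a. poly x a = 0 \<Longrightarrow> poly w a = 0 \<Longrightarrow> False"
  shows "coprime x w"
proof (rule coprimeI)
  fix d assume d: "d dvd x" "d dvd w"
  have "d \<noteq> 0" using d(1) assms(1) by auto
  have "degree d = 0"
  proof (rule ccontr)
    assume "degree d \<noteq> 0"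
    hence "\<not> constant (poly d)" by (simp add: constant_degree)
    then obtain a where "poly d a = 0" using fundamental_theorem_of_algebra by blast
    thus False using assms(2)[of a] d by (meson poly_eq_0_iff_dvd dvd_trans)
  qed
  thus "is_unit d" using \<open>d \<noteq> 0\<close> by (simp add: is_unit_iff_degree)
qed

text \<open>The reflected coefficients have their zeros on opposite sides of the circle, because the
  denominator has none in the bidisk.\<close>

lemma roots_of_reflected:
  fixes v x w y :: "complex poly"
  assumes cop: "coprime (comb v x) (comb w y)"
    and nz: "\<And>z1 z2. cmod z1 < 1 \<Longrightarrow> cmod z2 < 1 \<Longrightarrow> poly w z2 + z1 * poly y z2 \<noteq> 0"
    and deg: "degree v \<le> m" "degree w \<le> m"
    and c: "c \<noteq> 0" "preflect m v = smult c y" "preflect m w = smult c x"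
  shows "degree x = m" "x \<noteq> 0" "coprime x w" "\<And>a. poly x a = 0 \<Longrightarrow> cmod a < 1"
    "\<And>a. cmod a < 1 \<Longrightarrow> poly w a \<noteq> 0"
proof -
  show w: "poly w a \<noteq> 0" if "cmod a < 1" for a using nz[of 0 a] that by simp
  have "poly w 0 \<noteq> 0" by (rule w) simp
  hence "coeff w 0 \<noteq> 0" by (simp add: poly_0_coeff_0)
  hence "coeff (preflect m w) m \<noteq> 0" by (simp add: coeff_preflect)
  hence xm: "coeff x m \<noteq> 0" using c by simp
  hence "m \<le> degree x" by (rule le_degree)
  moreover have "degree x \<le> m" using degree_preflect[of m w] c by simp
  ultimately show "degree x = m" by simp
  show x0: "x \<noteq> 0" using xm by auto
  \<comment> \<open>Where |y| exceeds |w| inside the disk, z1 = -w / y would be a zero of the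
    denominator in the bidisk; the closed disk follows by radial limits.\<close>
  have le: "cmod (poly y a) \<le> cmod (poly w a)" if "cmod a \<le> 1" for a
  proof -
    have 1: "cmod (poly y a) \<le> cmod (poly w a)" if "cmod a < 1" for a
    proof (rule ccontr)
      assume "\<not> ?thesis"
      hence *: "cmod (poly w a) < cmod (poly y a)" by simp
      hence "poly y a \<noteq> 0" by auto
      moreover have "cmod (- poly w a / poly y a) < 1" using * by (simp add: norm_divide divide_less_eq)
      ultimately show False using nz[of "- poly w a / poly y a" a] that by simp
    qed
    have "(\<lambda>n. 1 - inverse (real (Suc n))) \<longlonglongrightarrow> 1 - 0"
      by (intro tendsto_intros LIMSEQ_inverse_real_of_nat)
    hence t: "(\<lambda>n. of_real (1 - inverse (real (Suc n))) * a) \<longlonglongrightarrow> of_real 1 * a"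
      by (intro tendsto_intros) simp
    have t': "(\<lambda>n. cmod (poly p (of_real (1 - inverse (real (Suc n))) * a))) \<longlonglongrightarrow> cmod (poly p a)" for p
      using tendsto_norm[OF isCont_tendsto_compose[OF _ t, of "poly p"]] by simp
    have "cmod (of_real (1 - inverse (real (Suc n))) * a) < 1" for n
    proof -
      have "0 \<le> 1 - inverse (real (Suc n))" "1 - inverse (real (Suc n)) < 1" by (simp_all add: field_simps)
      hence "cmod (of_real (1 - inverse (real (Suc n))) * a) \<le> (1 - inverse (real (Suc n))) * 1"
        unfolding norm_mult norm_of_real using that by (intro mult_mono) auto
      also have "\<dots> < 1" by simp
      finally show ?thesis .
    qed
    from 1[OF this] show ?thesis by (intro LIMSEQ_le[OF t' t']) blast
  qed
  \<comment> \<open>Reflection takes a nonzero root a of x to the root 1 / conj(a) of w, which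
    cannot lie in the open disk.\<close>
  have inv: "cmod a \<le> 1" "cmod a = 1 \<Longrightarrow> poly w a = 0" if "poly x a = 0" for a
  proof -
    have 0: "poly (preflect m w) a = 0" using that c by simp
    have "poly w (1 / cnj a) = 0" if "a \<noteq> 0" using poly_preflect[OF deg(2) that] 0 that by simp
    hence 1: "1 \<le> cmod (1 / cnj a)" if "a \<noteq> 0" using w[of "1 / cnj a"] that by force
    show "cmod a \<le> 1" using 1 by (cases "a = 0") (auto simp: norm_divide field_simps)
    assume a: "cmod a = 1"
    hence "a * cnj a = 1" by (simp add: complex_norm_square[symmetric])
    moreover have "a \<noteq> 0" using a by auto
    ultimately have "1 / cnj a = a" by (simp add: divide_eq_eq)
    with \<open>a \<noteq> 0\<close> show "poly w a = 0" using \<open>a \<noteq> 0 \<Longrightarrow> poly w (1 / cnj a) = 0\<close> by simp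
  qed
  \<comment> \<open>Such an a lies on the circle. There \<open>le\<close> makes it a root of y and
    reflection a root of v, so all four polynomials would share it.\<close>
  have no_common: False if a: "poly x a = 0" "poly w a = 0" for a
  proof -
    have "cmod a = 1" using inv(1)[OF a(1)] w[of a] a(2) by force
    have ya: "poly y a = 0" using le[of a] a \<open>cmod a = 1\<close> by simp
    have "a \<noteq> 0" using \<open>cmod a = 1\<close> by auto
    have "a * cnj a = 1" using \<open>cmod a = 1\<close> by (simp add: complex_norm_square[symmetric])
    hence "1 / cnj a = a" using \<open>a \<noteq> 0\<close> by (simp add: divide_eq_eq)
    moreover have "poly (preflect m v) a = 0" using c ya by simp
    ultimately have va: "poly v a = 0" using poly_preflect[OF deg(1) \<open>a \<noteq> 0\<close>] \<open>a \<noteq> 0\<close> by simp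
    show False by (rule coprime_comb_no_common_root[OF cop va a ya])
  qed
  show "coprime x w" by (rule coprimeI_no_common_root[OF x0 no_common])
  show "cmod a < 1" if "poly x a = 0" for a
    using inv[OF that] no_common[OF that] by force
qed

section \<open>From power series back to polynomials\<close>

lemma degle_fps_of_poly: "degle m (fps_of_poly v) \<longleftrightarrow> degree v \<le> m"
  by (simp add: degle_def degree_le_iff)

lemma degle_poly_exists:
  assumes "degle m f"
  obtains p where "fps_of_poly p = f" "degree p \<le> m"
proof
  let ?p = "\<Sum>i\<le>m. monom (f $ i) i"
  have "coeff ?p i = f $ i" for i
    using assms by (simp add: coeff_sum degle_def if_distrib cong: if_cong)
  thus "fps_of_poly ?p = f" by (intro fps_ext) simp
  thus "degree ?p \<le> m" using assms degle_fps_of_poly[of m ?p] by simp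
qed

lemma creflect_fps_of_poly: "creflect m (fps_of_poly x) = fps_of_poly (preflect m x)"
  by (rule fps_ext) (simp add: creflect_def coeff_preflect)

lemma fps_of_poly_smult': "fps_of_poly (smult c p) = fps_const c * fps_of_poly p"
  by (rule fps_ext) simp

lemma fps_of_poly_eq_iff': "fps_of_poly p = fps_of_poly q \<longleftrightarrow> p = q"
  by (simp add: fps_eq_iff poly_eq_iff)

lemma H1_coeff_bounded:
  assumes "u \<in> H1"
  obtains B where "\<And>k. cmod (u $ k) \<le> B"
proof
  fix k
  have "(cmod (cf (iota u) (0, k)))\<^sup>2 \<le> nsq (iota u)"
    using assms unfolding nsq_def H1_def H2_def by (intro coord_le_lsq) simp
  thus "cmod (u $ k) \<le> sqrt (nsq (iota u))" by (simp add: cf_def real_le_rsqrt)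
qed

text \<open>The partial sums of q at a telescope to -a^(N + 1) \<open>g $ N\<close>, which tends to
  0 because |a| < 1 and the coefficients of g are bounded.\<close>

lemma poly_root_if_linear_factor:
  assumes a: "cmod a < 1" and g: "g \<in> H1" and q: "fps_of_poly q = fps_of_poly [:- a, 1:] * g"
  shows "poly q a = 0"
proof -
  obtain B where B: "\<And>k. cmod (g $ k) \<le> B" using H1_coeff_bounded[OF g] by blast
  have l: "fps_of_poly [:- a, 1:] = fps_X - fps_const a"
    by (rule fps_ext) (auto simp: coeff_pCons fps_X_def split: nat.split)
  have tele: "(\<Sum>i\<le>N. coeff q i * a ^ i) = - (a ^ Suc N * g $ N)" for N
  proof (induction N)
    case 0
    have "coeff q 0 = - a * g $ 0" using arg_cong[OF q, of "\<lambda>f. f $ 0"] unfolding l by simp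
    thus ?case by simp
  next
    case (Suc N)
    have "coeff q (Suc N) = g $ N - a * g $ Suc N"
      using arg_cong[OF q, of "\<lambda>f. f $ Suc N"] unfolding l by (simp add: left_diff_distrib)
    hence "coeff q (Suc N) * a ^ Suc N = (g $ N - a * g $ Suc N) * a ^ Suc N" by (simp only:)
    also have "\<dots> = a ^ Suc N * g $ N - a ^ Suc (Suc N) * g $ Suc N"
      by (simp add: algebra_simps)
    finally have "coeff q (Suc N) * a ^ Suc N = a ^ Suc N * g $ N - a ^ Suc (Suc N) * g $ Suc N" .
    thus ?case using Suc by simp
  qed
  have "(\<lambda>N. a ^ Suc N * g $ N) \<longlonglongrightarrow> 0"
  proof (rule Lim_null_comparison)
    show "\<forall>\<^sub>F N in sequentially. norm (a ^ Suc N * g $ N) \<le> cmod a ^ Suc N * B"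
      by (intro always_eventually allI) (simp add: norm_mult norm_power mult_left_mono B)
    have "(\<lambda>N. cmod a ^ Suc N * B) \<longlonglongrightarrow> 0 * B"
      by (intro tendsto_intros LIMSEQ_Suc LIMSEQ_power_zero) (simp add: a)
    thus "(\<lambda>N. cmod a ^ Suc N * B) \<longlonglongrightarrow> 0" by simp
  qed
  hence "(\<lambda>N. \<Sum>i\<le>N. coeff q i * a ^ i) \<longlonglongrightarrow> 0" unfolding tele using tendsto_minus by fastforce
  moreover have "(\<lambda>N. \<Sum>i\<le>N. coeff q i * a ^ i) \<longlonglongrightarrow> poly q a"
  proof (rule tendsto_eventually, unfold eventually_sequentially, intro exI allI impI)
    fix N assume "degree q \<le> N"
    thus "(\<Sum>i\<le>N. coeff q i * a ^ i) = poly q a"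
      unfolding poly_altdef by (intro sum.mono_neutral_right) (auto simp: coeff_eq_0)
  qed
  ultimately show ?thesis using LIMSEQ_unique by blast
qed

text \<open>A root of x lies in the disk, where g is analytic and w has no zero, so it is a root of
  \<open>\<beta>\<close>. Dividing both by the linear factor keeps the equation and allows
  induction, which accounts for multiplicities.\<close>

lemma degree_le_of_cross:
  assumes "x \<noteq> 0" "\<beta> \<noteq> 0" "\<And>a. poly x a = 0 \<Longrightarrow> cmod a < 1" "\<And>a. cmod a < 1 \<Longrightarrow> poly w a \<noteq> 0"
    "g \<in> H1" "fps_of_poly w * fps_of_poly \<beta> = fps_of_poly x * g"
  shows "degree x \<le> degree \<beta>"
  using assms(1,2,3,6)
proof (induction "degree x" arbitrary: x \<beta>)
  case (Suc n)
  hence "\<not> constant (poly x)" by (simp add: constant_degree)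
  then obtain a where a: "poly x a = 0" using fundamental_theorem_of_algebra by blast
  let ?l = "[:- a, 1:]"
  obtain x1 where x1: "x = ?l * x1" using a unfolding poly_eq_0_iff_dvd by (elim dvdE)
  have a1: "cmod a < 1" by (rule Suc.prems(3)[OF a])
  have "fps_of_poly (w * \<beta>) = fps_of_poly ?l * (fps_of_poly x1 * g)"
    using Suc.prems(4) unfolding x1 fps_of_poly_mult by (simp only: mult.assoc)
  hence "poly (w * \<beta>) a = 0"
    by (rule poly_root_if_linear_factor[OF a1 degle_H1_mult[of "degree x1", OF _ assms(5)], rotated])
      (simp add: degle_fps_of_poly)
  hence "poly \<beta> a = 0" using assms(4)[OF a1] by simp
  then obtain b1 where b1: "\<beta> = ?l * b1" unfolding poly_eq_0_iff_dvd by (elim dvdE)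
  have l0: "fps_of_poly ?l \<noteq> 0" using fps_of_poly_eq_iff'[of ?l 0] by simp
  have "fps_of_poly ?l * (fps_of_poly w * fps_of_poly b1) = fps_of_poly ?l * (fps_of_poly x1 * g)"
    using Suc.prems(4) unfolding x1 b1 fps_of_poly_mult by (simp only: mult_ac)
  hence eq: "fps_of_poly w * fps_of_poly b1 = fps_of_poly x1 * g" using l0 by simp
  have x10: "x1 \<noteq> 0" and b10: "b1 \<noteq> 0" using Suc.prems(1,2) x1 b1 by auto
  have dx: "degree x = Suc (degree x1)" unfolding x1 using x10 by (subst degree_mult_eq) auto
  have db: "degree \<beta> = Suc (degree b1)" unfolding b1 using b10 by (subst degree_mult_eq) auto
  have "degree x1 \<le> degree b1"
  proof (rule Suc.hyps(1))
    show "n = degree x1" using Suc.hyps(2) dx by simp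
    show "cmod c < 1" if "poly x1 c = 0" for c using Suc.prems(3)[of c] that unfolding x1 by simp
  qed (use x10 b10 eq in auto)
  thus ?case using dx db by simp
qed simp

section \<open>The rank is the degree in z2 of the reduced fraction\<close>

context isometric_multiplier
begin

lemma moebius_ip_add:
  assumes t: "moebius v x w y" and t': "moebius v' x' w' y'"
  shows "ip1 v v' + ip1 x x' = ip1 w w' + ip1 y y'"
proof -
  note I = moebius_H1[OF t, unfolded H1_iota] moebius_H1[OF t', unfolded H1_iota]
  have expand: "ip (iota a + fps_X * iota b) (iota a' + fps_X * iota b') = ip1 a a' + ip1 b b'"
    if "iota a \<in> H2" "iota b \<in> H2" "iota a' \<in> H2" "iota b' \<in> H2" for a b a' b'
    using that by (simp add: ip_add_left ip_add_right H2_add H2_X ip_X_iota ip_iota_X ip_XX ip1_def)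
  have "ip (\<theta> * (iota w + fps_X * iota y)) (\<theta> * (iota w' + fps_X * iota y')) =
      ip (iota w + fps_X * iota y) (iota w' + fps_X * iota y')"
    by (rule mult_ip) (use I in \<open>auto intro!: H2_add H2_X[THEN iffD2]\<close>)
  thus ?thesis unfolding moebius_eq[OF t] moebius_eq[OF t'] by (simp add: expand I)
qed

text \<open>An additional factor z1 on the first denominator moves the pairing by one degree in z1,
  which leaves a single product on each side.\<close>

lemma moebius_ip_cross:
  assumes t: "moebius v x w y" and t': "moebius v' x' w' y'"
  shows "ip1 v x' = ip1 w y'"
proof -
  note I = moebius_H1[OF t, unfolded H1_iota] moebius_H1[OF t', unfolded H1_iota]
  have expand: "ip (fps_X * (iota a + fps_X * iota b)) (iota a' + fps_X * iota b') = ip1 a b'"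
    if "iota a \<in> H2" "iota b \<in> H2" "iota a' \<in> H2" "iota b' \<in> H2" for a b a' b'
  proof -
    have "ip (fps_X * (iota a + fps_X * iota b)) (iota a' + fps_X * iota b') =
        ip (fps_X * (iota a + fps_X * iota b)) (fps_X * iota b')"
      using that by (simp add: ip_add_right H2_add H2_X ip_X_iota)
    also have "\<dots> = ip1 a b'" unfolding ip_XX using that by (simp add: ip_add_left H2_X ip_X_iota ip1_def)
    finally show ?thesis .
  qed
  have "ip (\<theta> * (fps_X * (iota w + fps_X * iota y))) (\<theta> * (iota w' + fps_X * iota y')) =
      ip (fps_X * (iota w + fps_X * iota y)) (iota w' + fps_X * iota y')"
    by (rule mult_ip) (use I in \<open>auto intro!: H2_add H2_X[THEN iffD2]\<close>)
  thus ?thesis unfolding mult.left_commute[of \<theta> fps_X] moebius_eq[OF t] moebius_eq[OF t'] by (simp add: expand I)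
qed

text \<open>The three z1-coefficients of |v + z1 x|^2 = |w + z1 y|^2 on the torus, after
  multiplication by z1 z2^m. Each coefficient in z2 is an isometry relation between two shifts of
  the fraction by powers of z2.\<close>

lemma moebius_creflect_relations:
  assumes t: "moebius v x w y" and deg: "degle m v" "degle m x" "degle m w" "degle m y"
  shows "v * creflect m x = w * creflect m y" "x * creflect m v = y * creflect m w"
    "v * creflect m v + x * creflect m x = w * creflect m w + y * creflect m y"
proof -
  have tX: "moebius (fps_X ^ j * v) (fps_X ^ j * x) (fps_X ^ j * w) (fps_X ^ j * y)" for j
    using moebius_degle[OF t degle_X[of j]] by (simp only: mult.commute)
  note nth = mult_creflect_nth[OF deg(1)] mult_creflect_nth[OF deg(2)] mult_creflect_nth[OF deg(3)] mult_creflect_nth[OF deg(4)]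
  note H = moebius_H1[OF t]
  show "v * creflect m x = w * creflect m y"
    by (rule fps_ext) (simp only: nth H moebius_ip_cross[OF tX tX])
  show "x * creflect m v = y * creflect m w"
  proof (rule fps_ext)
    fix N
    show "(x * creflect m v) $ N = (y * creflect m w) $ N"
      unfolding nth(1)[OF H(2)] nth(3)[OF H(4)]
      using arg_cong[OF moebius_ip_cross[OF tX[of N] tX[of m]], of cnj] by (simp only: ip1_cnj)
  qed
  show "v * creflect m v + x * creflect m x = w * creflect m w + y * creflect m y"
    by (rule fps_ext) (simp only: fps_add_nth nth H moebius_ip_add[OF tX tX])
qed

lemma theta_nonzero: "\<theta> \<noteq> 0"
proof
  assume "\<theta> = 0"
  hence "ip 1 1 = (0::complex)" using mult_ip[of 1 1] H1_one by (simp add: ip_zero_left H1_iota)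
  moreover have "ip 1 1 = (1::complex)" using ip_zpow[of 1 0 0] by (simp add: zpow_def)
  ultimately show False by simp
qed

text \<open>Together, m is the least k with \<open>rank_le k\<close>. The case psi = 0 is apart
  because \<open>reflection_unique\<close> requires x or y to be nonzero.\<close>

theorem rank_le_iff_degree:
  fixes v x w y :: "complex poly"
  assumes cop: "coprime (comb v x) (comb w y)"
    and nz: "\<And>z1 z2. cmod z1 < 1 \<Longrightarrow> cmod z2 < 1 \<Longrightarrow> poly w z2 + z1 * poly y z2 \<noteq> 0"
    and t: "moebius (fps_of_poly v) (fps_of_poly x) (fps_of_poly w) (fps_of_poly y)"
    and m: "m = max (max (degree v) (degree x)) (max (degree w) (degree y))"
  shows "rank_le m" "rank_le k \<Longrightarrow> m \<le> k"
proof -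
  have deg: "degree v \<le> m" "degree x \<le> m" "degree w \<le> m" "degree y \<le> m" using m by auto
  note deg' = deg[folded degle_fps_of_poly]
  have w0: "w \<noteq> 0" using nz[of 0 0] by auto
  hence fw0: "fps_of_poly w \<noteq> 0" using fps_of_poly_eq_iff'[of w 0] by simp
  have "rank_le m \<and> (rank_le k \<longrightarrow> m \<le> k)"
  proof (cases "\<psi> = 0")
    case psi: True
    have \<theta>: "\<theta> = iota \<phi>" using theta_split psi by simp
    have phi0: "\<phi> \<noteq> 0" using theta_nonzero \<theta> by auto
    have v: "fps_of_poly v = \<phi> * fps_of_poly w" by (rule moebius_shift(1)[OF t])
    have "iota (\<phi> * fps_of_poly y) = iota (fps_of_poly x)"
      using moebius_shift(2)[OF t] psi unfolding iota_mult \<theta>[symmetric] by simp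
    hence x: "fps_of_poly x = \<phi> * fps_of_poly y" by simp
    have "fps_of_poly (y * v) = fps_of_poly (x * w)" unfolding fps_of_poly_mult v x by (simp only: mult_ac)
    hence yv: "y * v = x * w" by (simp only: fps_of_poly_eq_iff')
    have y0: "y = 0" by (rule coprime_comb_proportional[OF cop yv])
    hence x0: "x = 0" using yv w0 by simp
    have t0: "moebius (fps_of_poly v) 0 (fps_of_poly w) 0" using t x0 y0 by simp
    have v0: "v \<noteq> 0" using v phi0 fw0 by auto
    have "coprime v w"
    proof (rule coprimeI)
      fix d assume d: "d dvd v" "d dvd w"
      have "lift d dvd comb p 0" if "d dvd p" for p
        using that lift_mult_comb[of d _ 0] by (metis dvdE dvd_triv_left mult_zero_right)
      hence "is_unit (lift d)" using cop d unfolding x0 y0 by (intro coprime_common_divisor) auto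
      hence "degree (lift d) = 0" by (auto simp: is_unit_poly_iff)
      hence "coeff d i = 0" if "i > 0" for i using coeff_eq_0[of "lift d" i] that by (simp add: coeff_lift)
      hence "degree d = 0" using degree_le_iff[of d 0] by simp
      moreover have "d \<noteq> 0" using d v0 by auto
      ultimately show "is_unit d" by (simp add: is_unit_iff_degree)
    qed
    note cop' = this
    have "rank_le m"
      by (rule rank_le_if_moebius_psi_zero[OF t0 psi, of "degree v"]) (use v0 deg in \<open>auto simp: degle_fps_of_poly\<close>)
    moreover have "m \<le> k" if rank_le: "rank_le k"
    proof -
      obtain p q where pq: "degle k p" "degle k q" "q \<noteq> 0" "moebius p 0 q 0"
        using rank_le_psi_zero[OF rank_le psi] by blast
      obtain p' where p': "fps_of_poly p' = p" "degree p' \<le> k" using degle_poly_exists[OF pq(1)] by blast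
      obtain q' where q': "fps_of_poly q' = q" "degree q' \<le> k" using degle_poly_exists[OF pq(2)] by blast
      \<comment> \<open>Both v / w and p / q equal phi, and v / w is in lowest terms.\<close>
      have "fps_of_poly (v * q') = fps_of_poly (w * p')"
        unfolding fps_of_poly_mult v p' q' moebius_shift(1)[OF pq(4)] by (simp only: mult_ac)
      hence vq: "v * q' = w * p'" by (simp only: fps_of_poly_eq_iff')
      have q'0: "q' \<noteq> 0" using pq(3) q'(1) by auto
      hence p'0: "p' \<noteq> 0" using vq v0 by auto
      have "w dvd v * q'" unfolding vq by simp
      hence "w dvd q'" using cop' by (simp add: coprime_dvd_mult_right_iff coprime_commute)
      hence "degree w \<le> k" using dvd_imp_degree_le[OF _ q'0] q'(2) by force
      have "v dvd w * p'" unfolding vq[symmetric] by simp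
      hence "v dvd p'" using cop' by (simp add: coprime_dvd_mult_right_iff)
      hence "degree v \<le> k" using dvd_imp_degree_le[OF _ p'0] p'(2) by force
      thus ?thesis using \<open>degree w \<le> k\<close> m x0 y0 by simp
    qed
    ultimately show ?thesis by blast
  next
    case psi: False
    have z1: "x \<noteq> 0 \<or> y \<noteq> 0"
    proof (rule ccontr)
      assume "\<not> ?thesis"
      hence "\<psi> * iota (fps_of_poly w) = 0" using moebius_shift(2)[OF t] by simp
      thus False using psi fw0 by simp
    qed
    have top: "\<not> (m > 0 \<and> degree v < m \<and> degree x < m \<and> degree w < m \<and> degree y < m)"
      using m by linarith
    note rel = moebius_creflect_relations[OF t deg', unfolded creflect_fps_of_poly fps_of_poly_mult[symmetric]
        fps_of_poly_add[symmetric] fps_of_poly_eq_iff']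
    obtain c where c: "c \<noteq> 0" "preflect m x = smult c w" "preflect m v = smult c y"
      "preflect m y = smult c v" "preflect m w = smult c x"
      by (rule reflection_unique[OF cop deg top w0 z1 rel])
    note R = roots_of_reflected[OF cop nz deg(1,3) c(1,3,5)]
    have "rank_le m"
    proof (rule rank_le_if_moebius[OF t deg' c(1)])
      show "creflect m (fps_of_poly x) = fps_const c * fps_of_poly w"
        "creflect m (fps_of_poly w) = fps_const c * fps_of_poly x"
        "creflect m (fps_of_poly v) = fps_const c * fps_of_poly y"
        unfolding creflect_fps_of_poly c fps_of_poly_smult' by (rule refl)+
      show "fps_of_poly w \<noteq> 0" by (rule fw0)
      fix e u assume eu: "\<forall>i\<ge>m. e $ i = 0" "\<forall>i\<ge>m. u $ i = 0" "fps_of_poly x * e = fps_of_poly w * u"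
      have "degle m e" "degle m u" using eu by (auto simp: degle_def)
      then obtain e' u' where e': "fps_of_poly e' = e" and u': "fps_of_poly u' = u"
        using degle_poly_exists by metis
      have "fps_of_poly (x * e') = fps_of_poly (w * u')" unfolding fps_of_poly_mult e' u' by (rule eu(3))
      hence eq: "x * e' = w * u'" by (simp only: fps_of_poly_eq_iff')
      hence "x dvd w * u'" by (metis dvd_triv_left)
      hence dvd: "x dvd u'" using R(3) by (simp add: coprime_dvd_mult_right_iff)
      have "u' = 0"
      proof (rule ccontr)
        assume u'0: "u' \<noteq> 0"
        hence "m \<le> degree u'" using dvd_imp_degree_le[OF dvd] R(1) by simp
        hence "lead_coeff u' = 0" using eu(2) unfolding u'[symmetric] by simp
        thus False using u'0 by simp
      qed
      hence "e' = 0" using eq R(2) by simp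
      thus "e = 0" using e' by simp
    qed
    moreover have "m \<le> k" if rank_le: "rank_le k"
    proof -
      obtain \<beta> g where \<beta>: "\<beta> \<noteq> 0" "degle k \<beta>" "g \<in> H1" "fps_of_poly w * \<beta> = fps_of_poly x * g"
        using rank_le_moebius_cross[OF t rank_le psi fw0] by blast
      obtain b where b: "fps_of_poly b = \<beta>" "degree b \<le> k" using degle_poly_exists[OF \<beta>(2)] by blast
      have "degree x \<le> degree b"
        by (rule degree_le_of_cross[OF R(2) _ R(4) R(5) \<beta>(3)]) (use \<beta> b in auto)
      thus ?thesis using R(1) b(2) by simp
    qed
    ultimately show ?thesis by blast
  qed
  thus "rank_le m" "rank_le k \<Longrightarrow> m \<le> k" by auto
qed

end

section \<open>Fourier series on the torus\<close>

abbreviation square :: "(real \<times> real) set" where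
  "square \<equiv> {0..2 * pi} \<times> {0..2 * pi}"

abbreviation torus :: "(real \<times> real) measure" where
  "torus \<equiv> lebesgue_on square"

definition torus_exp :: "nat \<times> nat \<Rightarrow> real \<times> real \<Rightarrow> complex" where
  "torus_exp = (\<lambda>(j, k) (s, t). cis (real j * s) * cis (real k * t))"

lemma square_cbox: "square = cbox (0, 0) (2 * pi, 2 * pi)"
  by (simp add: cbox_Pair_eq)

lemma integrable_torus:
  fixes f :: "real \<times> real \<Rightarrow> complex"
  assumes "continuous_on square f"
  shows "integrable torus f"
proof -
  have "f absolutely_integrable_on square"
    using assms unfolding square_cbox by (rule absolutely_integrable_continuous)
  thus ?thesis by (simp add: integrable_restrict_space set_integrable_def square_cbox)
qed

lemma integral_torus:
  fixes f :: "real \<times> real \<Rightarrow> complex"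
  assumes "continuous_on square f"
  shows "(LINT x|torus. f x) = integral {0..2 * pi} (\<lambda>s. integral {0..2 * pi} (\<lambda>t. f (s, t)))"
proof -
  have "(LINT x|torus. f x) = integral square f"
    by (rule lebesgue_integral_eq_integral[OF integrable_torus[OF assms]]) (simp add: square_cbox)
  thus ?thesis using integral_prod_continuous[of 0 0 "2 * pi" "2 * pi" f] assms by (simp add: square_cbox)
qed

lemma integral_cis: "integral {0..2 * pi} (\<lambda>s. cis (of_int m * s)) = (if m = 0 then 2 * pi else 0)"
proof (cases "m = 0")
  case False
  have "((\<lambda>s. cis (of_int m * s)) has_integral
      cis (of_int m * (2 * pi)) / (\<i> * of_int m) - cis (of_int m * 0) / (\<i> * of_int m)) {0..2 * pi}"
  proof (rule fundamental_theorem_of_calculus)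
    fix s :: real
    show "((\<lambda>s. cis (of_int m * s) / (\<i> * of_int m)) has_vector_derivative cis (of_int m * s)) (at s within {0..2 * pi})"
      unfolding cis_conv_exp using False
      by (auto intro!: derivative_eq_intros has_vector_derivative_real_field
          simp: mult.left_commute[of \<i> "exp z" \<i> for z])
  qed simp
  moreover have "cis (of_int m * (2 * pi)) = 1"
    using cis_multiple_2pi[of "of_int m"] by (simp add: mult_ac)
  ultimately show ?thesis using False by (simp add: integral_unique)
qed (simp add: cis_zero scaleR_conv_of_real)

lemma torus_exp_orthonormal:
  "(LINT x|torus. torus_exp p x * cnj (torus_exp q x)) = (if p = q then (2 * pi)\<^sup>2 else 0)"
proof -
  obtain j k j' k' where pq: "p = (j, k)" "q = (j', k')" by (cases p, cases q) auto
  let ?m = "int j - int j'" and ?n = "int k - int k'"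
  have e: "torus_exp p (s, t) * cnj (torus_exp q (s, t)) = cis (of_int ?m * s) * cis (of_int ?n * t)" for s t
  proof -
    have "of_int ?m * s = real j * s + - (real j' * s)" "of_int ?n * t = real k * t + - (real k' * t)"
      by (simp_all add: left_diff_distrib)
    moreover have "torus_exp p (s, t) * cnj (torus_exp q (s, t)) =
        (cis (real j * s) * cis (- (real j' * s))) * (cis (real k * t) * cis (- (real k' * t)))"
      unfolding torus_exp_def pq by (simp only: prod.case complex_cnj_mult cis_cnj mult_ac)
    ultimately show ?thesis by (simp only: cis_mult)
  qed
  have "continuous_on square (\<lambda>x. torus_exp p x * cnj (torus_exp q x))"
    unfolding torus_exp_def pq case_prod_beta by (auto intro!: continuous_intros)
  from integral_torus[OF this]
  have "(LINT x|torus. torus_exp p x * cnj (torus_exp q x)) =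
      integral {0..2 * pi} (\<lambda>s. cis (of_int ?m * s) * integral {0..2 * pi} (\<lambda>t. cis (of_int ?n * t)))"
    unfolding e by simp
  also have "\<dots> = integral {0..2 * pi} (\<lambda>s. cis (of_int ?m * s)) * integral {0..2 * pi} (\<lambda>t. cis (of_int ?n * t))"
    by simp
  also have "\<dots> = (if p = q then (2 * pi)\<^sup>2 else 0)"
    unfolding integral_cis by (auto simp: pq power2_eq_square)
  finally show ?thesis .
qed

lemma torus_exp_measurable [measurable]: "torus_exp p \<in> borel_measurable torus"
proof -
  have "continuous_on square (torus_exp p)"
    unfolding torus_exp_def case_prod_beta by (auto intro!: continuous_intros)
  from integrable_torus[OF this] show ?thesis by (rule borel_measurable_integrable)
qed

lemma norm_torus_exp: "norm (torus_exp p x) = 1"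
  by (simp add: torus_exp_def case_prod_beta norm_mult)

lemma integrable_torus_bounded:
  fixes f :: "real \<times> real \<Rightarrow> complex"
  assumes "f \<in> borel_measurable torus" "\<And>x. norm (f x) \<le> B"
  shows "integrable torus f"
proof (rule integrableI_bounded_set[where A = square and B = B])
  show "emeasure torus square < \<infinity>"
    by (simp add: emeasure_restrict_space square_cbox emeasure_lborel_cbox_eq)
qed (use assms in \<open>auto simp: square_cbox space_restrict_space\<close>)

lemma borel_measurable_cnj:
  "f \<in> borel_measurable M \<Longrightarrow> (\<lambda>x. cnj (f x)) \<in> borel_measurable M"
  by (rule measurable_compose[OF _ borel_measurable_continuous_onI]) (auto intro!: continuous_intros)

lemma torus_finite: "finite_measure torus"
  by (rule finite_measureI)
    (simp add: emeasure_restrict_space square_cbox emeasure_lborel_cbox_eq space_restrict_space)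

text \<open>Meant for absolutely summable coefficients: those of functions dilated by a radius below
  1, and those of polynomials.\<close>

definition fourier :: "(nat \<times> nat \<Rightarrow> complex) \<Rightarrow> real \<times> real \<Rightarrow> complex" where
  "fourier c x = (\<Sum>\<^sub>\<infinity>p. c p * torus_exp p x)"

context
  fixes c :: "nat \<times> nat \<Rightarrow> complex"
  assumes c: "(\<lambda>p. norm (c p)) summable_on UNIV"
begin

lemma fourier_abs_summable: "(\<lambda>p. norm (c p * torus_exp p x)) summable_on UNIV"
  using c by (simp add: norm_mult norm_torus_exp)

lemma norm_fourier_le: "norm (fourier c x) \<le> (\<Sum>\<^sub>\<infinity>p. norm (c p))"
  unfolding fourier_def using norm_infsum_bound[OF fourier_abs_summable[of x]]
  by (simp add: norm_mult norm_torus_exp)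

lemma fourier_summable: "summable (\<lambda>n. norm (c (prod_decode n)))"
proof -
  have "(\<lambda>n. norm (c (prod_decode n))) summable_on UNIV"
    using summable_on_reindex_bij_betw[OF bij_prod_decode, of "\<lambda>p. norm (c p)"] c by simp
  thus ?thesis by (rule summable_on_imp_summable)
qed

lemma fourier_sums: "(\<lambda>n. c (prod_decode n) * torus_exp (prod_decode n) x) sums fourier c x"
proof -
  have "((\<lambda>p. c p * torus_exp p x) has_sum fourier c x) UNIV"
    unfolding fourier_def by (rule has_sum_infsum[OF abs_summable_summable[OF fourier_abs_summable]])
  hence "((\<lambda>n. c (prod_decode n) * torus_exp (prod_decode n) x) has_sum fourier c x) UNIV"
    using has_sum_reindex_bij_betw[OF bij_prod_decode, of "\<lambda>p. c p * torus_exp p x"] by simp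
  thus ?thesis by (rule has_sum_imp_sums)
qed

lemma fourier_measurable [measurable]: "fourier c \<in> borel_measurable torus"
proof -
  have "fourier c = (\<lambda>x. \<Sum>n. c (prod_decode n) * torus_exp (prod_decode n) x)"
    using fourier_sums by (auto simp: sums_iff)
  thus ?thesis by simp
qed

lemma integrable_torus_exp_mult:
  assumes "f \<in> borel_measurable torus" "\<And>x. norm (f x) \<le> B"
  shows "integrable torus (\<lambda>x. torus_exp p x * f x)"
  by (rule integrable_torus_bounded[of _ B]) (use assms in \<open>auto simp: norm_mult norm_torus_exp\<close>)

text \<open>Termwise integration, justified by the summable bounds |c p| B. The double index is
  enumerated by \<open>prod_decode\<close> because \<open>sums_integral\<close> speaks of
  sequences.\<close>

lemma fourier_integral_sums:
  assumes f: "f \<in> borel_measurable torus" "\<And>x. norm (f x) \<le> B"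
  shows "(\<lambda>n. c (prod_decode n) * (LINT x|torus. torus_exp (prod_decode n) x * f x)) sums
    (LINT x|torus. fourier c x * f x)"
proof -
  let ?F = "\<lambda>n x. c (prod_decode n) * (torus_exp (prod_decode n) x * f x)"
  note I = integrable_torus_exp_mult[OF f]
  have int: "integrable torus (?F n)" for n using I[of "prod_decode n"] by simp
  have B0: "B \<ge> 0" using f(2)[of undefined] norm_ge_zero order_trans by blast
  have nF: "norm (?F n x) \<le> norm (c (prod_decode n)) * B" for n x
    by (simp add: norm_mult norm_torus_exp mult_left_mono f)
  have s1: "AE x in torus. summable (\<lambda>n. norm (?F n x))"
    by (intro AE_I2 summable_comparison_test'[OF summable_mult2[OF fourier_summable, of B]])
      (use nF in simp)
  have s2: "summable (\<lambda>n. LINT x|torus. norm (?F n x))"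
  proof (rule summable_comparison_test'[OF summable_mult2[OF summable_mult2[OF fourier_summable, of B], of "measure torus (space torus)"]])
    fix n :: nat
    have "(LINT x|torus. norm (?F n x)) \<le> (LINT x|torus. norm (c (prod_decode n)) * B)"
      by (rule integral_mono) (use int nF in \<open>auto simp: finite_measure.integrable_const[OF torus_finite]\<close>)
    also have "\<dots> = norm (c (prod_decode n)) * B * measure torus (space torus)" by simp
    finally show "norm (LINT x|torus. norm (?F n x)) \<le> norm (c (prod_decode n)) * B * measure torus (space torus)"
      by simp
  qed
  have "(\<lambda>n. LINT x|torus. ?F n x) sums (LINT x|torus. (\<Sum>n. ?F n x))"
    by (rule sums_integral[OF int s1 s2])
  moreover have "(\<Sum>n. ?F n x) = fourier c x * f x" for x
    using sums_mult2[OF fourier_sums[of x], of "f x"] by (simp add: sums_iff mult.assoc)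
  ultimately show ?thesis by simp
qed

lemma fourier_coefficient:
  "(LINT x|torus. fourier c x * cnj (torus_exp q x)) = (2 * pi)\<^sup>2 * c q"
proof -
  have meas: "(\<lambda>x. cnj (torus_exp q x)) \<in> borel_measurable torus"
    by (rule borel_measurable_cnj[OF torus_exp_measurable])
  have 1: "(\<lambda>n. c (prod_decode n) * (if prod_decode n = q then (2 * pi)\<^sup>2 else 0)) sums
      (LINT x|torus. fourier c x * cnj (torus_exp q x))"
    using fourier_integral_sums[OF meas, of 1] by (simp add: norm_torus_exp torus_exp_orthonormal)
  have 2: "(\<lambda>n. c (prod_decode n) * (if prod_decode n = q then (2 * pi)\<^sup>2 else 0)) sums
      (\<Sum>n\<in>{prod_encode q}. c (prod_decode n) * (if prod_decode n = q then (2 * pi)\<^sup>2 else 0))"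
    by (rule sums_finite) auto
  show ?thesis using sums_unique2[OF 1 2] by (simp add: mult.commute)
qed

end

text \<open>Termwise integration against the conjugate of the series itself, followed by
  \<open>fourier_coefficient\<close>.\<close>

lemma parseval:
  assumes c: "(\<lambda>p. norm (c p)) summable_on UNIV"
  shows "(LINT x|torus. (norm (fourier c x))\<^sup>2) = (2 * pi)\<^sup>2 * lsq c" "l2 c"
proof -
  let ?B = "\<Sum>\<^sub>\<infinity>p. norm (c p)"
  have "(\<lambda>p. norm (c p)) summable_on UNIV" using c by simp
  have l2: "l2 c" unfolding l2_def
  proof (rule summable_on_comparison_test[OF summable_on_cmult_right[OF c, of ?B]])
    fix p
    have "norm (c p) \<le> ?B" using finite_sum_le_infsum[of "\<lambda>p. norm (c p)" UNIV "{p}"] c by simp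
    thus "(cmod (c p))\<^sup>2 \<le> ?B * norm (c p)" by (simp add: power2_eq_square mult_right_mono)
  qed auto
  thus "l2 c" .
  have "(\<lambda>n. c (prod_decode n) * (LINT x|torus. torus_exp (prod_decode n) x * cnj (fourier c x))) sums
      (LINT x|torus. fourier c x * cnj (fourier c x))"
    by (rule fourier_integral_sums[OF c, where B = ?B])
      (simp_all add: norm_fourier_le[OF c] borel_measurable_cnj[OF fourier_measurable[OF c]])
  moreover have "(LINT x|torus. torus_exp q x * cnj (fourier c x)) = cnj ((2 * pi)\<^sup>2 * c q)" for q
  proof -
    have "cnj ((2 * pi)\<^sup>2 * c q) = (LINT x|torus. cnj (fourier c x * cnj (torus_exp q x)))"
      unfolding fourier_coefficient[OF c, symmetric] by (rule Bochner_Integration.integral_cnj[symmetric])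
    thus ?thesis by (simp add: mult.commute)
  qed
  ultimately have "(\<lambda>n. c (prod_decode n) * cnj ((2 * pi)\<^sup>2 * c (prod_decode n))) sums
      (LINT x|torus. fourier c x * cnj (fourier c x))" by (simp only:)
  from sums_Re[OF this]
  have 1: "(\<lambda>n. (2 * pi)\<^sup>2 * (norm (c (prod_decode n)))\<^sup>2) sums Re (LINT x|torus. fourier c x * cnj (fourier c x))"
  proof (rule sums_cong[THEN iffD1, rotated])
    fix n
    have "c (prod_decode n) * cnj ((2 * pi)\<^sup>2 * c (prod_decode n)) =
        of_real ((2 * pi)\<^sup>2) * (c (prod_decode n) * cnj (c (prod_decode n)))" by simp
    also have "\<dots> = of_real ((2 * pi)\<^sup>2 * (norm (c (prod_decode n)))\<^sup>2)"
      unfolding complex_norm_square[symmetric] by simp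
    finally show "Re (c (prod_decode n) * cnj ((2 * pi)\<^sup>2 * c (prod_decode n))) =
        (2 * pi)\<^sup>2 * (norm (c (prod_decode n)))\<^sup>2" by (simp only: Re_complex_of_real)
  qed
  have "((\<lambda>p. (norm (c p))\<^sup>2) has_sum lsq c) UNIV"
    using l2 unfolding l2_def lsq_def by (rule has_sum_infsum)
  hence "((\<lambda>n. (norm (c (prod_decode n)))\<^sup>2) has_sum lsq c) UNIV"
    using has_sum_reindex_bij_betw[OF bij_prod_decode, of "\<lambda>p. (norm (c p))\<^sup>2"] by simp
  hence 2: "(\<lambda>n. (2 * pi)\<^sup>2 * (norm (c (prod_decode n)))\<^sup>2) sums ((2 * pi)\<^sup>2 * lsq c)"
    by (intro sums_mult has_sum_imp_sums)
  have "(LINT x|torus. fourier c x * cnj (fourier c x)) = of_real (LINT x|torus. (norm (fourier c x))\<^sup>2)"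
    unfolding integral_complex_of_real[symmetric] complex_norm_square ..
  thus "(LINT x|torus. (norm (fourier c x))\<^sup>2) = (2 * pi)\<^sup>2 * lsq c"
    using sums_unique2[OF 1 2] by (simp only: Re_complex_of_real)
qed

section \<open>Functions on the bidisk\<close>

lemma geometric_summable2:
  fixes a b :: real
  assumes "0 \<le> a" "a < 1" "0 \<le> b" "b < 1"
  shows "(\<lambda>p. a ^ fst p * b ^ snd p) summable_on (UNIV :: (nat \<times> nat) set)"
proof -
  have geo: "(\<lambda>n. x ^ n) summable_on UNIV" if "0 \<le> x" "x < 1" for x :: real
    by (rule norm_summable_imp_summable_on) (use that in \<open>auto simp: norm_power intro!: summable_geometric\<close>)
  have "(\<lambda>p. a ^ fst p * b ^ snd p) summable_on Sigma (UNIV :: nat set) (\<lambda>_. UNIV :: nat set)"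
  proof (rule summable_on_SigmaI)
    fix j :: nat
    show "((\<lambda>k. a ^ fst (j, k) * b ^ snd (j, k)) has_sum a ^ j * infsum (\<lambda>n. b ^ n) UNIV) UNIV"
      unfolding fst_conv snd_conv by (intro has_sum_cmult_right has_sum_infsum geo assms)
  next
    show "(\<lambda>j. a ^ j * infsum (\<lambda>n. b ^ n) UNIV) summable_on UNIV"
      by (intro summable_on_cmult_left geo assms)
  qed (use assms in auto)
  thus ?thesis by simp
qed

section \<open>Power series as functions on the bidisk\<close>

definition term2 :: "fps2 \<Rightarrow> complex \<times> complex \<Rightarrow> nat \<times> nat \<Rightarrow> complex" where
  "term2 f z p = f $ fst p $ snd p * fst z ^ fst p * snd z ^ snd p"

definition Fn :: "fps2 \<Rightarrow> complex \<times> complex \<Rightarrow> complex" where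
  "Fn f z = (if z \<in> bidisk then infsum (term2 f z) UNIV else 0)"

lemma bidisk_iff: "z \<in> bidisk \<longleftrightarrow> cmod (fst z) < 1 \<and> cmod (snd z) < 1"
  by (auto simp: bidisk_def mem_Times_iff)

lemma H2_coeff_le: "f \<in> H2 \<Longrightarrow> cmod (f $ j $ k) \<le> sqrt (nsq f)"
  using coord_le_lsq[of "cf f" "(j, k)"] by (simp add: H2_def nsq_def cf_def real_le_rsqrt)

lemma term2_abs_summable:
  assumes "f \<in> H2" "z \<in> bidisk"
  shows "(\<lambda>p. norm (term2 f z p)) summable_on UNIV"
proof (rule Infinite_Sum.abs_summable_on_comparison_test')
  show "(\<lambda>p. sqrt (nsq f) * (cmod (fst z) ^ fst p * cmod (snd z) ^ snd p)) summable_on UNIV"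
    by (intro summable_on_cmult_right geometric_summable2) (use assms(2) in \<open>auto simp: bidisk_iff\<close>)
  fix p
  show "norm (term2 f z p) \<le> sqrt (nsq f) * (cmod (fst z) ^ fst p * cmod (snd z) ^ snd p)"
    unfolding term2_def norm_mult norm_power mult.assoc
    by (intro mult_right_mono H2_coeff_le assms) auto
qed

lemma Fn_has_sum:
  assumes "f \<in> H2" "z \<in> bidisk"
  shows "(term2 f z has_sum Fn f z) UNIV"
  using has_sum_infsum[OF abs_summable_summable[OF term2_abs_summable[OF assms]]] assms(2)
  by (simp add: Fn_def)

lemma has_power_series_iff:
  "has_power_series g (cf f) \<longleftrightarrow> (\<forall>z\<in>bidisk. (term2 f z has_sum g z) UNIV)"
proof -
  have "(\<lambda>(j, k). cf f (j, k) * z1 ^ j * z2 ^ k) = term2 f (z1, z2)" for z1 z2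
    by (auto simp: term2_def cf_def fun_eq_iff)
  thus ?thesis by (auto simp: has_power_series_def)
qed

lemma Fn_power_series: "f \<in> H2 \<Longrightarrow> has_power_series (Fn f) (cf f)"
  unfolding has_power_series_iff using Fn_has_sum by blast

lemma term2_torus:
  "term2 f (of_real r * cis s, of_real r * cis t) p =
     (f $ fst p $ snd p * of_real (r ^ (fst p + snd p))) * torus_exp p (s, t)"
proof (cases p)
  case (Pair j k)
  show ?thesis
    unfolding Pair term2_def torus_exp_def prod.case fst_conv snd_conv power_mult_distrib Complex.DeMoivre
    by (simp add: power_add)
qed

lemma torus_in_bidisk: "0 \<le> r \<Longrightarrow> r < 1 \<Longrightarrow> (of_real r * cis s, of_real r * cis t) \<in> bidisk"
  by (simp add: bidisk_iff norm_mult)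

lemma dilation_abs_summable:
  assumes "\<And>z. z \<in> bidisk \<Longrightarrow> (term2 f z has_sum g z) UNIV" "0 \<le> r" "r < 1"
  shows "(\<lambda>p. norm (f $ fst p $ snd p * of_real (r ^ (fst p + snd p)))) summable_on UNIV"
proof -
  have "term2 f (of_real r * cis 0, of_real r * cis 0) summable_on UNIV"
    using assms(1)[OF torus_in_bidisk[OF assms(2,3)]] by (rule has_sum_imp_summable)
  hence "(\<lambda>p. norm (term2 f (of_real r * cis 0, of_real r * cis 0) p)) summable_on UNIV"
    unfolding summable_on_iff_abs_summable_on_complex .
  thus ?thesis unfolding term2_torus norm_mult norm_torus_exp mult_1_right .
qed

lemma dilation_fourier:
  assumes "\<And>z. z \<in> bidisk \<Longrightarrow> (term2 f z has_sum g z) UNIV" "0 \<le> r" "r < 1"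
  shows "fourier (\<lambda>p. f $ fst p $ snd p * of_real (r ^ (fst p + snd p))) (s, t) =
    g (of_real r * cis s, of_real r * cis t)"
  using infsumI[OF assms(1)[OF torus_in_bidisk[OF assms(2,3), of s t]]]
  unfolding fourier_def term2_torus[symmetric] .

text \<open>The coefficients can be recovered as Fourier coefficients on the torus of radius 1/2.
  This justifies the definite description in \<open>taylor_coeff\<close>.\<close>

lemma power_series_unique:
  assumes "\<And>z. z \<in> bidisk \<Longrightarrow> (term2 f z has_sum g z) UNIV" "\<And>z. z \<in> bidisk \<Longrightarrow> (term2 f' z has_sum g z) UNIV"
  shows "f = f'"
proof (rule fps_ext, rule fps_ext)
  fix j k
  let ?c = "\<lambda>p. f $ fst p $ snd p * of_real ((1/2) ^ (fst p + snd p))"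
  let ?c' = "\<lambda>p. f' $ fst p $ snd p * of_real ((1/2) ^ (fst p + snd p))"
  have c: "(\<lambda>p. norm (?c p)) summable_on UNIV" by (rule dilation_abs_summable[OF assms(1)]) auto
  have c': "(\<lambda>p. norm (?c' p)) summable_on UNIV" by (rule dilation_abs_summable[OF assms(2)]) auto
  have "fourier ?c x = fourier ?c' x" for x
  proof (cases x)
    case (Pair s t)
    show ?thesis unfolding Pair
      using dilation_fourier[OF assms(1), of "1/2" s t] dilation_fourier[OF assms(2), of "1/2" s t] by simp
  qed
  hence "(2 * pi)\<^sup>2 * ?c (j, k) = (2 * pi)\<^sup>2 * ?c' (j, k)"
    unfolding fourier_coefficient[OF c, symmetric] fourier_coefficient[OF c', symmetric] by simp
  thus "f $ j $ k = f' $ j $ k" by simp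
qed

lemma taylor_coeff_Fn: "f \<in> H2 \<Longrightarrow> taylor_coeff (Fn f) = cf f"
  unfolding taylor_coeff_def
proof (rule the_equality)
  assume f: "f \<in> H2"
  show "has_power_series (Fn f) (cf f)" by (rule Fn_power_series[OF f])
  fix a assume a: "has_power_series (Fn f) a"
  have "mk a = f"
  proof (rule power_series_unique[where g = "Fn f"])
    show "(term2 (mk a) z has_sum Fn f z) UNIV" if "z \<in> bidisk" for z
      using a that has_power_series_iff[of "Fn f" "mk a"] by simp
    show "(term2 f z has_sum Fn f z) UNIV" if "z \<in> bidisk" for z by (rule Fn_has_sum[OF f that])
  qed
  thus "a = cf f" using cf_mk by metis
qed

lemma hardy_inner_Fn: "f \<in> H2 \<Longrightarrow> g \<in> H2 \<Longrightarrow> hardy_inner (Fn f) (Fn g) = ip f g"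
  by (simp add: hardy_inner_def taylor_coeff_Fn ip_def lip_def)

lemma hardy_eq: "hardy = Fn ` H2"
proof
  show "hardy \<subseteq> Fn ` H2"
  proof
    fix g assume "g \<in> hardy"
    then obtain a where a: "\<forall>z. z \<notin> bidisk \<longrightarrow> g z = 0" "has_power_series g a"
      "(\<lambda>i. (cmod (a i))\<^sup>2) summable_on UNIV" by (auto simp: hardy_def)
    have H: "mk a \<in> H2" using a(3) by (simp add: H2_def l2_def)
    have "g z = Fn (mk a) z" for z
    proof (cases "z \<in> bidisk")
      case True
      have "(term2 (mk a) z has_sum g z) UNIV"
        using a(2) True has_power_series_iff[of g "mk a"] by simp
      thus ?thesis using Fn_has_sum[OF H True] has_sum_unique by blast
    next
      case False
      moreover from this have "g z = 0" using a(1)[rule_format, OF False] by simp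
      ultimately show ?thesis by (simp add: Fn_def)
    qed
    thus "g \<in> Fn ` H2" using H by blast
  qed
  show "Fn ` H2 \<subseteq> hardy"
  proof
    fix g assume "g \<in> Fn ` H2"
    then obtain f where "f \<in> H2" "g = Fn f" by blast
    thus "g \<in> hardy" using Fn_power_series[of f]
      by (auto simp: hardy_def H2_def l2_def Fn_def intro!: exI[of _ "cf f"])
  qed
qed

lemma Fn_inj: "f \<in> H2 \<Longrightarrow> g \<in> H2 \<Longrightarrow> Fn f = Fn g \<Longrightarrow> f = g"
  by (rule cf_eqI) (metis taylor_coeff_Fn)

lemma Fn_eqI:
  assumes "f \<in> H2" "\<And>z. z \<in> bidisk \<Longrightarrow> (term2 f z has_sum g z) UNIV" "\<And>z. z \<notin> bidisk \<Longrightarrow> g z = 0"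
  shows "Fn f = g"
proof
  fix z
  show "Fn f z = g z"
    using Fn_has_sum[OF assms(1), of z] assms(2)[of z] assms(3)[of z] has_sum_unique
    by (cases "z \<in> bidisk") (auto simp: Fn_def)
qed

lemma Fn_add: "f \<in> H2 \<Longrightarrow> g \<in> H2 \<Longrightarrow> Fn (f + g) = Fn f + Fn g"
proof (rule Fn_eqI)
  fix z assume "f \<in> H2" "g \<in> H2" "z \<in> bidisk"
  from has_sum_add[OF Fn_has_sum[OF this(1,3)] Fn_has_sum[OF this(2,3)]]
  moreover have "term2 (f + g) z = (\<lambda>p. term2 f z p + term2 g z p)"
    by (auto simp: term2_def distrib_right)
  ultimately show "(term2 (f + g) z has_sum (Fn f + Fn g) z) UNIV" by simp
qed (auto simp: H2_add Fn_def)

lemma Fn_sc: "f \<in> H2 \<Longrightarrow> Fn (sc c f) = (\<lambda>z. c * Fn f z)"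
proof (rule Fn_eqI)
  fix z assume "f \<in> H2" "z \<in> bidisk"
  from has_sum_cmult_right[OF Fn_has_sum[OF this], of c]
  moreover have "term2 (sc c f) z = (\<lambda>p. c * term2 f z p)"
    by (auto simp: term2_def mult.assoc)
  ultimately show "(term2 (sc c f) z has_sum (c * Fn f z)) UNIV" by simp
qed (auto simp: H2_sc Fn_def)

lemma Fn_diff: "f \<in> H2 \<Longrightarrow> g \<in> H2 \<Longrightarrow> Fn (f - g) = Fn f - Fn g"
  using Fn_add[of "f - g" g] by (simp add: H2_diff)

lemma Fn_zero: "Fn 0 = 0"
  using Fn_diff[of 0 0] by (simp add: H2_zero)

lemma sum_fun_apply: "(\<Sum>i\<in>F. f i) z = (\<Sum>i\<in>F. f i z)" for f :: "'i \<Rightarrow> 'a \<Rightarrow> complex"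
  by (induction F rule: infinite_finite_induct) simp_all

lemma Fn_sum: "finite F \<Longrightarrow> (\<And>i. i \<in> F \<Longrightarrow> f i \<in> H2) \<Longrightarrow> Fn (\<Sum>i\<in>F. f i) = (\<Sum>i\<in>F. Fn (f i))"
  by (induction F rule: finite_induct) (simp_all add: Fn_zero Fn_add H2_sum)

text \<open>The product may fail to lie in \<open>H2\<close>, so its series is handled pointwise, as
  a Cauchy product of absolutely convergent sums.\<close>

lemma product_has_sum:
  assumes f: "f \<in> H2" and g: "g \<in> H2" and z: "z \<in> bidisk"
  shows "(term2 (f * g) z has_sum (Fn f z * Fn g z)) UNIV"
proof -
  let ?a = "term2 f z" and ?b = "term2 g z"
  have sa: "(?a has_sum Fn f z) UNIV" and sb: "(?b has_sum Fn g z) UNIV"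
    using Fn_has_sum f g z by auto
  note na = term2_abs_summable[OF f z] and nb = term2_abs_summable[OF g z]
  have "(\<lambda>x. norm (?a (fst x) * ?b (snd x))) summable_on Sigma UNIV (\<lambda>_. UNIV)"
  proof (rule summable_on_SigmaI)
    fix p
    show "((\<lambda>q. norm (?a (fst (p, q)) * ?b (snd (p, q)))) has_sum norm (?a p) * infsum (\<lambda>q. norm (?b q)) UNIV) UNIV"
      unfolding fst_conv snd_conv norm_mult by (intro has_sum_cmult_right has_sum_infsum nb)
  next
    show "(\<lambda>p. norm (?a p) * infsum (\<lambda>q. norm (?b q)) UNIV) summable_on UNIV"
      by (intro summable_on_cmult_left na)
  qed auto
  hence "(\<lambda>x. ?a (fst x) * ?b (snd x)) summable_on Sigma UNIV (\<lambda>_. UNIV)"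
    by (rule abs_summable_summable)
  hence 1: "((\<lambda>x. ?a (fst x) * ?b (snd x)) has_sum (Fn f z * Fn g z)) (Sigma UNIV (\<lambda>_. UNIV))"
    by (rule has_sum_SigmaI[rotated 2]) (auto intro: has_sum_cmult_right sb has_sum_cmult_left sa)
  \<comment> \<open>Pairs of monomials grouped by the exponent of their product: the first component
    is that exponent, the second the exponent contributed by f.\<close>
  let ?S = "Sigma UNIV (\<lambda>p. {..fst p} \<times> {..snd p}) :: ((nat \<times> nat) \<times> (nat \<times> nat)) set"
  let ?h = "\<lambda>x. f $ fst (snd x) $ snd (snd x) *
    g $ (fst (fst x) - fst (snd x)) $ (snd (fst x) - snd (snd x)) * fst z ^ fst (fst x) * snd z ^ snd (fst x)"
  have "((\<lambda>x. ?a (fst x) * ?b (snd x)) has_sum (Fn f z * Fn g z)) (Sigma UNIV (\<lambda>_. UNIV)) \<longleftrightarrow>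
      (?h has_sum (Fn f z * Fn g z)) ?S"
  proof (rule has_sum_reindex_bij_witness[where
        i = "\<lambda>x. (snd x, (fst (fst x) - fst (snd x), snd (fst x) - snd (snd x)))" and
        j = "\<lambda>x. ((fst (fst x) + fst (snd x), snd (fst x) + snd (snd x)), fst x)"])
    fix x :: "(nat \<times> nat) \<times> (nat \<times> nat)"
    show "?h ((fst (fst x) + fst (snd x), snd (fst x) + snd (snd x)), fst x) = ?a (fst x) * ?b (snd x)"
      by (simp add: term2_def power_add mult_ac)
  qed auto
  with 1 have 2: "(?h has_sum (Fn f z * Fn g z)) ?S" by simp
  show ?thesis
  proof (rule has_sum_SigmaD[OF 2])
    fix p
    have "term2 (f * g) z p = (\<Sum>q\<in>{..fst p} \<times> {..snd p}. ?h (p, q))"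
      unfolding term2_def fst_conv snd_conv
      by (simp add: fps_mult_nth fps_sum_nth sum_distrib_right sum.cartesian_product case_prod_beta atMost_atLeast0)
    thus "((\<lambda>q. ?h (p, q)) has_sum term2 (f * g) z p) ({..fst p} \<times> {..snd p})"
      by (simp only:) (rule has_sum_finite, simp)
  qed
qed

lemma Fn_mult:
  assumes "f \<in> H2" "g \<in> H2" "f * g \<in> H2"
  shows "Fn (f * g) = (\<lambda>z. Fn f z * Fn g z)"
  by (rule Fn_eqI[OF assms(3) product_has_sum[OF assms(1,2)]]) (auto simp: Fn_def)

lemma Fn_zpow: "Fn (zpow j k) z = (if z \<in> bidisk then fst z ^ j * snd z ^ k else 0)"
proof (cases "z \<in> bidisk")
  case True
  have "zpow j k $ j' $ k' = (if (j', k') = (j, k) then 1 else 0)" for j' k'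
    using fun_cong[OF cf_zpow, of j k "(j', k')"] by (simp add: cf_def)
  hence "(term2 (zpow j k) z has_sum fst z ^ j * snd z ^ k) UNIV"
    by (intro has_sum_finite_neutralI[of "{(j, k)}"]) (auto simp: term2_def)
  thus ?thesis using Fn_has_sum[OF H2_zpow True, of j k] True has_sum_unique by auto
qed (simp add: Fn_def)

lemma Fn_X: "f \<in> H2 \<Longrightarrow> Fn (fps_X * f) = shift_z1 (Fn f)"
proof -
  assume f: "f \<in> H2"
  have X: "fps_X = zpow 1 0" by (simp add: zpow_def)
  have "Fn (fps_X * f) = (\<lambda>z. Fn fps_X z * Fn f z)"
    by (rule Fn_mult) (simp_all add: f H2_X, simp add: X H2_zpow)
  moreover have "Fn fps_X z * Fn f z = fst z * Fn f z" for z
  proof (cases "z \<in> bidisk")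
    case True
    thus ?thesis unfolding X Fn_zpow by simp
  qed (simp add: Fn_def)
  ultimately show ?thesis unfolding shift_z1_def by presburger
qed

text \<open>Besides embedding, this exchanges the two variables: the outer one is z2 for polynomials
  and z1 for \<open>fps2\<close>.\<close>

definition emb :: "complex poly poly \<Rightarrow> fps2" where
  "emb p = Abs_fps (\<lambda>j. Abs_fps (\<lambda>k. coeff (coeff p k) j))"

lemma emb_nth: "emb p $ j $ k = coeff (coeff p k) j" by (simp add: emb_def)

lemma emb_mult: "emb (p * q) = emb p * emb q"
proof (rule fps_ext, rule fps_ext)
  fix j k
  have "emb (p * q) $ j $ k = (\<Sum>l\<le>k. \<Sum>i\<le>j. coeff (coeff p l) i * coeff (coeff q (k - l)) (j - i))"
    by (simp add: emb_nth coeff_mult coeff_sum)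
  also have "\<dots> = (\<Sum>i\<le>j. \<Sum>l\<le>k. coeff (coeff p l) i * coeff (coeff q (k - l)) (j - i))"
    by (rule sum.swap)
  also have "\<dots> = (emb p * emb q) $ j $ k"
    by (simp add: fps_mult_nth fps_sum_nth emb_nth atMost_atLeast0)
  finally show "emb (p * q) $ j $ k = (emb p * emb q) $ j $ k" .
qed

lemma emb_eq_0_iff: "emb p = 0 \<longleftrightarrow> p = 0"
proof
  assume *: "emb p = 0"
  have "coeff (coeff p k) j = 0" for j k using emb_nth[of p j k] * by simp
  thus "p = 0" by (intro poly_eqI) simp
qed (simp add: emb_def fps_eq_iff)

lemma emb_comb: "emb (comb v x) = iota (fps_of_poly v) + fps_X * iota (fps_of_poly x)"
proof (rule fps_ext, rule fps_ext)
  fix j k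
  show "emb (comb v x) $ j $ k = (iota (fps_of_poly v) + fps_X * iota (fps_of_poly x)) $ j $ k"
    by (cases j; cases "j - 1") (simp_all add: emb_nth coeff_comb)
qed

lemma poly2_comb: "poly2 (comb v x) (z1, z2) = poly v z2 + z1 * poly x z2"
proof -
  have "poly (lift p) [:c:] = [:poly p c:]" for p c
    by (induction p) (simp_all add: lift_def map_poly_pCons)
  thus ?thesis by (simp add: poly2_def comb_def)
qed

lemma fps_of_poly_H1: "fps_of_poly v \<in> H1"
  by (rule degle_H1[of "degree v"]) (simp add: degle_fps_of_poly)

lemma Fn_fps_of_poly: "z \<in> bidisk \<Longrightarrow> Fn (iota (fps_of_poly v)) z = poly v (snd z)"
proof -
  assume z: "z \<in> bidisk"
  have "iota (fps_of_poly v) = (\<Sum>i\<le>degree v. sc (coeff v i) (zpow 0 i))"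
    using arg_cong[OF degle_expand[of "degree v" "fps_of_poly v"], of iota]
    by (simp only: iota_sum iota_sc iota_zpow degle_fps_of_poly fps_of_poly_nth)
  hence "Fn (iota (fps_of_poly v)) z = (\<Sum>i\<le>degree v. Fn (sc (coeff v i) (zpow 0 i))) z"
    by (simp only: Fn_sum[OF finite_atMost H2_sc[OF H2_zpow]])
  also have "\<dots> = (\<Sum>i\<le>degree v. Fn (sc (coeff v i) (zpow 0 i)) z)"
    by (rule sum_fun_apply)
  also have "\<dots> = poly v (snd z)"
    unfolding Fn_sc[OF H2_zpow] Fn_zpow poly_altdef using z by simp
  finally show ?thesis .
qed

lemma emb_comb_H2: "emb (comb v x) \<in> H2"
  unfolding emb_comb using fps_of_poly_H1 by (intro H2_add H2_X[THEN iffD2]) (auto simp: H1_def)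

lemma Fn_emb_comb: "z \<in> bidisk \<Longrightarrow> Fn (emb (comb v x)) z = poly2 (comb v x) z"
proof -
  assume z: "z \<in> bidisk"
  have H: "iota (fps_of_poly p) \<in> H2" for p using fps_of_poly_H1 by (simp add: H1_def)
  show ?thesis unfolding emb_comb
    using z by (cases z) (simp add: Fn_add H H2_X Fn_X shift_z1_def Fn_fps_of_poly poly2_comb)
qed

section \<open>Inner functions are isometric multipliers\<close>

lemma H2_zpow_mult: "f \<in> H2 \<Longrightarrow> zpow j k * f \<in> H2"
proof -
  assume f: "f \<in> H2"
  have "fps_X ^ i * h \<in> H2" if "h \<in> H2" for h i
    using that by (induction i) (simp_all add: mult.assoc H2_X)
  from this[of "iota (fps_X ^ k) * f" j] f show ?thesis
    unfolding zpow_def mult.assoc H2_Ypow by simp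
qed

text \<open>Finite partial sums tend to those of c, so \<open>lsq c\<close> is at most L;
  conversely, damping only lowers the norm.\<close>

lemma lsq_dilation:
  assumes l2: "\<And>n. l2 (\<lambda>p. c p * of_real (r n ^ N p))" and r: "\<And>n::nat. 0 \<le> r n" "\<And>n. r n \<le> 1" "r \<longlonglongrightarrow> 1"
    and lim: "(\<lambda>n. lsq (\<lambda>p. c p * of_real (r n ^ N p))) \<longlonglongrightarrow> L"
  shows "lsq c = L"
proof -
  have "(\<Sum>p\<in>F. (cmod (c p))\<^sup>2) \<le> L" if F: "finite F" for F
  proof (rule LIMSEQ_le[OF _ lim])
    have "(\<lambda>n. \<Sum>p\<in>F. (cmod (c p * of_real (r n ^ N p)))\<^sup>2) \<longlonglongrightarrow> (\<Sum>p\<in>F. (cmod (c p * of_real (1 ^ N p)))\<^sup>2)"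
      by (intro tendsto_intros r(3))
    thus "(\<lambda>n. \<Sum>p\<in>F. (cmod (c p * of_real (r n ^ N p)))\<^sup>2) \<longlonglongrightarrow> (\<Sum>p\<in>F. (cmod (c p))\<^sup>2)" by simp
    show "\<exists>N'. \<forall>n\<ge>N'. (\<Sum>p\<in>F. (cmod (c p * of_real (r n ^ N p)))\<^sup>2) \<le> lsq (\<lambda>p. c p * of_real (r n ^ N p))"
      using finite_le_lsq[OF l2 F] by blast
  qed
  note * = l2_boundedI[OF this]
  moreover have "L \<le> lsq c"
  proof (rule LIMSEQ_le_const2[OF lim], intro exI allI impI)
    fix n
    show "lsq (\<lambda>p. c p * of_real (r n ^ N p)) \<le> lsq c"
    proof (rule l2_boundedI(2))
      fix F :: "'a set" assume F: "finite F"
      have "(\<Sum>p\<in>F. (cmod (c p * of_real (r n ^ N p)))\<^sup>2) \<le> (\<Sum>p\<in>F. (cmod (c p))\<^sup>2)"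
        using r by (intro sum_mono power_mono) (auto simp: norm_mult norm_power power_le_one mult_left_le)
      also have "\<dots> \<le> lsq c" by (rule finite_le_lsq[OF *(1) F])
      finally show "(\<Sum>p\<in>F. (cmod (c p * of_real (r n ^ N p)))\<^sup>2) \<le> lsq c" .
    qed
  qed
  ultimately show ?thesis by (simp add: antisym)
qed

lemma Fn_part:
  assumes "finite F" "z \<in> bidisk"
  shows "Fn (part F h) z = (\<Sum>p\<in>F. h $ fst p $ snd p * fst z ^ fst p * snd z ^ snd p)"
proof -
  have "Fn (part F h) z = (\<Sum>p\<in>F. Fn (sc (h $ fst p $ snd p) (zpow (fst p) (snd p))) z)"
    unfolding part_def by (subst Fn_sum[OF assms(1) H2_sc[OF H2_zpow]]) (rule sum_fun_apply)
  also have "\<dots> = (\<Sum>p\<in>F. h $ fst p $ snd p * fst z ^ fst p * snd z ^ snd p)"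
    unfolding Fn_sc[OF H2_zpow] Fn_zpow using assms(2) by (simp add: mult.assoc)
  finally show ?thesis .
qed

text \<open>The place where boundary values enter. For a polynomial g the product theta g is
  bounded, so its mean squares over the tori of radius r converge to the mean square of |g| on the
  torus, since |theta| has radial limit 1 almost everywhere. By Parseval they also converge to the
  norm of theta g.\<close>

lemma inner_nsq_part:
  fixes h :: fps2
  assumes \<Theta>: "\<Theta> \<in> H2" and inner: "inner_function (Fn \<Theta>)" and F: "finite F"
  defines "g \<equiv> part F h"
  shows "\<Theta> * g \<in> H2" "nsq (\<Theta> * g) = nsq g"
proof -
  have gH: "g \<in> H2" unfolding g_def by (rule part_H2)
  have "\<Theta> * g = (\<Sum>p\<in>F. sc (h $ fst p $ snd p) (zpow (fst p) (snd p) * \<Theta>))"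
    unfolding g_def part_def sum_distrib_left by (rule sum.cong) (auto simp: mult_ac)
  also have "\<dots> \<in> H2" by (intro H2_sum H2_sc H2_zpow_mult \<Theta>)
  finally show qH: "\<Theta> * g \<in> H2" .
  let ?q = "\<Theta> * g"
  have cfg: "cf g = trunc F (cf h)" unfolding g_def by (rule cf_part[OF F])
  have cfg': "g $ fst p $ snd p = (if p \<in> F then h $ fst p $ snd p else 0)" for p
    using fun_cong[OF cfg, of p] by (simp add: cf_def trunc_def case_prod_beta)
  have gsum: "(\<lambda>p. norm (g $ fst p $ snd p)) summable_on UNIV"
    by (rule finite_nonzero_values_imp_summable_on, rule finite_subset[OF _ F]) (auto simp: cfg')
  define G where "G = fourier (\<lambda>p. g $ fst p $ snd p)"
  have G_sum: "G (s, t) = (\<Sum>p\<in>F. h $ fst p $ snd p * cis s ^ fst p * cis t ^ snd p)" for s t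
  proof -
    have "((\<lambda>p. g $ fst p $ snd p * torus_exp p (s, t)) has_sum
        (\<Sum>p\<in>F. h $ fst p $ snd p * cis s ^ fst p * cis t ^ snd p)) UNIV"
      by (rule has_sum_finite_neutralI[OF F])
        (auto simp: cfg' torus_exp_def case_prod_beta Complex.DeMoivre mult.assoc)
    thus ?thesis unfolding G_def fourier_def by (rule infsumI)
  qed
  \<comment> \<open>Radii tending to 1 from below, as a sequence for the sake of dominated
    convergence.\<close>
  define r where "r n = 1 - inverse (real (Suc n))" for n
  have r0: "0 \<le> r n" and r1: "r n < 1" for n by (simp_all add: r_def field_simps)
  have "(\<lambda>n. 1 - inverse (real (Suc n))) \<longlonglongrightarrow> 1 - 0"
    by (intro tendsto_intros LIMSEQ_inverse_real_of_nat)
  hence rlim: "r \<longlonglongrightarrow> 1" unfolding r_def by simp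
  have r_left: "filterlim r (at_left 1) sequentially"
    unfolding filterlim_at using rlim r1 by (auto simp: order.strict_implies_not_eq intro!: always_eventually)
  define c where "c n = (\<lambda>p. ?q $ fst p $ snd p * of_real (r n ^ (fst p + snd p)))" for n
  note hs = Fn_has_sum[OF qH]
  have csum: "(\<lambda>p. norm (c n p)) summable_on UNIV" for n
    unfolding c_def by (rule dilation_abs_summable[OF hs r0 r1])
  have cF: "fourier (c n) (s, t) = Fn \<Theta> (of_real (r n) * cis s, of_real (r n) * cis t) *
      (\<Sum>p\<in>F. h $ fst p $ snd p * (of_real (r n) * cis s) ^ fst p * (of_real (r n) * cis t) ^ snd p)" for n s t
  proof -
    note z = torus_in_bidisk[OF r0 r1, of n s t]
    have "fourier (c n) (s, t) = Fn ?q (of_real (r n) * cis s, of_real (r n) * cis t)"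
      unfolding c_def by (rule dilation_fourier[OF hs r0 r1])
    also have "\<dots> = Fn \<Theta> (of_real (r n) * cis s, of_real (r n) * cis t) * Fn g (of_real (r n) * cis s, of_real (r n) * cis t)"
      unfolding Fn_mult[OF \<Theta> gH qH] ..
    finally show ?thesis unfolding g_def Fn_part[OF F z] by simp
  qed
  obtain M where M: "\<And>z. z \<in> bidisk \<Longrightarrow> cmod (Fn \<Theta> z) \<le> M"
    using inner unfolding inner_function_def bounded_iff by auto
  define B where "B = (\<Sum>p\<in>F. cmod (h $ fst p $ snd p))"
  have cb: "norm (fourier (c n) x) \<le> \<bar>M\<bar> * B" for n x
  proof (cases x)
    case (Pair s t)
    have "norm (\<Sum>p\<in>F. h $ fst p $ snd p * (of_real (r n) * cis s) ^ fst p * (of_real (r n) * cis t) ^ snd p) \<le> B"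
      unfolding B_def
    proof (rule order.trans[OF norm_sum], rule sum_mono)
      fix p
      have "r n ^ fst p * r n ^ snd p \<le> 1 * 1"
        using r0[of n] r1[of n] by (intro mult_mono power_le_one) auto
      hence "cmod (h $ fst p $ snd p) * (r n ^ fst p * r n ^ snd p) \<le> cmod (h $ fst p $ snd p) * 1"
        by (intro mult_left_mono) auto
      thus "norm (h $ fst p $ snd p * (of_real (r n) * cis s) ^ fst p * (of_real (r n) * cis t) ^ snd p) \<le> cmod (h $ fst p $ snd p)"
        using r0[of n] by (simp add: norm_mult norm_power mult.assoc)
    qed
    moreover have "cmod (Fn \<Theta> (of_real (r n) * cis s, of_real (r n) * cis t)) \<le> \<bar>M\<bar>"
      using M[OF torus_in_bidisk[OF r0 r1]] by (meson abs_ge_self order.trans)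
    ultimately show ?thesis unfolding Pair cF norm_mult by (intro mult_mono) auto
  qed
  have AE: "AE x in torus. (\<lambda>n. (norm (fourier (c n) x))\<^sup>2) \<longlonglongrightarrow> (norm (G x))\<^sup>2"
  proof -
    have "AE x in torus. \<exists>l. ((\<lambda>r. Fn \<Theta> (of_real r * cis (fst x), of_real r * cis (snd x))) \<longlongrightarrow> l) (at_left 1) \<and> cmod l = 1"
      using inner unfolding inner_function_def by (simp add: case_prod_beta)
    thus ?thesis
    proof (rule AE_mp, intro AE_I2 impI)
      fix x :: "real \<times> real"
      assume "\<exists>l. ((\<lambda>r. Fn \<Theta> (of_real r * cis (fst x), of_real r * cis (snd x))) \<longlongrightarrow> l) (at_left 1) \<and> cmod l = 1"
      then obtain l where l: "((\<lambda>r. Fn \<Theta> (of_real r * cis (fst x), of_real r * cis (snd x))) \<longlongrightarrow> l) (at_left 1)" "cmod l = 1"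
        by blast
      obtain s t where x: "x = (s, t)" by (cases x)
      have "(\<lambda>n. Fn \<Theta> (of_real (r n) * cis s, of_real (r n) * cis t)) \<longlonglongrightarrow> l"
        using filterlim_compose[OF l(1) r_left] by (simp add: x)
      moreover have "(\<lambda>n. \<Sum>p\<in>F. h $ fst p $ snd p * (of_real (r n) * cis s) ^ fst p * (of_real (r n) * cis t) ^ snd p) \<longlonglongrightarrow>
          (\<Sum>p\<in>F. h $ fst p $ snd p * (of_real 1 * cis s) ^ fst p * (of_real 1 * cis t) ^ snd p)"
        by (intro tendsto_intros rlim)
      ultimately have "(\<lambda>n. fourier (c n) x) \<longlonglongrightarrow> l * G x"
        unfolding x cF G_sum by (intro tendsto_mult) simp_all
      hence "(\<lambda>n. (norm (fourier (c n) x))\<^sup>2) \<longlonglongrightarrow> (norm (l * G x))\<^sup>2" by (intro tendsto_intros)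
      thus "(\<lambda>n. (norm (fourier (c n) x))\<^sup>2) \<longlonglongrightarrow> (norm (G x))\<^sup>2" by (simp add: norm_mult l(2))
    qed
  qed
  have "(\<lambda>n. LINT x|torus. (norm (fourier (c n) x))\<^sup>2) \<longlonglongrightarrow> (LINT x|torus. (norm (G x))\<^sup>2)"
  proof (rule integral_dominated_convergence[where w = "\<lambda>_. (\<bar>M\<bar> * B)\<^sup>2"])
    show "(\<lambda>x. (norm (G x))\<^sup>2) \<in> borel_measurable torus"
      unfolding G_def using fourier_measurable[OF gsum] by measurable
    show "(\<lambda>x. (norm (fourier (c n) x))\<^sup>2) \<in> borel_measurable torus" for n
      using fourier_measurable[OF csum] by measurable
    show "integrable torus (\<lambda>_. (\<bar>M\<bar> * B)\<^sup>2)"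
      by (rule finite_measure.integrable_const[OF torus_finite])
    show "AE x in torus. norm ((norm (fourier (c n) x))\<^sup>2) \<le> (\<bar>M\<bar> * B)\<^sup>2" for n
      using cb[of n] by (auto intro!: AE_I2 power_mono)
  qed (rule AE)
  hence "(\<lambda>n. (2 * pi)\<^sup>2 * lsq (c n)) \<longlonglongrightarrow> (2 * pi)\<^sup>2 * lsq (\<lambda>p. g $ fst p $ snd p)"
    unfolding G_def parseval(1)[OF csum] parseval(1)[OF gsum] .
  from tendsto_mult_left[OF this, of "inverse ((2 * pi)\<^sup>2)"]
  have lim: "(\<lambda>n. lsq (c n)) \<longlonglongrightarrow> lsq (\<lambda>p. g $ fst p $ snd p)"
    by (simp add: mult.assoc[symmetric])
  have "lsq (\<lambda>p. ?q $ fst p $ snd p) = lsq (\<lambda>p. g $ fst p $ snd p)"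
    by (rule lsq_dilation[where r = r and N = "\<lambda>p. fst p + snd p"])
      (use lim parseval(2)[OF csum] rlim r0 r1 in \<open>auto simp: c_def less_imp_le\<close>)
  thus "nsq ?q = nsq g" by (simp only: nsq_def cf_def case_prod_unfold)
qed

lemma nsq_tendsto:
  assumes "\<And>n. u n \<in> H2" "a \<in> H2" "(\<lambda>n. nsq (u n - a)) \<longlonglongrightarrow> 0"
  shows "(\<lambda>n. nsq (u n)) \<longlonglongrightarrow> nsq a"
proof -
  have lim: "(\<lambda>n. Re (ip (u n) a)) \<longlonglongrightarrow> Re (ip a a)" by (intro tendsto_Re ip_tendsto assms)
  hence "(\<lambda>n. nsq (u n - a) - nsq a + 2 * Re (ip (u n) a)) \<longlonglongrightarrow> 0 - nsq a + 2 * Re (ip a a)"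
    by (intro tendsto_add tendsto_diff tendsto_mult tendsto_const assms lim)
  moreover have "nsq (u n - a) - nsq a + 2 * Re (ip (u n) a) = nsq (u n)" for n
    using nsq_diff[OF assms(1,2)] by simp
  ultimately show ?thesis by (simp add: ip_self)
qed

text \<open>Polynomials are dense, but continuity of the multiplication is not yet known: Fatou on
  the coefficients first shows that it is a contraction.\<close>

lemma inner_isometric:
  assumes \<Theta>: "\<Theta> \<in> H2" and inner: "inner_function (Fn \<Theta>)"
  shows "isometric_multiplier \<Theta>"
proof -
  note fin = inner_nsq_part[OF \<Theta> inner]
  have *: "\<Theta> * h \<in> H2" "nsq (\<Theta> * h) \<le> nsq h" if h: "h \<in> H2" for h
  proof -
    obtain F where F: "\<And>n. finite (F n)" and lim: "(\<lambda>n. nsq (part (F n) h - h)) \<longlonglongrightarrow> 0"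
      using H2_approx[OF h] by blast
    have le: "nsq (part (F n) h) \<le> nsq h" for n
      using h by (simp add: nsq_def H2_def cf_part lsq_trunc F finite_le_lsq)
    have 1: "\<Theta> * part (F n) h \<in> H2" "nsq (\<Theta> * part (F n) h) \<le> nsq h" for n
      using fin[OF F[of n], where h = h] le[of n] by auto
    have 2: "(\<lambda>n. (\<Theta> * part (F n) h) $ j $ k) \<longlonglongrightarrow> (\<Theta> * h) $ j $ k" for j k
    proof -
      have "(\<lambda>n. part (F n) h $ j $ k) \<longlonglongrightarrow> h $ j $ k" for j k
        using ip_tendsto[OF part_H2 h H2_zpow lim, of j k] by (simp add: ip_zpow)
      thus ?thesis by (auto simp: fps_mult_nth fps_sum_nth intro!: tendsto_intros)
    qed
    show "\<Theta> * h \<in> H2" "nsq (\<Theta> * h) \<le> nsq h"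
      using H2_Fatou[OF 1 2] by auto
  qed
  \<comment> \<open>By contractivity the products converge in norm, so equality of norms passes from
    the polynomials to h.\<close>
  have iso: "nsq (\<Theta> * h) = nsq h" if h: "h \<in> H2" for h
  proof -
    obtain F where F: "\<And>n. finite (F n)" and lim: "(\<lambda>n. nsq (part (F n) h - h)) \<longlonglongrightarrow> 0"
      using H2_approx[OF h] by blast
    have lim': "(\<lambda>n. nsq (\<Theta> * part (F n) h - \<Theta> * h)) \<longlonglongrightarrow> 0"
    proof (rule tendsto_sandwich[OF _ _ tendsto_const lim])
      show "\<forall>\<^sub>F n in sequentially. nsq (\<Theta> * part (F n) h - \<Theta> * h) \<le> nsq (part (F n) h - h)"
        unfolding right_diff_distrib[symmetric] by (intro always_eventually allI *(2) H2_diff part_H2 h)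
    qed (simp add: nsq_ge0)
    have "(\<lambda>n. nsq (\<Theta> * part (F n) h)) \<longlonglongrightarrow> nsq (\<Theta> * h)"
      by (rule nsq_tendsto[OF *(1)[OF part_H2] *(1)[OF h] lim'])
    moreover have "(\<lambda>n. nsq (\<Theta> * part (F n) h)) \<longlonglongrightarrow> nsq h"
      using nsq_tendsto[OF part_H2 h lim] fin(2)[OF F, where h = h] by simp
    ultimately show ?thesis by (rule LIMSEQ_unique)
  qed
  \<comment> \<open>Polarisation; the imaginary parts follow below by replacing f with i f.\<close>
  have Re_eq: "Re (ip (\<Theta> * f) (\<Theta> * g)) = Re (ip f g)" if "f \<in> H2" "g \<in> H2" for f g
    using nsq_add[OF that] nsq_add[OF *(1)[OF that(1)] *(1)[OF that(2)]] iso[OF H2_add[OF that]]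
      iso[OF that(1)] iso[OF that(2)] by (simp add: distrib_left)
  show ?thesis
  proof
    fix f assume f: "f \<in> H2"
    show "\<Theta> * f \<in> H2" by (rule *(1)[OF f])
    fix g assume g: "g \<in> H2"
    have "Re (ip (\<Theta> * sc \<i> f) (\<Theta> * g)) = Re (ip (sc \<i> f) g)" by (rule Re_eq[OF H2_sc[OF f] g])
    hence "Re (ip (sc \<i> (\<Theta> * f)) (\<Theta> * g)) = Re (ip (sc \<i> f) g)" by (simp only: mult.left_commute)
    hence "Im (ip (\<Theta> * f) (\<Theta> * g)) = Im (ip f g)" unfolding ip_sc_left by simp
    thus "ip (\<Theta> * f) (\<Theta> * g) = ip f g" using Re_eq[OF f g] by (simp add: complex_eq_iff)
  qed
qed

section \<open>The main theorem\<close>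

lemma poly_eq_0_if_locally_0:
  fixes p :: "complex poly"
  assumes "\<forall>\<^sub>F z in nhds b. poly p z = 0"
  shows "p = 0"
proof (rule ccontr)
  assume "p \<noteq> 0"
  hence fin: "finite {z. poly p z = 0}" by (rule poly_roots_finite)
  obtain S where S: "open S" "b \<in> S" "\<forall>z\<in>S. poly p z = 0"
    using assms unfolding eventually_nhds by blast
  hence "finite S" using finite_subset[OF _ fin] by blast
  thus False using S finite_imp_not_open[of S] by blast
qed

text \<open>A zero of the reduced denominator would have to be a zero of the numerator, too. Since zero
  sets in two variables have no isolated points, this is impossible for coprime polynomials.\<close>

lemma reduced_denominator_nonzero:
  assumes cop: "coprime (comb v x) (comb w y)"
    and eq: "\<And>z. z \<in> bidisk \<Longrightarrow> t z * poly2 (comb w y) z = poly2 (comb v x) z"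
    and z: "cmod a < 1" "cmod b < 1"
  shows "poly w b + a * poly y b \<noteq> 0"
proof
  assume 0: "poly w b + a * poly y b = 0"
  have num: "poly v c + z1 * poly x c = 0" if "poly w c + z1 * poly y c = 0" "cmod z1 < 1" "cmod c < 1" for z1 c
    using eq[of "(z1, c)"] that by (simp add: poly2_comb bidisk_iff)
  show False
  proof (cases "poly y b = 0")
    case True
    hence wb: "poly w b = 0" using 0 by simp
    \<comment> \<open>The denominator vanishes on the whole disk z2 = b, hence so does the
      numerator.\<close>
    have "poly v b + z1 * poly x b = 0" if "cmod z1 < 1" for z1
      by (rule num[OF _ that z(2)]) (simp add: True wb)
    from this[of 0] this[of "1/2"] have vb: "poly v b = 0" "poly x b = 0" by simp_all
    show False by (rule coprime_comb_no_common_root[OF cop vb wb True])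
  next
    case False
    \<comment> \<open>Near b the zero set of the denominator contains the graph z1 = f(z2), on which
      the numerator vanishes as well.\<close>
    define f where "f = (\<lambda>c. - poly w c / poly y c)"
    have "- poly w b = a * poly y b" using 0 by (simp add: neg_eq_iff_add_eq_0)
    hence fb: "f b = a" unfolding f_def using False by (simp only: nonzero_mult_div_cancel_right not_False_eq_True)
    have cont: "isCont f b" unfolding f_def using False by (intro continuous_intros) auto
    have "\<forall>\<^sub>F c in nhds b. cmod (f c) < 1"
      using tendsto_norm[OF cont[unfolded isCont_def tendsto_at_iff_tendsto_nhds]]
      by (rule order_tendstoD) (use z fb in simp)
    moreover have "\<forall>\<^sub>F c in nhds b. poly y c \<noteq> 0"
      using tendsto_imp_eventually_ne[OF poly_isCont[of b y, unfolded isCont_def tendsto_at_iff_tendsto_nhds]] False by blast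
    moreover have "\<forall>\<^sub>F c in nhds b. cmod c < 1"
      by (rule order_tendstoD[OF tendsto_norm[OF filterlim_ident]]) (rule z(2))
    ultimately have "\<forall>\<^sub>F c in nhds b. poly (y * v - x * w) c = 0"
    proof eventually_elim
      case (elim c)
      have "poly w c + f c * poly y c = 0" using elim(2) by (simp add: f_def)
      hence "poly v c + f c * poly x c = 0" by (rule num[OF _ elim(1,3)])
      thus ?case using elim(2) by (simp add: f_def field_simps)
    qed
    hence "y * v - x * w = 0" by (rule poly_eq_0_if_locally_0)
    hence "y = 0" using coprime_comb_proportional[OF cop] by simp
    thus False using False by simp
  qed
qed

lemma degree_comb: "degree (comb v x) = max (degree v) (degree x)"
proof (rule antisym)
  show "degree (comb v x) \<le> max (degree v) (degree x)" unfolding degree_comb_le by simp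
  show "max (degree v) (degree x) \<le> degree (comb v x)"
    using degree_comb_le[of v x "degree (comb v x)"] by simp
qed

section \<open>Reduction to lowest terms\<close>

context isometric_multiplier
begin

lemma moebius_iff_emb: "moebius (fps_of_poly v) (fps_of_poly x) (fps_of_poly w) (fps_of_poly y) \<longleftrightarrow>
    \<theta> * emb (comb w y) = emb (comb v x)"
  unfolding moebius_def emb_comb using fps_of_poly_H1 by simp

lemma moebius_iff_pointwise:
  assumes \<theta>: "\<theta> \<in> H2"
  shows "moebius (fps_of_poly v) (fps_of_poly x) (fps_of_poly w) (fps_of_poly y) \<longleftrightarrow>
    (\<forall>z\<in>bidisk. Fn \<theta> z * poly2 (comb w y) z = poly2 (comb v x) z)"
proof -
  note H = emb_comb_H2 mult_H2[OF emb_comb_H2]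
  have 1: "Fn (\<theta> * emb (comb w y)) z = Fn \<theta> z * poly2 (comb w y) z" if "z \<in> bidisk" for z
    using Fn_mult[OF \<theta> H(1) H(2)] Fn_emb_comb[OF that] by simp
  show ?thesis unfolding moebius_iff_emb
  proof
    assume "\<theta> * emb (comb w y) = emb (comb v x)"
    thus "\<forall>z\<in>bidisk. Fn \<theta> z * poly2 (comb w y) z = poly2 (comb v x) z"
      using 1 Fn_emb_comb by metis
  next
    assume *: "\<forall>z\<in>bidisk. Fn \<theta> z * poly2 (comb w y) z = poly2 (comb v x) z"
    have "Fn (\<theta> * emb (comb w y)) = Fn (emb (comb v x))"
    proof
      fix z
      show "Fn (\<theta> * emb (comb w y)) z = Fn (emb (comb v x)) z"
        using 1[of z] Fn_emb_comb[of z v x] * by (cases "z \<in> bidisk") (simp_all add: Fn_def)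
    qed
    thus "\<theta> * emb (comb w y) = emb (comb v x)" by (rule Fn_inj[OF H(2) H(1)])
  qed
qed

text \<open>Cancel the gcd in two variables. Since z1-degrees add, the quotients still have
  z1-degree at most 1, so they are again of the form \<open>comb\<close>.\<close>

lemma rank_le_imp_coprime_form:
  assumes "rank_le n"
  obtains v x w y where "coprime (comb v x) (comb w y)"
    "moebius (fps_of_poly v) (fps_of_poly x) (fps_of_poly w) (fps_of_poly y)"
proof -
  obtain m a b c d where deg: "degle m a" "degle m b" "degle m c" "degle m d"
    and nz: "c \<noteq> 0 \<or> d \<noteq> 0" and t: "moebius a b c d"
    by (rule rank_le_imp_rational[OF assms])
  obtain a' where a': "fps_of_poly a' = a" using degle_poly_exists[OF deg(1)] by blast
  obtain b' where b': "fps_of_poly b' = b" using degle_poly_exists[OF deg(2)] by blast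
  obtain c' where c': "fps_of_poly c' = c" using degle_poly_exists[OF deg(3)] by blast
  obtain d' where d': "fps_of_poly d' = d" using degle_poly_exists[OF deg(4)] by blast
  let ?P = "comb a' b'" and ?Q = "comb c' d'"
  have eq: "\<theta> * emb ?Q = emb ?P" using t unfolding a'[symmetric] b'[symmetric] c'[symmetric] d'[symmetric] moebius_iff_emb .
  have Q0: "?Q \<noteq> 0" using nz c' d' by (auto simp: comb_eq_0_iff)
  hence g0: "gcd ?P ?Q \<noteq> 0" by simp
  obtain P Q where PQ: "?P = P * gcd ?P ?Q" "?Q = Q * gcd ?P ?Q" "coprime P Q"
    using gcd_coprime_exists[OF g0] by blast
  define g where "g = gcd ?P ?Q"
  have P: "?P = P * g" and Q: "?Q = Q * g" using PQ unfolding g_def by auto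
  have gn: "g \<noteq> 0" using g0 unfolding g_def .
  have "(\<theta> * emb Q) * emb g = emb P * emb g"
    using eq unfolding P Q emb_mult by (simp only: mult.assoc)
  moreover have "emb g \<noteq> 0" using gn emb_eq_0_iff by simp
  ultimately have eq': "\<theta> * emb Q = emb P" by simp
  have le: "degree_z1 R \<le> 1" if "comb p q = R * g" for R p q
  proof (cases "R = 0")
    case True
    thus ?thesis using degree_z1_comb[of 0 0] by (simp add: comb_zero)
  next
    case False
    have "degree_z1 R \<le> degree_z1 (R * g)" using degree_z1_mult[OF False gn] by simp
    also have "\<dots> \<le> 1" unfolding that[symmetric] by (simp add: degree_z1_comb)
    finally show ?thesis .
  qed
  obtain v x where vx: "P = comb v x" by (rule comb_exists[OF le[OF P]])
  obtain w y where wy: "Q = comb w y" by (rule comb_exists[OF le[OF Q]])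
  show ?thesis
    using PQ(3) eq' unfolding vx wy moebius_iff_emb[symmetric] by (rule that)
qed

section \<open>The operators of the statement in terms of power series\<close>

lemma model_space_Fn:
  assumes \<theta>: "\<theta> \<in> H2"
  shows "model_space (Fn \<theta>) = Fn ` K"
proof -
  have "hardy_inner (Fn f) (\<lambda>z. Fn \<theta> z * Fn g z) = ip f (\<theta> * g)" if "f \<in> H2" "g \<in> H2" for f g
    unfolding Fn_mult[OF \<theta> that(2) mult_H2[OF that(2)], symmetric]
    by (rule hardy_inner_Fn) (use that mult_H2 in auto)
  thus ?thesis unfolding model_space_def K_def hardy_eq by auto
qed

text \<open>Two candidates differ by an element of the model space orthogonal to itself.\<close>

lemma hardy_proj_Fn:
  assumes f: "f \<in> H2"
  shows "hardy_proj (Fn ` K) (Fn f) = Fn (proj f)"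
  unfolding hardy_proj_def
proof (rule the_equality)
  have inner: "hardy_inner (Fn f - Fn h) (Fn g) = ip (f - h) g" if "h \<in> K" "g \<in> K" for h g
    unfolding Fn_diff[OF f K_H2[OF that(1)], symmetric]
    by (rule hardy_inner_Fn) (use f that in \<open>auto intro: H2_diff K_H2\<close>)
  show "Fn (proj f) \<in> Fn ` K \<and> (\<forall>g\<in>Fn ` K. hardy_inner (Fn f - Fn (proj f)) g = 0)"
    using inner proj_perp[OF f] proj_K[OF f] by auto
  fix h assume "h \<in> Fn ` K \<and> (\<forall>g\<in>Fn ` K. hardy_inner (Fn f - h) g = 0)"
  then obtain h' where h': "h = Fn h'" "h' \<in> K" "\<And>g. g \<in> K \<Longrightarrow> ip (f - h') g = 0"
    using inner by auto
  let ?d = "proj f - h'"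
  have dK: "?d \<in> K" by (rule K_diff[OF proj_K[OF f] h'(2)])
  have "ip ((f - h') - (f - proj f)) ?d = 0"
    using ip_diff_left[OF H2_diff[OF f K_H2[OF h'(2)]] H2_diff[OF f K_H2[OF proj_K[OF f]]] K_H2[OF dK]]
      h'(3)[OF dK] proj_perp[OF f dK] by simp
  hence "ip ?d ?d = 0" by simp
  hence "?d = 0" using dK by (intro ip_self_eq0D) (auto simp: K_H2)
  thus "h = Fn (proj f)" using h'(1) by simp
qed

lemma compressed_shift_Fn:
  assumes \<theta>: "\<theta> \<in> H2" and f: "f \<in> H2"
  shows "compressed_shift_z1 (Fn \<theta>) (Fn f) = Fn (proj (fps_X * f))"
  unfolding compressed_shift_z1_def model_space_Fn[OF \<theta>] Fn_X[OF f, symmetric]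
  by (rule hardy_proj_Fn) (simp add: H2_X f)

text \<open>For g in the model space the projection drops out of <P z1 f, g>, and the backward shift
  leaves the model space invariant.\<close>

lemma hardy_adjoint_Fn:
  assumes \<theta>: "\<theta> \<in> H2" and g: "g \<in> K"
  shows "hardy_adjoint (Fn ` K) (compressed_shift_z1 (Fn \<theta>)) (Fn g) = Fn (fps_shift 1 g)"
  unfolding hardy_adjoint_def
proof (rule the_equality)
  have lhs: "hardy_inner (compressed_shift_z1 (Fn \<theta>) (Fn f)) (Fn g) = ip f (fps_shift 1 g)" if f: "f \<in> K" for f
  proof -
    have XH: "fps_X * f \<in> H2" using f by (simp add: H2_X K_H2)
    have "hardy_inner (compressed_shift_z1 (Fn \<theta>) (Fn f)) (Fn g) = ip (proj (fps_X * f)) g"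
      unfolding compressed_shift_Fn[OF \<theta> K_H2[OF f]]
      by (rule hardy_inner_Fn) (auto intro!: K_H2 proj_K XH g)
    also have "\<dots> = ip (fps_X * f) g"
      using proj_perp[OF XH g] ip_diff_left[OF XH K_H2[OF proj_K[OF XH]] K_H2[OF g]] by simp
    finally show ?thesis by (simp only: ip_X_left)
  qed
  have sK: "fps_shift 1 g \<in> K" by (rule K_shift[OF g])
  show "Fn (fps_shift 1 g) \<in> Fn ` K \<and>
      (\<forall>f\<in>Fn ` K. hardy_inner (compressed_shift_z1 (Fn \<theta>) f) (Fn g) = hardy_inner f (Fn (fps_shift 1 g)))"
  proof (intro conjI ballI)
    fix f assume "f \<in> Fn ` K"
    then obtain f' where f': "f = Fn f'" "f' \<in> K" by blast
    show "hardy_inner (compressed_shift_z1 (Fn \<theta>) f) (Fn g) = hardy_inner f (Fn (fps_shift 1 g))"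
      unfolding f'(1) lhs[OF f'(2)] by (rule hardy_inner_Fn[symmetric]) (intro K_H2 f'(2) sK)+
  qed (use sK in blast)
  fix h assume h: "h \<in> Fn ` K \<and>
      (\<forall>f\<in>Fn ` K. hardy_inner (compressed_shift_z1 (Fn \<theta>) f) (Fn g) = hardy_inner f h)"
  then obtain h' where h': "h = Fn h'" "h' \<in> K" by blast
  have eq: "ip f (fps_shift 1 g) = ip f h'" if f: "f \<in> K" for f
    using h lhs[OF f] f h' hardy_inner_Fn[OF K_H2[OF f] K_H2[OF h'(2)]] by auto
  let ?d = "fps_shift 1 g - h'"
  have dK: "?d \<in> K" by (rule K_diff[OF sK h'(2)])
  have "ip ?d ?d = 0"
    using eq[OF dK] ip_diff_right[OF K_H2[OF sK] K_H2[OF h'(2)] K_H2[OF dK]] by simp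
  hence "?d = 0" using dK by (intro ip_self_eq0D) (auto simp: K_H2)
  thus "h = Fn (fps_shift 1 g)" using h'(1) by simp
qed

lemma commutator_Fn:
  assumes \<theta>: "\<theta> \<in> H2" and f: "f \<in> K"
  shows "commutator (hardy_adjoint (model_space (Fn \<theta>)) (compressed_shift_z1 (Fn \<theta>)))
    (compressed_shift_z1 (Fn \<theta>)) (Fn f) = Fn (Cop f)"
proof -
  have XH: "fps_X * f \<in> H2" using f by (simp add: H2_X K_H2)
  have SH: "fps_shift 1 f \<in> H2" using f by (simp only: K_H2 K_shift)
  have XSH: "fps_X * fps_shift 1 f \<in> H2" using SH by (simp add: H2_X)
  have "Fn (fps_shift 1 (proj (fps_X * f))) - Fn (proj (fps_X * fps_shift 1 f)) = Fn (Cop f)"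
    unfolding commutator_formula[OF f, symmetric]
    by (rule Fn_diff[symmetric, OF K_H2[OF K_shift[OF proj_K[OF XH]]] K_H2[OF proj_K[OF XSH]]])
  thus ?thesis
    unfolding commutator_def model_space_Fn[OF \<theta>] compressed_shift_Fn[OF \<theta> K_H2[OF f]]
      hardy_adjoint_Fn[OF \<theta> proj_K[OF XH]] hardy_adjoint_Fn[OF \<theta> f] compressed_shift_Fn[OF \<theta> SH] .
qed

section \<open>Rank as the size of a basis of the range\<close>

lemma Cop_H2: "f \<in> K \<Longrightarrow> Cop f \<in> H2"
  unfolding Cop_def Aop_def by (intro H2_diff K_H2 Bop_K psi_H2 H1_nth ws_H1)

definition range_C :: "(complex \<times> complex \<Rightarrow> complex) set" where
  "range_C = (\<lambda>f. Fn (Cop f)) ` K"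

lemma Fn_Cop_sum:
  assumes "\<And>i. i \<in> F \<Longrightarrow> g i \<in> K" "finite F"
  shows "Fn (Cop (\<Sum>i\<in>F. sc (c i) (g i))) = (\<lambda>z. \<Sum>i\<in>F. c i * Fn (Cop (g i)) z)"
proof -
  have "Fn (Cop (\<Sum>i\<in>F. sc (c i) (g i))) = (\<Sum>i\<in>F. Fn (sc (c i) (Cop (g i))))"
  proof -
    have "Cop (\<Sum>i\<in>F. sc (c i) (g i)) = (\<Sum>i\<in>F. sc (c i) (Cop (g i)))"
      by (rule Cop_sum) (rule assms(1))
    thus ?thesis using Fn_sum[OF assms(2) H2_sc[OF Cop_H2[OF assms(1)]]] by (simp only:)
  qed
  thus ?thesis using assms(1) by (auto simp: fun_eq_iff sum_fun_apply Fn_sc Cop_H2)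
qed

lemma rank_le_if_spanned:
  assumes "finite B" "card B \<le> n" "range_C \<subseteq> cfun.span B"
  shows "rank_le n"
  unfolding rank_le_def
proof (intro allI impI)
  fix g assume "\<forall>i\<le>n. g i \<in> K"
  hence gK: "g i \<in> K" if "i \<le> n" for i using that by blast
  have span: "Fn (Cop (g i)) \<in> cfun.span B" if "i \<le> n" for i
    using assms(3) gK[OF that] by (auto simp: range_C_def)
  obtain c where c: "\<exists>i\<le>n. c i \<noteq> 0" "\<And>a. (\<Sum>i\<le>n. c i * Fn (Cop (g i)) a) = 0"
    using span_dependent[OF assms(1,2), of "\<lambda>i. Fn (Cop (g i))"] span by blast
  have "Fn (Cop (\<Sum>i\<le>n. sc (c i) (g i))) = Fn 0"
    unfolding Fn_zero by (subst Fn_Cop_sum) (auto simp: gK c(2) fun_eq_iff)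
  hence "Cop (\<Sum>i\<le>n. sc (c i) (g i)) = 0"
    by (intro Fn_inj Cop_H2 H2_zero K_sum K_sc gK) auto
  thus "\<exists>c. (\<exists>i\<le>n. c i \<noteq> 0) \<and> Cop (\<Sum>i\<le>n. sc (c i) (g i)) = 0" using c(1) by blast
qed

lemma range_C_subspace: "cfun.subspace range_C"
proof -
  have 0: "0 \<in> range_C" unfolding range_C_def
    by (rule image_eqI[OF _ K_zero]) (simp add: Cop_zero Fn_zero)
  have add: "a + b \<in> range_C" if ab: "a \<in> range_C" "b \<in> range_C" for a b
  proof -
    obtain f g where fg: "f \<in> K" "g \<in> K" "a = Fn (Cop f)" "b = Fn (Cop g)"
      using ab by (auto simp: range_C_def)
    show ?thesis unfolding range_C_def
      by (rule image_eqI[OF _ K_add[OF fg(1,2)]]) (simp add: fg Cop_add Fn_add Cop_H2)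
  qed
  have scale: "(\<lambda>x. c * a x) \<in> range_C" if a: "a \<in> range_C" for a c
  proof -
    obtain f where f: "f \<in> K" "a = Fn (Cop f)" using a by (auto simp: range_C_def)
    have "(\<lambda>x. c * a x) = Fn (Cop (sc c f))" unfolding f(2) Cop_sc[OF f(1)] Fn_sc[OF Cop_H2[OF f(1)]] ..
    thus ?thesis unfolding range_C_def using K_sc[OF f(1)] by blast
  qed
  show ?thesis by (rule cfun.subspaceI) (use 0 add scale in auto)
qed

text \<open>Given m + 1 independent vectors of the range, some nontrivial combination of their
  preimages lies in the kernel of C, contradicting independence.\<close>

lemma independent_card_le:
  assumes rank_le: "rank_le m" and T: "T \<subseteq> range_C" "cfun.independent T"
  shows "finite T \<and> card T \<le> m"
proof (rule ccontr)
  assume "\<not> ?thesis"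
  hence "infinite T \<or> Suc m \<le> card T" by auto
  hence "\<exists>T'. T' \<subseteq> T \<and> card T' = Suc m \<and> finite T'"
  proof
    assume "infinite T"
    thus ?thesis using infinite_arbitrarily_large[of T "Suc m"] by blast
  next
    assume "Suc m \<le> card T"
    thus ?thesis using obtain_subset_with_card_n[of "Suc m" T] by blast
  qed
  then obtain T' where T': "T' \<subseteq> T" "card T' = Suc m" "finite T'" by blast
  obtain b where b: "bij_betw b {..m} T'"
    using finite_same_card_bij[of "{..m}" T'] T' by auto
  have "b i \<in> range_C" if "i \<le> m" for i using that b T'(1) T(1) by (auto simp: bij_betw_def)
  hence "\<forall>i. \<exists>g. i \<le> m \<longrightarrow> g \<in> K \<and> b i = Fn (Cop g)" unfolding range_C_def by blast
  from choice[OF this] obtain g where g: "\<And>i. i \<le> m \<Longrightarrow> g i \<in> K" "\<And>i. i \<le> m \<Longrightarrow> b i = Fn (Cop (g i))" by blast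
  obtain c where c: "\<exists>i\<le>m. c i \<noteq> 0" "Cop (\<Sum>i\<le>m. sc (c i) (g i)) = 0"
    using rank_le[unfolded rank_le_def, rule_format, of g] g(1) by blast
  have sum0: "(\<lambda>z. \<Sum>i\<le>m. c i * b i z) = 0"
  proof -
    have "(\<lambda>z. \<Sum>i\<le>m. c i * b i z) = (\<lambda>z. \<Sum>i\<le>m. c i * Fn (Cop (g i)) z)" using g(2) by simp
    also have "\<dots> = Fn (Cop (\<Sum>i\<le>m. sc (c i) (g i)))"
      by (rule Fn_Cop_sum[symmetric]) (use g(1) in auto)
    finally show ?thesis unfolding c(2) Fn_zero .
  qed
  have "(\<Sum>i\<le>m. c i * b i z) = 0" for z using fun_cong[OF sum0, of z] by simp
  hence s0: "(\<Sum>i\<le>m. (\<lambda>z. c i * b i z)) = 0" by (intro ext) (simp add: sum_fun_apply)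
  let ?u = "\<lambda>v. c (inv_into {..m} b v)"
  have inj: "inj_on b {..m}" and im: "b ` {..m} = T'" using b by (auto simp: bij_betw_def)
  have "(\<Sum>v\<in>T'. (\<lambda>x. ?u v * v x)) = 0"
    unfolding im[symmetric] sum.reindex[OF inj] o_def s0[symmetric]
    by (rule sum.cong) (auto simp: inv_into_f_f[OF inj])
  moreover have "\<exists>v\<in>T'. ?u v \<noteq> 0"
  proof -
    obtain i where "i \<le> m" "c i \<noteq> 0" using c(1) by blast
    thus ?thesis unfolding im[symmetric] by (intro bexI[of _ "b i"]) (auto simp: inv_into_f_f[OF inj])
  qed
  ultimately have "\<exists>t u. finite t \<and> t \<subseteq> T \<and> (\<Sum>v\<in>t. (\<lambda>x. u v * v x)) = 0 \<and> (\<exists>v\<in>t. u v \<noteq> 0)"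
    by (intro exI[of _ T'] exI[of _ ?u] conjI T'(1,3))
  hence "cfun.dependent T" unfolding cfun.dependent_explicit .
  thus False using T(2) by simp
qed

text \<open>A basis spans, so its size is at least m by minimality, and it is independent, so its
  size is at most m. A maximal independent subset of the range shows that a basis exists.\<close>

lemma has_basis_iff:
  assumes m: "rank_le m" "\<And>k. rank_le k \<Longrightarrow> m \<le> k"
  shows "(\<exists>B. finite B \<and> card B = n \<and> cfun.independent B \<and> cfun.span B = range_C) \<longleftrightarrow> n = m"
proof
  assume "\<exists>B. finite B \<and> card B = n \<and> cfun.independent B \<and> cfun.span B = range_C"
  then obtain B where B: "finite B" "card B = n" "cfun.independent B" "cfun.span B = range_C" by blast
  have "rank_le n" by (rule rank_le_if_spanned[OF B(1)]) (use B in auto)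
  hence "m \<le> n" by (rule m(2))
  moreover have "n \<le> m"
    using independent_card_le[OF m(1) _ B(3)] cfun.span_superset[of B] B(2,4) by auto
  ultimately show "n = m" by simp
next
  assume n: "n = m"
  obtain B where B: "B \<subseteq> range_C" "cfun.independent B" "range_C \<subseteq> cfun.span B"
    using cfun.maximal_independent_subset[of range_C] by blast
  have card: "finite B" "card B \<le> m" using independent_card_le[OF m(1) B(1,2)] by auto
  have "rank_le (card B)" by (rule rank_le_if_spanned[OF card(1) order_refl B(3)])
  hence "card B = m" using m(2) card(2) by force
  moreover have "cfun.span B = range_C"
    using B(3) cfun.span_minimal[OF B(1) range_C_subspace] by blast
  ultimately show "\<exists>B. finite B \<and> card B = n \<and> cfun.independent B \<and> cfun.span B = range_C"
    using card(1) B(2) n by blast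
qed

lemma has_rank_iff:
  assumes "\<theta> \<in> H2"
  shows "has_rank_on (commutator (hardy_adjoint (model_space (Fn \<theta>)) (compressed_shift_z1 (Fn \<theta>)))
      (compressed_shift_z1 (Fn \<theta>))) (model_space (Fn \<theta>)) n \<longleftrightarrow>
    (\<exists>B. finite B \<and> card B = n \<and> cfun.independent B \<and> cfun.span B = range_C)"
proof -
  have "commutator (hardy_adjoint (model_space (Fn \<theta>)) (compressed_shift_z1 (Fn \<theta>)))
      (compressed_shift_z1 (Fn \<theta>)) ` Fn ` K = range_C"
    unfolding range_C_def image_image using commutator_Fn[OF assms] by auto
  thus ?thesis unfolding has_rank_on_def model_space_Fn[OF assms] by simp
qed

end

theorem theorem1p1:
  fixes \<theta> :: "complex \<times> complex \<Rightarrow> complex" and n :: nat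
  assumes "\<theta> \<in> hardy" and "inner_function \<theta>"
  shows "has_rank_on
           (commutator (hardy_adjoint (model_space \<theta>) (compressed_shift_z1 \<theta>))
                       (compressed_shift_z1 \<theta>))
           (model_space \<theta>) n
         \<longleftrightarrow> rational_inner_of_degree \<theta> (1, n) \<or> rational_inner_of_degree \<theta> (0, n)"
proof -
  obtain \<Theta> where \<Theta>: "\<Theta> \<in> H2" "\<theta> = Fn \<Theta>" using assms(1) unfolding hardy_eq by blast
  interpret isometric_multiplier \<Theta>
    by (rule inner_isometric[OF \<Theta>(1)]) (use assms(2) \<Theta>(2) in simp)
  show ?thesis (is "?R \<longleftrightarrow> ?D")
  proof
    assume ?R
    then obtain B where B: "finite B" "card B = n" "cfun.independent B" "cfun.span B = range_C"
      unfolding \<Theta>(2) has_rank_iff[OF \<Theta>(1)] by blast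
    have "rank_le n" by (rule rank_le_if_spanned[OF B(1)]) (use B in auto)
    then obtain v x w y where cop: "coprime (comb v x) (comb w y)"
      and t: "moebius (fps_of_poly v) (fps_of_poly x) (fps_of_poly w) (fps_of_poly y)"
      by (rule rank_le_imp_coprime_form)
    have eq: "Fn \<Theta> z * poly2 (comb w y) z = poly2 (comb v x) z" if "z \<in> bidisk" for z
      using t that unfolding moebius_iff_pointwise[OF \<Theta>(1)] by blast
    note nz = reduced_denominator_nonzero[OF cop eq]
    define m where "m = max (max (degree v) (degree x)) (max (degree w) (degree y))"
    have n: "n = m"
      using has_basis_iff[OF rank_le_iff_degree[OF cop nz t m_def], of n] B by blast
    have "\<forall>z\<in>bidisk. poly2 (comb w y) z \<noteq> 0 \<and> \<theta> z = poly2 (comb v x) z / poly2 (comb w y) z"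
    proof
      fix z assume z: "z \<in> bidisk"
      have "poly2 (comb w y) z \<noteq> 0"
        using nz[of "fst z" "snd z"] z by (cases z) (simp add: poly2_comb bidisk_iff)
      thus "poly2 (comb w y) z \<noteq> 0 \<and> \<theta> z = poly2 (comb v x) z / poly2 (comb w y) z"
        using eq[OF z] \<Theta>(2) by (simp add: eq_divide_eq)
    qed
    moreover have "max (degree_z2 (comb v x)) (degree_z2 (comb w y)) = n"
      by (simp add: n m_def degree_z2_def degree_comb)
    ultimately have "rational_inner_of_degree \<theta> (max (degree_z1 (comb v x)) (degree_z1 (comb w y)), n)"
      unfolding rational_inner_of_degree_def using assms(2) cop by blast
    \<comment> \<open>The z1-degree 0 arises when x and y both vanish, that is when theta depends on
      z2 alone.\<close>
    moreover have "max (degree_z1 (comb v x)) (degree_z1 (comb w y)) \<in> {0, 1}"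
      by (simp add: degree_z1_comb)
    ultimately show ?D by auto
  next
    assume ?D
    then obtain p q where pq: "coprime p q"
      "\<forall>z\<in>bidisk. poly2 q z \<noteq> 0 \<and> \<theta> z = poly2 p z / poly2 q z"
      "max (degree_z1 p) (degree_z1 q) \<le> 1" "n = max (degree_z2 p) (degree_z2 q)"
      unfolding rational_inner_of_degree_def by force
    obtain v x where p: "p = comb v x" by (rule comb_exists[of p]) (use pq(3) in auto)
    obtain w y where q: "q = comb w y" by (rule comb_exists[of q]) (use pq(3) in auto)
    have nz: "poly w z2 + z1 * poly y z2 \<noteq> 0" if "cmod z1 < 1" "cmod z2 < 1" for z1 z2
      using pq(2)[rule_format, of "(z1, z2)"] that by (simp add: q poly2_comb bidisk_iff)
    have t: "moebius (fps_of_poly v) (fps_of_poly x) (fps_of_poly w) (fps_of_poly y)"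
      unfolding moebius_iff_pointwise[OF \<Theta>(1)] using pq(2) by (simp add: p q \<Theta>(2))
    have n: "n = max (max (degree v) (degree x)) (max (degree w) (degree y))"
      using pq(4) by (simp add: p q degree_z2_def degree_comb)
    show ?R
      unfolding \<Theta>(2) has_rank_iff[OF \<Theta>(1)]
      using has_basis_iff[OF rank_le_iff_degree[OF pq(1)[unfolded p q] nz t n], of n] by blast
  qed
qed

end
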